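(* Let $A,B\in\mathcal{S}_n$ be such that $A-B$ has inertia $(p,q,0)$ (so $p+q=n$), and let $\mathcal{U},\mathcal{V}$ be subspaces of $\mathbb{R}^n$. Consider the problem of finding $C\in\mathcal{S}_n$ such that $C$ is a maximal lower bound of $A$ and $B$ in the Löwner order, $Cu=Bu$ for all $u\in\mathcal{U}$, and $Cv=Av$ for all $v\in\mathcal{V}$. Then: (1) This problem has a solution if and only if $A-B$ is positive definite over $\mathcal{U}$, $A-B$ is negative definite over $\mathcal{V}$, and $u^T(A-B)v=0$ for all $u\in\mathcal{U}$, $v\in\mathcal{V}$. (2) Suppose moreover $A-B = J_{p,q}$ and these conditions hold. Let $\mathcal{W}\subseteq\mathcal{M}_{p,q}$ be the affine subspace of matrices $R$ such that $R^T\pi_p(u)+\pi_q(u)=0$ for all $u\in\mathcal{U}$ and $R\pi_q(v)+\pi_p(v)=0$ for all $v\in\mathcal{V}$. Then $\mathcal{B}_{p,q}\cap\mathcal{W}$ is nonempty, and the solutions $C$ are exactly the matrices $$C = A - S(I_p\oplus 0_q)S,\qquad S=\begin{pmatrix}(I_p+MM^T)^{1/2} & M\\ M^T & (I_q+M^TM)^{1/2}\end{pmatrix},$$ with $M\in\phi_{p,q}^{-1}(\mathcal{B}_{p,q}\cap\mathcal{W})$, distinct such $M$ giving distinct $C$. The affine subspace $\mathcal{W}$ has dimension $(p-\dim\mathcal{U})(q-\dim\mathcal{V})$; in particular the solution is unique if and only if $\dim\mathcal{U}=p$ or $\dim\mathcal{V}=q$.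
   Context: $\mathcal{S}_n$ is the set of real symmetric $n\times n$ matrices and $\mathcal{M}_{p,q}$ the set of real $p\times q$ matrices. Löwner order: $X\preceq Y$ iff $x^TXx\le x^TYx$ for all $x$; a maximal lower bound of $A,B$ is a $C$ with $C\preceq A$, $C\preceq B$ such that no $C'\ne C$ with $C\preceq C'$ satisfies $C'\preceq A$, $C'\preceq B$. Inertia $(p,q,r)$: numbers of positive, negative, zero eigenvalues. A symmetric $N$ is positive (negative) definite over a subspace $\mathcal{X}$ if $x^TNx>0$ ($<0$) for all nonzero $x\in\mathcal{X}$. $J_{p,q}=I_p\oplus(-I_q)$ (block diagonal). $\pi_p:\mathbb{R}^n\to\mathbb{R}^p$ selects the first $p$ coordinates and $\pi_q:\mathbb{R}^n\to\mathbb{R}^q$ the last $q$ coordinates. $\|\cdot\|$ is the spectral norm and $\mathcal{B}_{p,q}=\{X\in\mathcal{M}_{p,q}:\|X\|<1\}$. $\phi_{p,q}:\mathcal{M}_{p,q}\to\mathcal{B}_{p,q}$, $\phi_{p,q}(X)=(I_p+XX^T)^{-1/2}X$, is a bijection. $X^{1/2}$ denotes the positive semidefinite square root. *)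

theory Defs
  imports "Jordan_Normal_Form.Char_Poly"
begin

definition sym_mats :: "nat \<Rightarrow> real mat set" where
  "sym_mats n = {A. A \<in> carrier_mat n n \<and> transpose_mat A = A}"

definition qform :: "real mat \<Rightarrow> real vec \<Rightarrow> real" where
  "qform N x = x \<bullet> (N *\<^sub>v x)"

definition loewner_le :: "nat \<Rightarrow> real mat \<Rightarrow> real mat \<Rightarrow> bool" where
  "loewner_le n X Y \<longleftrightarrow> (\<forall>x \<in> carrier_vec n. qform X x \<le> qform Y x)"

definition max_lower_bound :: "nat \<Rightarrow> real mat \<Rightarrow> real mat \<Rightarrow> real mat \<Rightarrow> bool" where
  "max_lower_bound n A B C \<longleftrightarrow>
     C \<in> sym_mats n \<and> loewner_le n C A \<and> loewner_le n C B \<and>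
     (\<forall>C' \<in> sym_mats n. C' \<noteq> C \<longrightarrow> loewner_le n C C' \<longrightarrow>
        \<not> (loewner_le n C' A \<and> loewner_le n C' B))"

definition inertia :: "real mat \<Rightarrow> nat \<times> nat \<times> nat" where
  "inertia N =
     ((\<Sum>a \<in> {a. a > 0 \<and> poly (char_poly N) a = 0}. order a (char_poly N)),
      (\<Sum>a \<in> {a. a < 0 \<and> poly (char_poly N) a = 0}. order a (char_poly N)),
      order 0 (char_poly N))"

definition subspace_n :: "nat \<Rightarrow> real vec set \<Rightarrow> bool" where
  "subspace_n n U \<longleftrightarrow> U \<subseteq> carrier_vec n \<and> 0\<^sub>v n \<in> U \<and>
     (\<forall>u \<in> U. \<forall>v \<in> U. u + v \<in> U) \<and> (\<forall>c. \<forall>u \<in> U. c \<cdot>\<^sub>v u \<in> U)"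

definition pos_def_over :: "nat \<Rightarrow> real mat \<Rightarrow> real vec set \<Rightarrow> bool" where
  "pos_def_over n N X \<longleftrightarrow> (\<forall>x \<in> X. x \<noteq> 0\<^sub>v n \<longrightarrow> qform N x > 0)"

definition neg_def_over :: "nat \<Rightarrow> real mat \<Rightarrow> real vec set \<Rightarrow> bool" where
  "neg_def_over n N X \<longleftrightarrow> (\<forall>x \<in> X. x \<noteq> 0\<^sub>v n \<longrightarrow> qform N x < 0)"

definition lin_indep_vecs :: "nat \<Rightarrow> real vec set \<Rightarrow> bool" where
  "lin_indep_vecs n S \<longleftrightarrow> finite S \<and>
     (\<forall>c. (\<forall>i<n. (\<Sum>v\<in>S. c v * v $ i) = 0) \<longrightarrow> (\<forall>v\<in>S. c v = 0))"

definition dim_vecs :: "nat \<Rightarrow> real vec set \<Rightarrow> nat" where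
  "dim_vecs n X = Max {card S | S. S \<subseteq> X \<and> lin_indep_vecs n S}"

definition lin_indep_mats :: "nat \<Rightarrow> nat \<Rightarrow> real mat set \<Rightarrow> bool" where
  "lin_indep_mats p q S \<longleftrightarrow> finite S \<and>
     (\<forall>c. (\<forall>i<p. \<forall>j<q. (\<Sum>M\<in>S. c M * M $$ (i,j)) = 0) \<longrightarrow> (\<forall>M\<in>S. c M = 0))"

definition dim_mats :: "nat \<Rightarrow> nat \<Rightarrow> real mat set \<Rightarrow> nat" where
  "dim_mats p q X = Max {card S | S. S \<subseteq> X \<and> lin_indep_mats p q S}"

definition affine_dim_mats :: "nat \<Rightarrow> nat \<Rightarrow> real mat set \<Rightarrow> nat" where
  "affine_dim_mats p q W = dim_mats p q {X - Y | X Y. X \<in> W \<and> Y \<in> W}"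

definition J_mat :: "nat \<Rightarrow> nat \<Rightarrow> real mat" where
  "J_mat p q = four_block_mat (1\<^sub>m p) (0\<^sub>m p q) (0\<^sub>m q p) (- 1\<^sub>m q)"

definition proj_first :: "nat \<Rightarrow> real vec \<Rightarrow> real vec" where
  "proj_first p u = vec p (\<lambda>i. u $ i)"

definition proj_last :: "nat \<Rightarrow> real vec \<Rightarrow> real vec" where
  "proj_last q u = vec q (\<lambda>i. u $ (dim_vec u - q + i))"

definition vnorm :: "real vec \<Rightarrow> real" where
  "vnorm x = sqrt (x \<bullet> x)"

definition spec_norm :: "real mat \<Rightarrow> real" where
  "spec_norm X = Sup (insert 0 {vnorm (X *\<^sub>v x) | x. x \<in> carrier_vec (dim_col X) \<and> vnorm x = 1})"

definition unit_ball_mats :: "nat \<Rightarrow> nat \<Rightarrow> real mat set" where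
  "unit_ball_mats p q = {X. X \<in> carrier_mat p q \<and> spec_norm X < 1}"

definition psd :: "real mat \<Rightarrow> bool" where
  "psd Y \<longleftrightarrow> (\<forall>x \<in> carrier_vec (dim_row Y). qform Y x \<ge> 0)"

definition psd_sqrt :: "real mat \<Rightarrow> real mat" where
  "psd_sqrt X = (THE Y. Y \<in> sym_mats (dim_row X) \<and> psd Y \<and> Y * Y = X)"

definition inv_psd_sqrt :: "real mat \<Rightarrow> real mat" where
  "inv_psd_sqrt X = (THE Y. Y \<in> sym_mats (dim_row X) \<and> psd Y \<and> Y * Y * X = 1\<^sub>m (dim_row X))"

definition phi_pq :: "nat \<Rightarrow> nat \<Rightarrow> real mat \<Rightarrow> real mat" where
  "phi_pq p q X = inv_psd_sqrt (1\<^sub>m p + X * transpose_mat X) * X"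

definition S_mat :: "nat \<Rightarrow> nat \<Rightarrow> real mat \<Rightarrow> real mat" where
  "S_mat p q M = four_block_mat
      (psd_sqrt (1\<^sub>m p + M * transpose_mat M)) M
      (transpose_mat M) (psd_sqrt (1\<^sub>m q + transpose_mat M * M))"

definition E_mat :: "nat \<Rightarrow> nat \<Rightarrow> real mat" where
  "E_mat p q = four_block_mat (1\<^sub>m p) (0\<^sub>m p q) (0\<^sub>m q p) (0\<^sub>m q q)"

definition is_solution :: "nat \<Rightarrow> real mat \<Rightarrow> real mat \<Rightarrow> real vec set \<Rightarrow> real vec set \<Rightarrow> real mat \<Rightarrow> bool" where
  "is_solution n A B U V C \<longleftrightarrow> max_lower_bound n A B C \<and>
     (\<forall>u \<in> U. C *\<^sub>v u = B *\<^sub>v u) \<and> (\<forall>v \<in> V. C *\<^sub>v v = A *\<^sub>v v)"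

definition W_set :: "nat \<Rightarrow> nat \<Rightarrow> real vec set \<Rightarrow> real vec set \<Rightarrow> real mat set" where
  "W_set p q U V = {R. R \<in> carrier_mat p q \<and>
     (\<forall>u \<in> U. transpose_mat R *\<^sub>v proj_first p u + proj_last q u = 0\<^sub>v q) \<and>
     (\<forall>v \<in> V. R *\<^sub>v proj_last q v + proj_first p v = 0\<^sub>v p)}"

end

theory Submission
  imports Defs "HOL-Computational_Algebra.Fundamental_Theorem_Algebra"
begin

text \<open>
  Put \<open>N = A - B\<close> and \<open>Y = A - C\<close>. Then \<open>C\<close> is a maximal lower bound iff \<open>Y\<close> is minimal subject to
  \<open>Y \<succeq> 0\<close> and \<open>Y \<succeq> N\<close>, and the interpolation conditions read \<open>Y v = 0\<close> on \<open>V\<close> and \<open>Y u = N u\<close> on \<open>U\<close>.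
  If \<open>u\<close> is isotropic for a positive semidefinite matrix it lies in its kernel; this gives necessity in (1).
  For sufficiency, \<open>N\<close>-orthonormal bases of \<open>U\<close> and \<open>V\<close> together extend to one of the whole space, and
  \<open>Y\<close> is the sum of the \<open>(N w) (N w)\<^sup>T\<close> over the basis vectors \<open>w\<close> with \<open>w\<^sup>T N w = 1\<close>.

  For \<open>N = J\<close>, minimality forces the images of \<open>Y\<close> and \<open>Y - J\<close> to meet only in \<open>0\<close>, hence \<open>Y J Y = Y\<close>. Comparing
  blocks yields \<open>Y = S (I \<oplus> 0) S\<close>, where \<open>M\<close> is read off from the square root of the upper left block.
  With \<open>P\<close>, \<open>Q\<close> the diagonal blocks of \<open>S\<close> and \<open>x = (a, b)\<close>, one has \<open>Y x = 0\<close> iff \<open>P a + M b = 0\<close> and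
  \<open>(Y - J) x = 0\<close> iff \<open>M\<^sup>T a + Q b = 0\<close>; multiplying by \<open>P\<close>, \<open>Q\<close> inverse turns this into \<open>\<phi>(M) \<in> W\<close>.
\<close>

section \<open>Orthonormal systems of a symmetric form\<close>

text \<open>Geometrically, \<open>J Y\<close> is a \<open>J\<close>-orthogonal projection: the
  kernel of \<open>Y - J\<close> is the graph of all (a, -R^T a), the kernel of \<open>Y\<close> the
  graph of all (-R b, b), for one strict contraction R = phi(M). The two graphs are
  \<open>J\<close>-orthogonal complements, so a single R describes both; placing \<open>U\<close> in
  the first and \<open>V\<close> in the second gives equations affine in R, which is where
  \<open>W\<close> comes from. \<open>S\<close> is a hyperbolic rotation, \<open>S J S = J\<close>,
  so \<open>Y\<close> and \<open>Y - J\<close> are both semidefinite and their kernels span the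
  space, which makes \<open>Y\<close> minimal. Two claims of (2) are not visible in this picture.
  That \<open>W\<close> meets the ball is a contraction extension problem; it is settled indirectly,
  since (1) provides a solution and every solution has the stated form. Uniqueness uses that the
  ball is open: a small step along a nonzero direction of \<open>W\<close> stays inside and gives a
  second solution. The algebraic core is that \<open>P D + D Q = 0\<close> forces
  \<open>D = 0\<close> for \<open>P\<close> semidefinite and \<open>Q\<close> definite. It gives
  uniqueness of square roots, the relation between \<open>P\<close>, \<open>M\<close> and
  \<open>Q\<close>, and cancellation of definite factors.\<close>

lemma linear_system_nontrivial_kernel:
  fixes a :: "'s \<Rightarrow> 't \<Rightarrow> real"
  assumes "finite T" "finite S" "card T < card S"
  shows "\<exists>c. (\<exists>s\<in>S. c s \<noteq> 0) \<and> (\<forall>t\<in>T. (\<Sum>s\<in>S. c s * a s t) = 0)"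
  using assms
proof (induction T arbitrary: S a rule: finite_induct)
  case empty
  then have "S \<noteq> {}" by auto
  then show ?case by (intro exI[of _ "\<lambda>_. 1"]) auto
next
  case (insert t T)
  show ?case
  proof (cases "\<forall>s\<in>S. a s t = 0")
    case True
    from insert.IH[of S a] insert.prems insert.hyps obtain c where
      c: "\<exists>s\<in>S. c s \<noteq> 0" "\<forall>t\<in>T. (\<Sum>s\<in>S. c s * a s t) = 0" by auto
    moreover have "(\<Sum>s\<in>S. c s * a s t) = 0" using True by simp
    ultimately show ?thesis by auto
  next
    case False
    then obtain s0 where s0: "s0 \<in> S" "a s0 t \<noteq> 0" by auto
    \<comment> \<open>Gaussian elimination with pivot \<open>s0\<close>: \<open>a' s t = 0\<close>
      for every \<open>s\<close>, so the remaining unknowns only have to satisfy the equations in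
      \<open>T\<close>; the weight \<open>k\<close> of \<open>s0\<close> is then solved from
      equation \<open>t\<close>.\<close>
    define S' where "S' = S - {s0}"
    define a' where "a' s u = a s u - a s t / a s0 t * a s0 u" for s u
    have fS': "finite S'" using insert.prems S'_def by auto
    have "card S' = card S - 1" using s0 insert.prems by (simp add: S'_def)
    then have "card T < card S'" using insert.prems insert.hyps by simp
    from insert.IH[OF fS' this, of a'] obtain c where
      c: "\<exists>s\<in>S'. c s \<noteq> 0" "\<forall>u\<in>T. (\<Sum>s\<in>S'. c s * a' s u) = 0" by auto
    define k where "k = - (\<Sum>s\<in>S'. c s * a s t) / a s0 t"
    define d where "d s = (if s = s0 then k else c s)" for s
    have sum_eq: "(\<Sum>s\<in>S. d s * a s u) = k * a s0 u + (\<Sum>s\<in>S'. c s * a s u)" for u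
    proof -
      have "(\<Sum>s\<in>S. d s * a s u) = d s0 * a s0 u + (\<Sum>s\<in>S'. d s * a s u)"
        unfolding S'_def using s0 insert.prems by (simp add: sum.remove)
      also have "(\<Sum>s\<in>S'. d s * a s u) = (\<Sum>s\<in>S'. c s * a s u)"
        by (intro sum.cong) (auto simp: S'_def d_def)
      finally show ?thesis by (simp add: d_def)
    qed
    have "(\<Sum>s\<in>S. d s * a s u) = 0" if "u \<in> T" for u
    proof -
      have "0 = (\<Sum>s\<in>S'. c s * a' s u)" using c that by simp
      also have "\<dots> = (\<Sum>s\<in>S'. c s * a s u - (c s * a s t) * (a s0 u / a s0 t))"
        by (simp add: a'_def algebra_simps)
      also have "\<dots> = (\<Sum>s\<in>S'. c s * a s u) - (\<Sum>s\<in>S'. c s * a s t) * (a s0 u / a s0 t)"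
        by (simp only: sum_subtractf sum_distrib_right)
      finally show ?thesis unfolding sum_eq k_def by simp
    qed
    moreover have "(\<Sum>s\<in>S. d s * a s t) = 0"
      unfolding sum_eq k_def using s0 by simp
    moreover have "\<exists>s\<in>S. d s \<noteq> 0" using c(1) unfolding S'_def d_def by auto
    ultimately show ?thesis by (intro exI[of _ d]) auto
  qed
qed

text \<open>Indexed by a set \<open>K\<close> with a separate family \<open>g\<close>, so that the
  image of a combination under a matrix again has this shape, even when distinct basis vectors have
  equal images.\<close>

definition lincomb :: "nat \<Rightarrow> 'a set \<Rightarrow> ('a \<Rightarrow> real) \<Rightarrow> ('a \<Rightarrow> real vec) \<Rightarrow> real vec" where
  "lincomb n K f g = vec n (\<lambda>i. \<Sum>k\<in>K. f k * g k $ i)"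

definition bil :: "real mat \<Rightarrow> real vec \<Rightarrow> real vec \<Rightarrow> real" where
  "bil N x y = x \<bullet> (N *\<^sub>v y)"

lemma lincomb_carrier[simp]: "lincomb n K f g \<in> carrier_vec n"
  by (simp add: lincomb_def)

lemma index_lincomb[simp]: "i < n \<Longrightarrow> lincomb n K f g $ i = (\<Sum>k\<in>K. f k * g k $ i)"
  "dim_vec (lincomb n K f g) = n"
  by (auto simp: lincomb_def)

lemma lincomb_insert:
  assumes "finite K" "k \<notin> K" "g k \<in> carrier_vec n"
  shows "lincomb n (insert k K) f g = f k \<cdot>\<^sub>v g k + lincomb n K f g"
  using assms by (intro eq_vecI) auto

lemma lincomb_empty: "lincomb n {} f g = 0\<^sub>v n"
  by (intro eq_vecI) auto

lemma subspace_lincomb: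
  assumes X: "subspace_n n X" and "finite K" "\<And>k. k \<in> K \<Longrightarrow> g k \<in> X"
  shows "lincomb n K f g \<in> X"
  using assms(2,3)
proof (induction K rule: finite_induct)
  case empty
  then show ?case using X by (simp add: lincomb_empty subspace_n_def)
next
  case (insert k K)
  have "g k \<in> carrier_vec n" using X insert by (auto simp: subspace_n_def)
  then show ?case using X insert by (simp add: lincomb_insert subspace_n_def)
qed

lemma subspace_minus:
  assumes X: "subspace_n n X" and "x \<in> X" "y \<in> X"
  shows "x - y \<in> X"
proof -
  have "x \<in> carrier_vec n" "y \<in> carrier_vec n" using assms by (auto simp: subspace_n_def)
  then have "x - y = x + (-1) \<cdot>\<^sub>v y" by (intro eq_vecI) auto
  then show ?thesis using assms by (auto simp: subspace_n_def)
qed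

lemma subspace_carrier: "subspace_n n (carrier_vec n)"
  by (auto simp: subspace_n_def)

lemma subspace_dim: "subspace_n n X \<Longrightarrow> x \<in> X \<Longrightarrow> x \<in> carrier_vec n"
  by (auto simp: subspace_n_def)

lemma mult_mat_vec_lincomb:
  assumes "N \<in> carrier_mat m n" "\<And>k. k \<in> K \<Longrightarrow> g k \<in> carrier_vec n"
  shows "N *\<^sub>v lincomb n K f g = lincomb m K f (\<lambda>k. N *\<^sub>v g k)"
proof (rule eq_vecI)
  fix i assume "i < dim_vec (lincomb m K f (\<lambda>k. N *\<^sub>v g k))"
  then have i: "i < m" by simp
  have "(N *\<^sub>v lincomb n K f g) $ i = (\<Sum>j<n. \<Sum>k\<in>K. N $$ (i,j) * (f k * g k $ j))"
    using assms(1) i by (auto simp: scalar_prod_def sum_distrib_left atLeast0LessThan)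
  also have "\<dots> = (\<Sum>k\<in>K. \<Sum>j<n. N $$ (i,j) * (f k * g k $ j))" by (rule sum.swap)
  also have "\<dots> = (\<Sum>k\<in>K. f k * (\<Sum>j<n. N $$ (i,j) * g k $ j))"
    by (simp add: sum_distrib_left mult.left_commute)
  also have "\<dots> = (\<Sum>k\<in>K. f k * (N *\<^sub>v g k) $ i)"
  proof (intro sum.cong refl)
    fix k assume "k \<in> K"
    then have "dim_vec (g k) = n" using assms(2) by (auto simp: carrier_vecD)
    then show "f k * (\<Sum>j<n. N $$ (i,j) * g k $ j) = f k * (N *\<^sub>v g k) $ i"
      using assms(1) i by (auto simp: scalar_prod_def atLeast0LessThan)
  qed
  finally show "(N *\<^sub>v lincomb n K f g) $ i = lincomb m K f (\<lambda>k. N *\<^sub>v g k) $ i"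
    using i by simp
qed (use assms in auto)

lemma scalar_prod_lincomb:
  assumes "x \<in> carrier_vec n" "\<And>k. k \<in> K \<Longrightarrow> g k \<in> carrier_vec n"
  shows "x \<bullet> lincomb n K f g = (\<Sum>k\<in>K. f k * (x \<bullet> g k))"
proof -
  have "x \<bullet> lincomb n K f g = (\<Sum>j<n. \<Sum>k\<in>K. x $ j * (f k * g k $ j))"
    by (auto simp: scalar_prod_def sum_distrib_left atLeast0LessThan)
  also have "\<dots> = (\<Sum>k\<in>K. \<Sum>j<n. x $ j * (f k * g k $ j))" by (rule sum.swap)
  also have "\<dots> = (\<Sum>k\<in>K. f k * (\<Sum>j<n. x $ j * g k $ j))"
    by (simp add: sum_distrib_left mult.left_commute)
  also have "\<dots> = (\<Sum>k\<in>K. f k * (x \<bullet> g k))"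
    using assms by (intro sum.cong refl) (force simp: scalar_prod_def atLeast0LessThan)
  finally show ?thesis .
qed

lemma sym_matsD: "N \<in> sym_mats n \<Longrightarrow> N \<in> carrier_mat n n" "N \<in> sym_mats n \<Longrightarrow> transpose_mat N = N"
  by (auto simp: sym_mats_def)

lemma scalar_prod_mult_mat_vec:
  fixes N :: "real mat"
  assumes "N \<in> carrier_mat m n" "x \<in> carrier_vec m" "y \<in> carrier_vec n"
  shows "x \<bullet> (N *\<^sub>v y) = (transpose_mat N *\<^sub>v x) \<bullet> y"
  using transpose_vec_mult_scalar[OF assms(1,3,2)] by simp

lemma bil_commute:
  assumes N: "N \<in> sym_mats n" and "x \<in> carrier_vec n" "y \<in> carrier_vec n"
  shows "bil N x y = bil N y x"
proof -
  have "bil N x y = (N *\<^sub>v x) \<bullet> y"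
    using scalar_prod_mult_mat_vec[of N n n x y] assms sym_matsD[OF N] by (simp add: bil_def)
  also have "\<dots> = bil N y x"
    using assms sym_matsD[OF N] by (auto simp: bil_def intro!: comm_scalar_prod[of _ n])
  finally show ?thesis .
qed

lemma bil_add:
  assumes N: "N \<in> carrier_mat n n" and "x \<in> carrier_vec n" "y \<in> carrier_vec n" "z \<in> carrier_vec n"
  shows "bil N x (y + z) = bil N x y + bil N x z" "bil N (y + z) x = bil N y x + bil N z x"
  using assms by (auto simp: bil_def mult_add_distrib_mat_vec scalar_prod_add_distrib[of _ n]
      add_scalar_prod_distrib[of _ n])

lemma bil_minus:
  assumes N: "N \<in> carrier_mat n n" and "x \<in> carrier_vec n" "y \<in> carrier_vec n" "z \<in> carrier_vec n"
  shows "bil N x (y - z) = bil N x y - bil N x z" "bil N (y - z) x = bil N y x - bil N z x"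
  using assms by (auto simp: bil_def mult_minus_distrib_mat_vec scalar_prod_minus_distrib[of _ n]
      minus_scalar_prod_distrib[of _ n])

lemma bil_smult:
  assumes N: "N \<in> carrier_mat n n" and "x \<in> carrier_vec n" "y \<in> carrier_vec n"
  shows "bil N x (c \<cdot>\<^sub>v y) = c * bil N x y" "bil N (c \<cdot>\<^sub>v y) x = c * bil N y x"
  using assms by (auto simp: bil_def mult_mat_vec)

lemma bil_zero[simp]:
  assumes N: "N \<in> carrier_mat n n" and "x \<in> carrier_vec n"
  shows "bil N x (0\<^sub>v n) = 0" "bil N (0\<^sub>v n) x = 0"
proof -
  have "N *\<^sub>v 0\<^sub>v n = 0\<^sub>v n" using N by (intro eq_vecI) auto
  then show "bil N x (0\<^sub>v n) = 0" "bil N (0\<^sub>v n) x = 0" using assms by (auto simp: bil_def)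
qed

lemma bil_lincomb:
  assumes N: "N \<in> carrier_mat n n" and "x \<in> carrier_vec n" "\<And>k. k \<in> K \<Longrightarrow> g k \<in> carrier_vec n"
  shows "bil N x (lincomb n K f g) = (\<Sum>k\<in>K. f k * bil N x (g k))"
  unfolding bil_def using assms
  by (subst mult_mat_vec_lincomb) (auto simp: scalar_prod_lincomb)

text \<open>The form may be indefinite, so the members have square 1 or -1; with
  \<open>1\<^sub>m n\<close> as the form this is ordinary orthonormality.\<close>

definition orthonormal_wrt :: "nat \<Rightarrow> real mat \<Rightarrow> real vec set \<Rightarrow> bool" where
  "orthonormal_wrt n N S \<longleftrightarrow> S \<subseteq> carrier_vec n \<and>
     (\<forall>v\<in>S. \<forall>w\<in>S. v \<noteq> w \<longrightarrow> bil N v w = 0) \<and> (\<forall>w\<in>S. \<bar>bil N w w\<bar> = 1)"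

lemma orthonormal_wrt_sum:
  assumes "orthonormal_wrt n N S" "finite S" "v \<in> S"
  shows "(\<Sum>w\<in>S. f w * bil N v w) = f v * bil N v v"
proof -
  have "(\<Sum>w\<in>S. f w * bil N v w) = (\<Sum>w\<in>S. if w = v then f v * bil N v v else 0)"
    using assms by (intro sum.cong) (auto simp: orthonormal_wrt_def)
  then show ?thesis using assms by simp
qed

text \<open>More than \<open>n\<close> members would satisfy a linear relation; pairing it with a
  member \<open>s\<close> of nonzero coefficient leaves \<open>c s * bil N s s = 0\<close>, although
  \<open>bil N s s\<close> is 1 or -1. The bound allows systems of greatest cardinality to be chosen
  in place of an iterated Gram-Schmidt process.\<close>

lemma orthonormal_wrt_finite_card:
  assumes S: "orthonormal_wrt n N S" and N: "N \<in> carrier_mat n n"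
  shows "finite S" "card S \<le> n"
proof -
  \<comment> \<open>Finite subsets come first: an infinite set has \<open>card\<close> 0, so a bound
    on \<open>card S\<close> alone would not give finiteness.\<close>
  have le: "card T \<le> n" if T: "finite T" "T \<subseteq> S" for T
  proof (rule ccontr)
    assume "\<not> card T \<le> n"
    then have "card {..<n} < card T" by simp
    from linear_system_nontrivial_kernel[OF _ T(1) this, of "\<lambda>w i. w $ i"] obtain c s where
      c: "s \<in> T" "c s \<noteq> 0" "\<forall>i<n. (\<Sum>w\<in>T. c w * w $ i) = 0" by auto
    have oT: "orthonormal_wrt n N T" using S T(2) unfolding orthonormal_wrt_def by blast
    have *: "T \<subseteq> carrier_vec n" using oT unfolding orthonormal_wrt_def by blast
    have "lincomb n T c (\<lambda>w. w) = 0\<^sub>v n" using c(3) by (intro eq_vecI) auto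
    then have "bil N s (lincomb n T c (\<lambda>w. w)) = 0" using * c(1) N by auto
    then have "c s * bil N s s = 0"
      using * c(1) N by (subst (asm) bil_lincomb) (auto simp: orthonormal_wrt_sum[OF oT T(1)])
    then show False using oT c by (auto simp: orthonormal_wrt_def)
  qed
  show fin: "finite S"
  proof (rule ccontr)
    assume "infinite S"
    then obtain T where "T \<subseteq> S" "finite T" "card T = Suc n"
      using infinite_arbitrarily_large by metis
    then show False using le[of T] by simp
  qed
  show "card S \<le> n" using le[of S] fin by simp
qed

text \<open>The hypothesis on \<open>X\<close> holds both when \<open>N\<close> is definite on \<open>X\<close> and when \<open>N\<close> is nonsingular and \<open>X\<close> is everything.\<close>
lemma orthonormal_wrt_extend:
  assumes N: "N \<in> sym_mats n" and X: "subspace_n n X" and S: "orthonormal_wrt n N S" "S \<subseteq> X"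
    and nd: "\<And>x. x \<in> X \<Longrightarrow> x \<noteq> 0\<^sub>v n \<Longrightarrow> \<exists>y\<in>X. bil N x y \<noteq> 0"
  shows "\<exists>T. S \<subseteq> T \<and> T \<subseteq> X \<and> orthonormal_wrt n N T \<and>
    (\<forall>x\<in>X. (\<forall>w\<in>T. bil N w x = 0) \<longrightarrow> x = 0\<^sub>v n)"
proof -
  note Nc = sym_matsD(1)[OF N]
  note Xc = subspace_dim[OF X]
  define P where "P T \<longleftrightarrow> S \<subseteq> T \<and> T \<subseteq> X \<and> orthonormal_wrt n N T" for T
  have "P S" using S by (simp add: P_def)
  moreover have "\<forall>T. P T \<longrightarrow> card T < Suc n"
    using orthonormal_wrt_finite_card(2)[OF _ Nc] by (auto simp: P_def less_Suc_eq_le)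
  ultimately obtain T where T: "P T" and max: "\<And>T'. P T' \<Longrightarrow> card T' \<le> card T"
    using ex_has_greatest_nat[of P S card "Suc n"] by blast
  have oT: "orthonormal_wrt n N T" "T \<subseteq> X" using T by (auto simp: P_def)
  have finT: "finite T" using orthonormal_wrt_finite_card(1)[OF oT(1) Nc] .
  have Tc: "w \<in> carrier_vec n" if "w \<in> T" for w using oT Xc that by auto
  have "x = 0\<^sub>v n" if x: "x \<in> X" "\<forall>w\<in>T. bil N w x = 0" for x
  proof (rule ccontr)
    assume "x \<noteq> 0\<^sub>v n"
    then obtain y where y: "y \<in> X" "bil N x y \<noteq> 0" using nd x by auto
    \<comment> \<open>\<open>z\<close> is the part of \<open>y\<close> orthogonal to
      \<open>T\<close>. Multiplying by \<open>bil N w w\<close> replaces dividing by it, since this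
      sign is its own inverse.\<close>
    define l where "l = lincomb n T (\<lambda>w. bil N w w * bil N w y) (\<lambda>w. w)"
    define z where "z = y - l"
    have lX: "l \<in> X" unfolding l_def using oT finT by (intro subspace_lincomb[OF X]) auto
    then have zX: "z \<in> X" unfolding z_def using y subspace_minus[OF X] by auto
    have orth_z: "bil N w z = 0" if w: "w \<in> T" for w
    proof -
      have "bil N w l = (bil N w w * bil N w w) * bil N w y"
        unfolding l_def using w Tc Nc
        by (subst bil_lincomb) (auto simp: orthonormal_wrt_sum[OF oT(1) finT])
      also have "bil N w w * bil N w w = 1"
        using oT(1) w by (auto simp: orthonormal_wrt_def abs_if split: if_splits)
      finally show ?thesis
        unfolding z_def using w Tc Nc y lX Xc by (simp add: bil_minus)
    qed
    have "bil N x l = (\<Sum>w\<in>T. (bil N w w * bil N w y) * bil N x w)"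
      unfolding l_def using Tc Nc x Xc by (subst bil_lincomb) auto
    also have "\<dots> = 0" using x Tc Xc by (auto simp: bil_commute[OF N, of x] intro!: sum.neutral)
    finally have xz: "bil N x z \<noteq> 0"
      unfolding z_def using Nc x y Xc lX by (simp add: bil_minus)
    \<comment> \<open>Polarization: if every vector of \<open>X\<close> orthogonal to
      \<open>T\<close> were isotropic, so would be \<open>x\<close>, \<open>z\<close> and
      \<open>x + z\<close>, forcing \<open>2 * bil N x z = 0\<close>.\<close>
    have "\<exists>u\<in>X. bil N u u \<noteq> 0 \<and> (\<forall>w\<in>T. bil N w u = 0)"
    proof (rule ccontr)
      assume neg: "\<not> ?thesis"
      have "x + z \<in> X" using X x zX by (auto simp: subspace_n_def)
      moreover have "\<forall>w\<in>T. bil N w (x + z) = 0"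
        using Nc x zX Xc orth_z Tc by (auto simp: bil_add)
      ultimately have "bil N (x + z) (x + z) = 0" using neg by auto
      then have "bil N x x + bil N x z + (bil N z x + bil N z z) = 0"
        using Nc x zX Xc by (auto simp: bil_add)
      moreover have "bil N x x = 0" "bil N z z = 0" using neg x zX orth_z by auto
      moreover have "bil N z x = bil N x z" using bil_commute[OF N] x zX Xc by auto
      ultimately show False using xz by simp
    qed
    then obtain u where u: "u \<in> X" "bil N u u \<noteq> 0" "\<forall>w\<in>T. bil N w u = 0" by auto
    define r where "r = 1 / sqrt \<bar>bil N u u\<bar>"
    define v where "v = r \<cdot>\<^sub>v u"
    have vX: "v \<in> X" using u X by (auto simp: subspace_n_def v_def)
    have r2: "r * r = 1 / \<bar>bil N u u\<bar>" by (simp add: r_def)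
    have "bil N v v = r * r * bil N u u"
      using u Nc Xc by (simp add: v_def bil_smult)
    then have vv: "\<bar>bil N v v\<bar> = 1" using u(2) by (simp add: r2 abs_mult)
    have wv: "bil N w v = 0" "bil N v w = 0" if "w \<in> T" for w
      using that u Nc Xc Tc bil_commute[OF N, of w u] by (auto simp: v_def bil_smult)
    have "v \<notin> T" using wv vv by force
    have "orthonormal_wrt n N (insert v T)"
      using oT vv wv vX Xc unfolding orthonormal_wrt_def by auto
    then have "P (insert v T)" using T vX by (auto simp: P_def)
    from max[OF this] show False using finT \<open>v \<notin> T\<close> by simp
  qed
  then show ?thesis using T by (auto simp: P_def)
qed

text \<open>The difference of the two sides is orthogonal to \<open>T\<close>, because the signs
  \<open>bil N w w\<close> square to 1; completeness then makes it vanish.\<close>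

lemma orthonormal_wrt_expansion:
  assumes N: "N \<in> sym_mats n" and X: "subspace_n n X" and T: "orthonormal_wrt n N T" "T \<subseteq> X"
    and complete: "\<And>x. x \<in> X \<Longrightarrow> (\<And>w. w \<in> T \<Longrightarrow> bil N w x = 0) \<Longrightarrow> x = 0\<^sub>v n"
    and x: "x \<in> X"
  shows "x = lincomb n T (\<lambda>w. bil N w w * bil N w x) (\<lambda>w. w)"
proof -
  note Nc = sym_matsD(1)[OF N]
  note Xc = subspace_dim[OF X]
  have finT: "finite T" using orthonormal_wrt_finite_card(1)[OF T(1) Nc] .
  define l where "l = lincomb n T (\<lambda>w. bil N w w * bil N w x) (\<lambda>w. w)"
  have lX: "l \<in> X" unfolding l_def using T finT by (intro subspace_lincomb[OF X]) auto
  have "bil N w (x - l) = 0" if w: "w \<in> T" for w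
  proof -
    have "bil N w l = (bil N w w * bil N w w) * bil N w x"
      unfolding l_def using w T Xc Nc
      by (subst bil_lincomb) (auto simp: orthonormal_wrt_sum[OF T(1) finT])
    also have "bil N w w * bil N w w = 1"
      using T(1) w by (auto simp: orthonormal_wrt_def abs_if split: if_splits)
    finally show ?thesis
      using w T Nc x lX Xc by (subst bil_minus) auto
  qed
  then have 0: "x - l = 0\<^sub>v n" using complete[of "x - l"] subspace_minus[OF X x lX] by auto
  have "x = l"
  proof (rule eq_vecI)
    fix i assume "i < dim_vec l"
    then have i: "i < n" using Xc[OF lX] by simp
    then have "(x - l) $ i = 0" by (simp add: 0)
    then show "x $ i = l $ i" using Xc[OF lX] i by simp
  qed (use Xc[OF lX] Xc[OF x] in simp)
  then show ?thesis by (simp add: l_def)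
qed

section \<open>Eigenbases and square roots\<close>

lemma bil_one: "x \<in> carrier_vec n \<Longrightarrow> y \<in> carrier_vec n \<Longrightarrow> bil (1\<^sub>m n) x y = x \<bullet> y"
  by (simp add: bil_def)

abbreviation (input) orthonormal :: "nat \<Rightarrow> real vec set \<Rightarrow> bool" where
  "orthonormal n \<equiv> orthonormal_wrt n (1\<^sub>m n)"

lemma one_sym_mats[simp]: "1\<^sub>m n \<in> sym_mats n"
  by (simp add: sym_mats_def)

lemma scalar_prod_self_ge_0: "(x :: real vec) \<bullet> x \<ge> 0"
  by (auto simp: scalar_prod_def intro!: sum_nonneg)

lemma scalar_prod_self_eq_0:
  assumes "(x :: real vec) \<in> carrier_vec n"
  shows "x \<bullet> x = 0 \<longleftrightarrow> x = 0\<^sub>v n"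
proof
  assume "x \<bullet> x = 0"
  then have "\<forall>i<n. x $ i = 0"
    using assms by (auto simp: scalar_prod_def sum_nonneg_eq_0_iff)
  then show "x = 0\<^sub>v n" using assms by (intro eq_vecI) auto
qed (use assms in auto)

lemma scalar_prod_self_pos:
  assumes "(x :: real vec) \<in> carrier_vec n" "x \<noteq> 0\<^sub>v n"
  shows "x \<bullet> x > 0"
  using scalar_prod_self_eq_0[OF assms(1)] scalar_prod_self_ge_0[of x] assms(2) by linarith

lemma mat_eq_mult_vecI:
  fixes A B :: "real mat"
  assumes A: "A \<in> carrier_mat m n" and B: "B \<in> carrier_mat m n"
    and eq: "\<And>x. x \<in> carrier_vec n \<Longrightarrow> A *\<^sub>v x = B *\<^sub>v x"
  shows "A = B"
proof (rule eq_matI)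
  fix i j assume ij: "i < dim_row B" "j < dim_col B"
  have "(A *\<^sub>v unit_vec n j) $ i = (B *\<^sub>v unit_vec n j) $ i" by (simp add: eq)
  then show "A $$ (i,j) = B $$ (i,j)" using A B ij by simp
qed (use A B in auto)

lemma vec_eq_if_diff_0:
  assumes "(x :: real vec) \<in> carrier_vec n" "y \<in> carrier_vec n" "x - y = 0\<^sub>v n"
  shows "x = y"
proof (rule eq_vecI)
  fix i assume "i < dim_vec y"
  then have i: "i < n" using assms by simp
  have "(x - y) $ i = 0" using i by (simp add: assms(3))
  moreover have "(x - y) $ i = x $ i - y $ i" using assms(1,2) i by simp
  ultimately show "x $ i = y $ i" by simp
qed (use assms in simp)

text \<open>The characteristic polynomial has a complex root \<open>z\<close>. Writing an
  eigenvector as \<open>x + i y\<close>, symmetry of \<open>N\<close> applied to \<open>x\<close>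
  and \<open>y\<close> gives \<open>Im z * (x \<bullet> x + y \<bullet> y) = 0\<close>, so
  \<open>z\<close> is real and whichever of \<open>x\<close>, \<open>y\<close> is nonzero is a real
  eigenvector.\<close>

lemma sym_mat_eigenvector:
  assumes N: "N \<in> sym_mats m" and m: "m > 0"
  shows "\<exists>e c. c \<in> carrier_vec m \<and> c \<noteq> 0\<^sub>v m \<and> N *\<^sub>v c = e \<cdot>\<^sub>v c"
proof -
  note Nc = sym_matsD(1)[OF N]
  define G where "G = map_mat complex_of_real N"
  have Gc: "G \<in> carrier_mat m m" using Nc by (simp add: G_def)
  have "degree (char_poly G) = m" using degree_monic_char_poly[OF Gc] by simp
  then have "\<not> constant (poly (char_poly G))" using m by (simp add: constant_degree)
  from fundamental_theorem_of_algebra[OF this] obtain z where "poly (char_poly G) z = 0" by auto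
  then have "eigenvalue G z" using eigenvalue_root_char_poly[OF Gc] by simp
  then obtain v where v: "v \<in> carrier_vec m" "v \<noteq> 0\<^sub>v m" "G *\<^sub>v v = z \<cdot>\<^sub>v v"
    using Gc by (auto simp: eigenvalue_def eigenvector_def)
  define x where "x = map_vec Re v"
  define y where "y = map_vec Im v"
  have xc: "x \<in> carrier_vec m" and yc: "y \<in> carrier_vec m" using v by (auto simp: x_def y_def)
  have comp: "(\<Sum>j<m. of_real (N $$ (i,j)) * v $ j) = z * v $ i" if "i < m" for i
  proof -
    have "(G *\<^sub>v v) $ i = (z \<cdot>\<^sub>v v) $ i" using v by simp
    then show ?thesis using that v Nc by (simp add: G_def scalar_prod_def atLeast0LessThan)
  qed
  have Nx: "N *\<^sub>v x = Re z \<cdot>\<^sub>v x - Im z \<cdot>\<^sub>v y"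
  proof (rule eq_vecI)
    fix i assume "i < dim_vec (Re z \<cdot>\<^sub>v x - Im z \<cdot>\<^sub>v y)"
    then have i: "i < m" using yc by simp
    show "(N *\<^sub>v x) $ i = (Re z \<cdot>\<^sub>v x - Im z \<cdot>\<^sub>v y) $ i"
      using arg_cong[OF comp[OF i], of Re] i v Nc
      by (simp add: x_def y_def scalar_prod_def atLeast0LessThan)
  qed (use xc yc Nc in auto)
  have Ny: "N *\<^sub>v y = Re z \<cdot>\<^sub>v y + Im z \<cdot>\<^sub>v x"
  proof (rule eq_vecI)
    fix i assume "i < dim_vec (Re z \<cdot>\<^sub>v y + Im z \<cdot>\<^sub>v x)"
    then have i: "i < m" using xc by simp
    show "(N *\<^sub>v y) $ i = (Re z \<cdot>\<^sub>v y + Im z \<cdot>\<^sub>v x) $ i"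
      using arg_cong[OF comp[OF i], of Im] i v Nc
      by (simp add: x_def y_def scalar_prod_def atLeast0LessThan algebra_simps)
  qed (use xc yc Nc in auto)
  have "bil N x y = bil N y x" using bil_commute[OF N xc yc] .
  then have "x \<bullet> (Re z \<cdot>\<^sub>v y + Im z \<cdot>\<^sub>v x) = y \<bullet> (Re z \<cdot>\<^sub>v x - Im z \<cdot>\<^sub>v y)"
    by (simp add: bil_def Nx Ny)
  then have "Re z * (x \<bullet> y) + Im z * (x \<bullet> x) = Re z * (y \<bullet> x) - Im z * (y \<bullet> y)"
    using xc yc by (simp add: scalar_prod_add_distrib[of _ m] scalar_prod_minus_distrib[of _ m])
  then have *: "Im z * (x \<bullet> x + y \<bullet> y) = 0"
    using comm_scalar_prod[OF xc yc] by (simp add: algebra_simps)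
  have xy: "x \<noteq> 0\<^sub>v m \<or> y \<noteq> 0\<^sub>v m"
  proof (rule ccontr)
    assume "\<not> ?thesis"
    then have 0: "map_vec Re v = 0\<^sub>v m" "map_vec Im v = 0\<^sub>v m" by (auto simp: x_def y_def)
    have "v $ i = 0" if "i < m" for i
    proof -
      have "map_vec Re v $ i = 0" "map_vec Im v $ i = 0" using 0 that by simp_all
      then show ?thesis using v that by (simp add: complex_eq_iff)
    qed
    then have "v = 0\<^sub>v m" using v by (intro eq_vecI) auto
    then show False using v by simp
  qed
  then have "x \<bullet> x + y \<bullet> y > 0"
    using scalar_prod_self_pos[OF xc] scalar_prod_self_pos[OF yc]
      scalar_prod_self_ge_0[of x] scalar_prod_self_ge_0[of y] by linarith
  then have "Im z = 0" using * by simp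
  then have "N *\<^sub>v x = Re z \<cdot>\<^sub>v x" "N *\<^sub>v y = Re z \<cdot>\<^sub>v y"
    using xc yc unfolding Nx Ny by (auto intro!: eq_vecI)
  then show ?thesis using xy xc yc by blast
qed

lemma orthonormal_one:
  assumes "orthonormal n S"
  shows "w \<in> S \<Longrightarrow> w \<bullet> w = 1" "v \<in> S \<Longrightarrow> w \<in> S \<Longrightarrow> v \<noteq> w \<Longrightarrow> v \<bullet> w = 0"
    "w \<in> S \<Longrightarrow> w \<in> carrier_vec n" "finite S"
proof -
  show c: "w \<in> carrier_vec n" if "w \<in> S" for w
    using assms that by (auto simp: orthonormal_wrt_def)
  show "v \<bullet> w = 0" if "v \<in> S" "w \<in> S" "v \<noteq> w" for v w
  proof -
    have "bil (1\<^sub>m n) v w = 0" using assms that unfolding orthonormal_wrt_def by blast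
    then show ?thesis by (simp add: bil_one[OF c c, OF that(1,2)])
  qed
  show "w \<bullet> w = 1" if "w \<in> S"
  proof -
    have "\<bar>bil (1\<^sub>m n) w w\<bar> = 1" using assms that unfolding orthonormal_wrt_def by blast
    then have "\<bar>w \<bullet> w\<bar> = 1" by (simp add: bil_one[OF c c, OF that that])
    then show ?thesis using scalar_prod_self_ge_0[of w] by simp
  qed
  show "finite S" using orthonormal_wrt_finite_card[OF assms] by simp
qed

text \<open>Take an orthonormal set of eigenvectors of greatest size. Its orthogonal complement
  \<open>X\<close> is invariant under \<open>N\<close> by symmetry, so a nonzero \<open>X\<close>
  would contain one more eigenvector.\<close>

theorem sym_mat_eigenbasis:
  assumes N: "N \<in> sym_mats n"
  shows "\<exists>S ev. orthonormal n S \<and> (\<forall>w\<in>S. N *\<^sub>v w = ev w \<cdot>\<^sub>v w) \<and>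
    (\<forall>x\<in>carrier_vec n. x = lincomb n S (\<lambda>w. w \<bullet> x) (\<lambda>w. w))"
proof -
  note Nc = sym_matsD(1)[OF N]
  define P where "P S \<longleftrightarrow> orthonormal n S \<and> (\<forall>w\<in>S. \<exists>e. N *\<^sub>v w = e \<cdot>\<^sub>v w)" for S
  have "P {}" by (simp add: P_def orthonormal_wrt_def)
  moreover have "\<forall>T. P T \<longrightarrow> card T < Suc n"
    using orthonormal_wrt_finite_card(2)[of n "1\<^sub>m n"] by (auto simp: P_def less_Suc_eq_le)
  ultimately obtain S where S: "P S" and max: "\<And>T'. P T' \<Longrightarrow> card T' \<le> card S"
    using ex_has_greatest_nat[of P "{}" card "Suc n"] by blast
  have oS: "orthonormal n S" using S by (auto simp: P_def)
  note oS' = orthonormal_one[OF oS]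
  define X where "X = {x \<in> carrier_vec n. \<forall>w\<in>S. w \<bullet> x = 0}"
  have X: "subspace_n n X"
    using oS' by (auto simp: subspace_n_def X_def scalar_prod_add_distrib[of _ n])
  have inv: "N *\<^sub>v x \<in> X" if "x \<in> X" for x
  proof -
    have "w \<bullet> (N *\<^sub>v x) = 0" if w: "w \<in> S" for w
    proof -
      obtain e where e: "N *\<^sub>v w = e \<cdot>\<^sub>v w" using S w by (auto simp: P_def)
      have "w \<bullet> (N *\<^sub>v x) = x \<bullet> (N *\<^sub>v w)"
        using bil_commute[OF N, of w x] w oS' \<open>x \<in> X\<close> by (auto simp: bil_def X_def)
      also have "\<dots> = e * (w \<bullet> x)"
        using w oS' \<open>x \<in> X\<close> comm_scalar_prod[of w n x] by (auto simp: e X_def)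
      finally show ?thesis using w \<open>x \<in> X\<close> by (auto simp: X_def)
    qed
    then show ?thesis using that Nc by (auto simp: X_def)
  qed
  have zero: "x = 0\<^sub>v n" if x: "x \<in> X" for x
  proof (rule ccontr)
    assume x0: "x \<noteq> 0\<^sub>v n"
    have "\<exists>y\<in>X. bil (1\<^sub>m n) y' y \<noteq> 0" if "y' \<in> X" "y' \<noteq> 0\<^sub>v n" for y'
      using that scalar_prod_self_pos[of y' n] subspace_dim[OF X] by (intro bexI[of _ y']) (auto simp: bil_one)
    from orthonormal_wrt_extend[OF one_sym_mats X _ _ this, of "{}"] obtain T where
      T: "T \<subseteq> X" "orthonormal n T" "\<forall>x\<in>X. (\<forall>w\<in>T. bil (1\<^sub>m n) w x = 0) \<longrightarrow> x = 0\<^sub>v n"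
      by (auto simp: orthonormal_wrt_def)
    note oT = orthonormal_one[OF T(2)]
    define m where "m = card T"
    obtain f where f: "bij_betw f {..<m} T"
      using ex_bij_betw_nat_finite[OF oT(4)] by (auto simp: m_def atLeast0LessThan)
    have fT: "f i \<in> T" if "i < m" for i using f that by (auto simp: bij_betw_def)
    have fX: "f i \<in> X" and fc: "f i \<in> carrier_vec n" if "i < m" for i
      using fT[OF that] T oT by auto
    have ff: "f i \<bullet> f j = (if i = j then 1 else 0)" if "i < m" "j < m" for i j
    proof -
      have "f i = f j \<longleftrightarrow> i = j" using f that by (auto simp: bij_betw_def inj_on_def)
      then show ?thesis using oT fT that by auto
    qed
    have "T \<noteq> {}" using T(3) x x0 by auto
    then have m: "m > 0" using oT(4) by (simp add: m_def card_gt_0_iff)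
    \<comment> \<open>\<open>G\<close> is the compression of \<open>N\<close> to \<open>X\<close> in
      the orthonormal basis \<open>f\<close>. An eigenvector \<open>c\<close> of \<open>G\<close>
      gives a \<open>z\<close> for which \<open>N *\<^sub>v z - e \<cdot>\<^sub>v z\<close> is
      orthogonal to that basis; by invariance this vector lies in \<open>X\<close>, hence it is
      0.\<close>
    define G where "G = mat m m (\<lambda>(i,j). bil N (f i) (f j))"
    have "G \<in> sym_mats m" using bil_commute[OF N] fc by (auto simp: sym_mats_def G_def intro!: eq_matI)
    from sym_mat_eigenvector[OF this m] obtain e c where
      c: "c \<in> carrier_vec m" "c \<noteq> 0\<^sub>v m" "G *\<^sub>v c = e \<cdot>\<^sub>v c" by auto
    define z where "z = lincomb n {..<m} (\<lambda>j. c $ j) f"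
    have zX: "z \<in> X" unfolding z_def using fX by (intro subspace_lincomb[OF X]) auto
    have zc: "z \<in> carrier_vec n" by (simp add: z_def)
    have fz: "f i \<bullet> z = c $ i" if "i < m" for i
    proof -
      have "f i \<bullet> z = (\<Sum>j<m. c $ j * (f i \<bullet> f j))"
        unfolding z_def using fc that by (subst scalar_prod_lincomb) auto
      also have "\<dots> = (\<Sum>j<m. if i = j then c $ j else 0)"
        using that by (intro sum.cong) (auto simp: ff)
      finally show ?thesis using that by simp
    qed
    have fNz: "f i \<bullet> (N *\<^sub>v z) = e * c $ i" if i: "i < m" for i
    proof -
      have "f i \<bullet> (N *\<^sub>v z) = (\<Sum>j<m. c $ j * bil N (f i) (f j))"
        unfolding z_def bil_def[symmetric] using fc that Nc by (subst bil_lincomb) auto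
      also have "\<dots> = (G *\<^sub>v c) $ i"
        using i c(1) by (simp add: G_def scalar_prod_def atLeast0LessThan mult.commute)
      finally show ?thesis using i c by simp
    qed
    have "N *\<^sub>v z - e \<cdot>\<^sub>v z \<in> X"
      using inv[OF zX] zX X by (intro subspace_minus[OF X]) (auto simp: subspace_n_def)
    moreover have "bil (1\<^sub>m n) w (N *\<^sub>v z - e \<cdot>\<^sub>v z) = 0" if "w \<in> T" for w
    proof -
      obtain i where i: "i < m" "w = f i" using f \<open>w \<in> T\<close> by (auto simp: bij_betw_def)
      then show ?thesis using fc[OF i(1)] zc Nc fz fNz
        by (simp add: bil_one scalar_prod_minus_distrib[of _ n])
    qed
    ultimately have "N *\<^sub>v z - e \<cdot>\<^sub>v z = 0\<^sub>v n" using T(3) by auto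
    then have Nz: "N *\<^sub>v z = e \<cdot>\<^sub>v z" using vec_eq_if_diff_0[of _ n] zc Nc by auto
    have "z \<noteq> 0\<^sub>v n"
    proof
      assume "z = 0\<^sub>v n"
      then have "c $ i = 0" if "i < m" for i using fz[OF that] fc[OF that] by simp
      then have "c = 0\<^sub>v m" using c(1) by (intro eq_vecI) auto
      then show False using c by simp
    qed
    then have zz: "z \<bullet> z > 0" using scalar_prod_self_pos zc by auto
    define v where "v = (1 / sqrt (z \<bullet> z)) \<cdot>\<^sub>v z"
    have vX: "v \<in> X" using zX X by (auto simp: v_def subspace_n_def)
    have vc: "v \<in> carrier_vec n" using zc by (simp add: v_def)
    have vv: "v \<bullet> v = 1" using zz zc by (simp add: v_def)
    have "N *\<^sub>v v = e \<cdot>\<^sub>v v"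
      using zc Nc Nz by (simp add: v_def mult_mat_vec smult_smult_assoc mult.commute)
    moreover have wv: "w \<bullet> v = 0" "v \<bullet> w = 0" if "w \<in> S" for w
      using that vX oS' comm_scalar_prod[of w n v] by (auto simp: X_def)
    moreover have "v \<notin> S" using wv vv by force
    ultimately have "P (insert v S)"
      using S vc vv oS' by (auto simp: P_def orthonormal_wrt_def bil_one)
    from max[OF this] show False using oS'(4) \<open>v \<notin> S\<close> by simp
  qed
  have "x = lincomb n S (\<lambda>w. w \<bullet> x) (\<lambda>w. w)" if x: "x \<in> carrier_vec n" for x
  proof -
    have "x = lincomb n S (\<lambda>w. bil (1\<^sub>m n) w w * bil (1\<^sub>m n) w x) (\<lambda>w. w)"
    proof (rule orthonormal_wrt_expansion[OF one_sym_mats subspace_carrier oS _ _ x])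
      fix y assume y: "y \<in> carrier_vec n" "\<And>w. w \<in> S \<Longrightarrow> bil (1\<^sub>m n) w y = 0"
      have "w \<bullet> y = 0" if "w \<in> S" for w using y(2)[OF that] bil_one[OF oS'(3)[OF that] y(1)] by simp
      then show "y = 0\<^sub>v n" using y by (intro zero) (simp add: X_def)
    qed (use oS' in blast)
    also have "\<dots> = lincomb n S (\<lambda>w. w \<bullet> x) (\<lambda>w. w)"
      using oS' x by (intro eq_vecI) (auto simp: bil_one intro!: sum.cong)
    finally show ?thesis .
  qed
  moreover have "\<exists>ev. \<forall>w\<in>S. N *\<^sub>v w = ev w \<cdot>\<^sub>v w" using S by (auto simp: P_def intro!: bchoice)
  ultimately show ?thesis using oS by blast
qed

text \<open>Functional calculus: for an orthonormal eigenbasis \<open>S\<close> with eigenvalues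
  \<open>ev\<close>, applying a function to \<open>ev\<close> and using the result as
  \<open>f\<close> applies that function to the matrix. A singleton \<open>S\<close> gives multiples
  of w w^T.\<close>

definition spectral_mat :: "nat \<Rightarrow> real vec set \<Rightarrow> (real vec \<Rightarrow> real) \<Rightarrow> real mat" where
  "spectral_mat n S f = mat n n (\<lambda>(i,j). \<Sum>w\<in>S. f w * w $ i * w $ j)"

lemma spectral_mat_sym: "spectral_mat n S f \<in> sym_mats n"
  by (auto simp: spectral_mat_def sym_mats_def intro!: eq_matI sum.cong)

lemma spectral_mat_carrier[simp]: "spectral_mat n S f \<in> carrier_mat n n"
  by (simp add: spectral_mat_def)

lemma spectral_mat_mult_vec:
  assumes "x \<in> carrier_vec n" "S \<subseteq> carrier_vec n"
  shows "spectral_mat n S f *\<^sub>v x = lincomb n S (\<lambda>w. f w * (w \<bullet> x)) (\<lambda>w. w)"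
proof (rule eq_vecI)
  fix i assume "i < dim_vec (lincomb n S (\<lambda>w. f w * (w \<bullet> x)) (\<lambda>w. w))"
  then have i: "i < n" by simp
  have "(spectral_mat n S f *\<^sub>v x) $ i = (\<Sum>j<n. \<Sum>w\<in>S. f w * w $ i * w $ j * x $ j)"
    using assms(1) i by (simp add: spectral_mat_def scalar_prod_def atLeast0LessThan sum_distrib_right)
  also have "\<dots> = (\<Sum>w\<in>S. \<Sum>j<n. f w * w $ i * w $ j * x $ j)" by (rule sum.swap)
  also have "\<dots> = (\<Sum>w\<in>S. f w * (w \<bullet> x) * w $ i)"
    using assms(1) by (intro sum.cong refl)
      (simp add: scalar_prod_def atLeast0LessThan sum_distrib_left sum_distrib_right mult_ac)
  finally show "(spectral_mat n S f *\<^sub>v x) $ i = lincomb n S (\<lambda>w. f w * (w \<bullet> x)) (\<lambda>w. w) $ i"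
    using i by simp
qed (simp add: spectral_mat_def)

lemma scalar_prod_lincomb_orthonormal:
  assumes S: "orthonormal n S" and v: "v \<in> S"
  shows "v \<bullet> lincomb n S f (\<lambda>w. w) = f v"
proof -
  note oS = orthonormal_one[OF S]
  have "v \<bullet> lincomb n S f (\<lambda>w. w) = (\<Sum>w\<in>S. f w * bil (1\<^sub>m n) v w)"
    using oS v by (subst scalar_prod_lincomb) (auto simp: bil_one)
  also have "\<dots> = f v" using orthonormal_wrt_sum[OF S oS(4) v] oS v by (simp add: bil_one)
  finally show ?thesis .
qed

text \<open>For orthonormal \<open>S\<close> the matrices w w^T are idempotent and annihilate each
  other, so only the weights multiply.\<close>

lemma spectral_mat_mult:
  assumes S: "orthonormal n S"
  shows "spectral_mat n S f * spectral_mat n S g = spectral_mat n S (\<lambda>w. f w * g w)"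
proof (rule mat_eq_mult_vecI[of _ n n])
  fix x :: "real vec" assume x: "x \<in> carrier_vec n"
  note oS = orthonormal_one[OF S]
  have Sc: "S \<subseteq> carrier_vec n" using oS by auto
  have "spectral_mat n S f * spectral_mat n S g *\<^sub>v x = spectral_mat n S f *\<^sub>v (spectral_mat n S g *\<^sub>v x)"
    using x by (intro assoc_mult_mat_vec[of _ n n _ n]) auto
  also have "\<dots> = lincomb n S (\<lambda>w. f w * (w \<bullet> (spectral_mat n S g *\<^sub>v x))) (\<lambda>w. w)"
    using x Sc by (subst spectral_mat_mult_vec) (auto intro: mult_mat_vec_carrier[of _ n n])
  also have "\<dots> = lincomb n S (\<lambda>w. f w * (g w * (w \<bullet> x))) (\<lambda>w. w)"
    using x Sc by (intro eq_vecI)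
      (auto simp: spectral_mat_mult_vec scalar_prod_lincomb_orthonormal[OF S] intro!: sum.cong)
  also have "\<dots> = spectral_mat n S (\<lambda>w. f w * g w) *\<^sub>v x"
    using x Sc by (simp add: spectral_mat_mult_vec mult.assoc)
  finally show "spectral_mat n S f * spectral_mat n S g *\<^sub>v x = spectral_mat n S (\<lambda>w. f w * g w) *\<^sub>v x" .
qed (rule mult_carrier_mat spectral_mat_carrier)+

section \<open>Positive definite matrices and their square roots\<close>

definition pos_def_mat :: "nat \<Rightarrow> real mat \<Rightarrow> bool" where
  "pos_def_mat n A \<longleftrightarrow> A \<in> sym_mats n \<and> (\<forall>x\<in>carrier_vec n. x \<noteq> 0\<^sub>v n \<longrightarrow> bil A x x > 0)"

lemma pos_def_matD: "pos_def_mat n A \<Longrightarrow> A \<in> sym_mats n" "pos_def_mat n A \<Longrightarrow> A \<in> carrier_mat n n"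
  "pos_def_mat n A \<Longrightarrow> transpose_mat A = A"
  "pos_def_mat n A \<Longrightarrow> x \<in> carrier_vec n \<Longrightarrow> x \<noteq> 0\<^sub>v n \<Longrightarrow> bil A x x > 0"
  by (auto simp: pos_def_mat_def sym_mats_def)

lemma pos_def_mat_psd: assumes "pos_def_mat n A" shows "psd A"
proof -
  have "bil A x x \<ge> 0" if "x \<in> carrier_vec n" for x
    using assms that pos_def_matD(2)[OF assms] by (cases "x = 0\<^sub>v n") (force simp: pos_def_mat_def)+
  then show ?thesis using pos_def_matD(2)[OF assms] by (auto simp: psd_def qform_def bil_def)
qed

lemma spectral_mat_pos_def:
  assumes S: "orthonormal n S" and pos: "\<And>w. w \<in> S \<Longrightarrow> f w > 0"
    and exp: "\<And>x. x \<in> carrier_vec n \<Longrightarrow> x = lincomb n S (\<lambda>w. w \<bullet> x) (\<lambda>w. w)"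
  shows "pos_def_mat n (spectral_mat n S f)"
  unfolding pos_def_mat_def
proof (intro conjI ballI impI)
  fix x :: "real vec" assume x: "x \<in> carrier_vec n" "x \<noteq> 0\<^sub>v n"
  note oS = orthonormal_one[OF S]
  have Sc: "S \<subseteq> carrier_vec n" using oS by auto
  have "bil (spectral_mat n S f) x x = (\<Sum>w\<in>S. f w * (w \<bullet> x) * (x \<bullet> w))"
    unfolding bil_def using x Sc oS by (subst spectral_mat_mult_vec) (auto simp: scalar_prod_lincomb)
  also have "\<dots> = (\<Sum>w\<in>S. f w * (w \<bullet> x)\<^sup>2)"
    using x oS by (auto intro!: sum.cong simp: power2_eq_square comm_scalar_prod[of x n])
  finally have eq: "bil (spectral_mat n S f) x x = (\<Sum>w\<in>S. f w * (w \<bullet> x)\<^sup>2)" .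
  have ge: "f w * (w \<bullet> x)\<^sup>2 \<ge> 0" if "w \<in> S" for w using pos[OF that] by simp
  have "(\<Sum>w\<in>S. f w * (w \<bullet> x)\<^sup>2) \<noteq> 0"
  proof
    assume "(\<Sum>w\<in>S. f w * (w \<bullet> x)\<^sup>2) = 0"
    then have "\<forall>w\<in>S. f w * (w \<bullet> x)\<^sup>2 = 0" using ge oS(4) by (simp add: sum_nonneg_eq_0_iff)
    then have "w \<bullet> x = 0" if "w \<in> S" for w using pos[OF that] that by force
    then have "lincomb n S (\<lambda>w. w \<bullet> x) (\<lambda>w. w) = 0\<^sub>v n" by (intro eq_vecI) auto
    then show False using exp[OF x(1)] x(2) by metis
  qed
  then show "bil (spectral_mat n S f) x x > 0" using eq ge by (simp add: sum_nonneg less_le)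
qed (simp add: spectral_mat_sym)

lemma spectral_mat_eqI:
  assumes S: "S \<subseteq> carrier_vec n" and A: "A \<in> carrier_mat n n"
    and exp: "\<And>x. x \<in> carrier_vec n \<Longrightarrow> x = lincomb n S (\<lambda>w. w \<bullet> x) (\<lambda>w. w)"
    and ev: "\<And>w. w \<in> S \<Longrightarrow> A *\<^sub>v w = f w \<cdot>\<^sub>v w"
  shows "A = spectral_mat n S f"
proof (rule mat_eq_mult_vecI[OF A])
  fix x :: "real vec" assume x: "x \<in> carrier_vec n"
  have "A *\<^sub>v x = A *\<^sub>v lincomb n S (\<lambda>w. w \<bullet> x) (\<lambda>w. w)"
      by (rule arg_cong[OF exp[OF x]])
  also have "\<dots> = lincomb n S (\<lambda>w. w \<bullet> x) (\<lambda>w. A *\<^sub>v w)"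
    using A S by (intro mult_mat_vec_lincomb) auto
  also have "\<dots> = lincomb n S (\<lambda>w. f w * (w \<bullet> x)) (\<lambda>w. w)"
  proof (rule eq_vecI)
    fix i assume "i < dim_vec (lincomb n S (\<lambda>w. f w * (w \<bullet> x)) (\<lambda>w. w))"
    then have i: "i < n" by simp
    have "(A *\<^sub>v w) $ i = f w * w $ i" if "w \<in> S" for w
      using ev[OF that] S that i by (auto simp: carrier_vecD)
    then show "lincomb n S (\<lambda>w. w \<bullet> x) (\<lambda>w. A *\<^sub>v w) $ i = lincomb n S (\<lambda>w. f w * (w \<bullet> x)) (\<lambda>w. w) $ i"
      using i by (auto intro!: sum.cong)
  qed simp
  also have "\<dots> = spectral_mat n S f *\<^sub>v x" using x S by (simp add: spectral_mat_mult_vec)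
  finally show "A *\<^sub>v x = spectral_mat n S f *\<^sub>v x" .
qed simp

text \<open>All eigenvalues are positive; \<open>P\<close> takes their square roots and
  \<open>Z\<close> the reciprocals of these. The inverse comes along with the root because later
  cancellations of \<open>P\<close> are multiplications by \<open>Z\<close>.\<close>

lemma pos_def_sqrt_exists:
  assumes A: "pos_def_mat n A"
  shows "\<exists>P Z. pos_def_mat n P \<and> pos_def_mat n Z \<and> P * P = A \<and> P * Z = 1\<^sub>m n \<and> Z * P = 1\<^sub>m n"
proof -
  from sym_mat_eigenbasis[OF pos_def_matD(1)[OF A]] obtain S ev where
    S: "orthonormal n S" and ev: "\<And>w. w \<in> S \<Longrightarrow> A *\<^sub>v w = ev w \<cdot>\<^sub>v w" and
    exp: "\<And>x. x \<in> carrier_vec n \<Longrightarrow> x = lincomb n S (\<lambda>w. w \<bullet> x) (\<lambda>w. w)"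
    by (elim exE conjE) (rule that, assumption, erule bspec, assumption, erule bspec)
  note oS = orthonormal_one[OF S]
  have Sc: "S \<subseteq> carrier_vec n" using oS by auto
  have evpos: "ev w > 0" if w: "w \<in> S" for w
  proof -
    have "w \<noteq> 0\<^sub>v n" using oS(1,3)[OF w] by auto
    then have "bil A w w > 0" using pos_def_matD(4)[OF A] oS w by auto
    then show ?thesis using oS w by (simp add: bil_def ev)
  qed
  define P where "P = spectral_mat n S (\<lambda>w. sqrt (ev w))"
  define Z where "Z = spectral_mat n S (\<lambda>w. 1 / sqrt (ev w))"
  have "pos_def_mat n P" "pos_def_mat n Z"
    unfolding P_def Z_def using evpos by (intro spectral_mat_pos_def[OF S _ exp]; simp)+
  moreover have "P * P = A"
    unfolding P_def spectral_mat_mult[OF S]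
    using evpos ev by (intro spectral_mat_eqI[symmetric, OF Sc _ exp]) (auto simp: less_imp_le pos_def_matD(2)[OF A])
  moreover have one: "1\<^sub>m n = spectral_mat n S (\<lambda>w. 1)"
    using Sc by (intro spectral_mat_eqI[OF Sc _ exp]) auto
  have "P * Z = 1\<^sub>m n" "Z * P = 1\<^sub>m n"
    unfolding P_def Z_def spectral_mat_mult[OF S] unfolding one spectral_mat_def
    using evpos by (intro cong_mat; auto intro!: sum.cong simp: less_le)+
  ultimately show ?thesis by blast
qed

text \<open>On an eigenvector \<open>w\<close> of \<open>Q\<close> with eigenvalue
  \<open>e > 0\<close>, the vector \<open>y = D w\<close> satisfies \<open>P y = - e y\<close>,
  which a semidefinite \<open>P\<close> allows only for \<open>y = 0\<close>. Eigenvectors of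
  \<open>Q\<close> span, so \<open>D = 0\<close>.\<close>

lemma sylvester_unique:
  assumes P: "P \<in> carrier_mat m m" "psd P" and Q: "pos_def_mat n Q" and D: "D \<in> carrier_mat m n"
    and eq: "P * D + D * Q = 0\<^sub>m m n"
  shows "D = 0\<^sub>m m n"
proof -
  from sym_mat_eigenbasis[OF pos_def_matD(1)[OF Q]] obtain S ev where
    S: "orthonormal n S" and ev: "\<And>w. w \<in> S \<Longrightarrow> Q *\<^sub>v w = ev w \<cdot>\<^sub>v w" and
    exp: "\<And>x. x \<in> carrier_vec n \<Longrightarrow> x = lincomb n S (\<lambda>w. w \<bullet> x) (\<lambda>w. w)"
    by (elim exE conjE) (rule that, assumption, erule bspec, assumption, erule bspec)
  note oS = orthonormal_one[OF S]
  have Dw: "D *\<^sub>v w = 0\<^sub>v m" if w: "w \<in> S" for w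
  proof -
    note wc = oS(3)[OF w]
    have "w \<noteq> 0\<^sub>v n" using oS(1,3)[OF w] by auto
    then have "bil Q w w > 0" using pos_def_matD(4)[OF Q] wc by auto
    then have e: "ev w > 0" using oS w by (simp add: bil_def ev)
    define y where "y = D *\<^sub>v w"
    have yc: "y \<in> carrier_vec m" using D wc by (simp add: y_def)
    have "(P * D + D * Q) *\<^sub>v w = P *\<^sub>v y + D *\<^sub>v (Q *\<^sub>v w)"
      using P D pos_def_matD(2)[OF Q] wc
      by (simp add: y_def add_mult_distrib_mat_vec[of _ m n] assoc_mult_mat_vec[of _ m m _ n]
          assoc_mult_mat_vec[of _ m n _ n])
    also have "\<dots> = P *\<^sub>v y + ev w \<cdot>\<^sub>v y" using D wc by (simp add: ev[OF w] mult_mat_vec y_def)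
    finally have "P *\<^sub>v y + ev w \<cdot>\<^sub>v y = 0\<^sub>m m n *\<^sub>v w" using eq by simp
    also have "\<dots> = 0\<^sub>v m" using wc by (intro eq_vecI) auto
    finally have "P *\<^sub>v y + ev w \<cdot>\<^sub>v y = 0\<^sub>v m" .
    then have "y \<bullet> (P *\<^sub>v y + ev w \<cdot>\<^sub>v y) = 0" using yc by simp
    then have "y \<bullet> (P *\<^sub>v y) + ev w * (y \<bullet> y) = 0"
      using yc P by (simp add: scalar_prod_add_distrib[of _ m])
    moreover have "y \<bullet> (P *\<^sub>v y) \<ge> 0" using P yc by (auto simp: psd_def qform_def)
    ultimately have "ev w * (y \<bullet> y) \<le> 0" by simp
    then have "y \<bullet> y = 0" using e scalar_prod_self_ge_0[of y] by (simp add: mult_le_0_iff)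
    then show ?thesis using scalar_prod_self_eq_0[OF yc] by (simp add: y_def)
  qed
  show ?thesis
  proof (rule mat_eq_mult_vecI[OF D])
    fix x :: "real vec" assume x: "x \<in> carrier_vec n"
    have "D *\<^sub>v x = D *\<^sub>v lincomb n S (\<lambda>w. w \<bullet> x) (\<lambda>w. w)"
      by (rule arg_cong[OF exp[OF x]])
    also have "\<dots> = lincomb m S (\<lambda>w. w \<bullet> x) (\<lambda>w. D *\<^sub>v w)"
      using D oS by (intro mult_mat_vec_lincomb) auto
    also have "\<dots> = 0\<^sub>m m n *\<^sub>v x" using x by (intro eq_vecI) (auto simp: Dw)
    finally show "D *\<^sub>v x = 0\<^sub>m m n *\<^sub>v x" .
  qed simp
qed

lemma mat_eq_if_diff_0:
  assumes "(X :: real mat) \<in> carrier_mat m n" "Y \<in> carrier_mat m n" "X - Y = 0\<^sub>m m n"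
  shows "X = Y"
proof (rule eq_matI)
  fix i j assume ij: "i < dim_row Y" "j < dim_col Y"
  then have "(X - Y) $$ (i,j) = 0" using assms(2) by (simp add: assms(3))
  then show "X $$ (i,j) = Y $$ (i,j)" using ij by simp
qed (use assms in auto)

text \<open>\<open>D = Y - P\<close> solves \<open>Y D + D P = Y\<^sup>2 - P\<^sup>2 = 0\<close>.
  The competitor \<open>Y\<close> is merely semidefinite, as in the descriptions that define
  \<open>psd_sqrt\<close> and \<open>inv_psd_sqrt\<close>.\<close>

lemma pos_def_sqrt_unique:
  assumes P: "pos_def_mat n P" and Y: "Y \<in> sym_mats n" "psd Y" and eq: "Y * Y = P * P"
  shows "Y = P"
proof -
  note Pc = pos_def_matD(2)[OF P] and Yc = sym_matsD(1)[OF Y(1)]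
  have 0: "Y * (Y - P) + (Y - P) * P = 0\<^sub>m n n"
    using Pc Yc eq by (simp add: mult_minus_distrib_mat[of _ n n] minus_mult_distrib_mat[of _ n n])
      (auto intro!: eq_matI)
  have "Y - P = 0\<^sub>m n n" by (rule sylvester_unique[OF Yc Y(2) P minus_carrier_mat[OF Pc] 0])
  then show ?thesis using mat_eq_if_diff_0 Pc Yc by blast
qed

lemma psd_sqrt_eqI:
  assumes P: "pos_def_mat n P"
  shows "psd_sqrt (P * P) = P"
  unfolding psd_sqrt_def
  using pos_def_sqrt_unique[OF P] P pos_def_mat_psd[OF P] pos_def_matD[OF P]
  by (intro the_equality) auto

text \<open>Multiplying the defining equation of a candidate \<open>Y\<close> by
  \<open>Z * Z\<close> gives \<open>Y * Y = Z * Z\<close>, which reduces the matter to uniqueness of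
  square roots.\<close>

lemma inv_psd_sqrt_eqI:
  assumes P: "pos_def_mat n P" and Z: "pos_def_mat n Z" and PZ: "P * Z = 1\<^sub>m n" "Z * P = 1\<^sub>m n"
  shows "inv_psd_sqrt (P * P) = Z"
proof -
  note Pc = pos_def_matD(2)[OF P] and Zc = pos_def_matD(2)[OF Z]
  have cancel: "X * X * (Y * Y) = 1\<^sub>m n"
    if X: "X \<in> carrier_mat n n" and Y: "Y \<in> carrier_mat n n" and XY: "X * Y = 1\<^sub>m n" for X Y :: "real mat"
  proof -
    have "X * X * (Y * Y) = X * (X * (Y * Y))" by (rule assoc_mult_mat[OF X X mult_carrier_mat[OF Y Y]])
    also have "X * (Y * Y) = X * Y * Y" by (rule assoc_mult_mat[OF X Y Y, symmetric])
    also have "\<dots> = Y" by (simp only: XY left_mult_one_mat[OF Y])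
    finally show ?thesis by (simp only: XY)
  qed
  have 2: "Y = Z" if Y: "Y \<in> sym_mats n" "psd Y" "Y * Y * (P * P) = 1\<^sub>m n" for Y
  proof -
    note Yc = sym_matsD(1)[OF Y(1)]
    have c: "Y * Y \<in> carrier_mat n n" "P * P \<in> carrier_mat n n" "Z * Z \<in> carrier_mat n n"
      using Yc Pc Zc by auto
    have "Y * Y = Y * Y * (P * P * (Z * Z))"
      by (simp only: cancel[OF Pc Zc PZ(1)] right_mult_one_mat[OF c(1)])
    also have "\<dots> = Y * Y * (P * P) * (Z * Z)" by (rule assoc_mult_mat[OF c, symmetric])
    also have "\<dots> = Z * Z" by (simp only: Y(3) left_mult_one_mat[OF c(3)])
    finally show ?thesis using pos_def_sqrt_unique[OF Z Y(1,2)] by simp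
  qed
  show ?thesis
    unfolding inv_psd_sqrt_def
  proof (rule the_equality)
    show "Z \<in> sym_mats (dim_row (P * P)) \<and> psd Z \<and> Z * Z * (P * P) = 1\<^sub>m (dim_row (P * P))"
      using pos_def_matD(1)[OF Z] pos_def_mat_psd[OF Z] Pc cancel[OF Zc Pc PZ(2)] by simp
  next
    fix Y assume "Y \<in> sym_mats (dim_row (P * P)) \<and> psd Y \<and> Y * Y * (P * P) = 1\<^sub>m (dim_row (P * P))"
    then have "Y \<in> sym_mats n" "psd Y" "Y * Y * (P * P) = 1\<^sub>m n" using Pc by simp_all
    then show "Y = Z" by (rule 2)
  qed
qed

section \<open>Maximal lower bounds\<close>

lemma qform_bil: "qform N x = bil N x x"
  by (simp add: qform_def bil_def)

lemma bil_diff_mat: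
  assumes "A \<in> carrier_mat n n" "B \<in> carrier_mat n n" "x \<in> carrier_vec n" "y \<in> carrier_vec n"
  shows "bil (A - B) x y = bil A x y - bil B x y"
  using assms by (simp add: bil_def minus_mult_distrib_mat_vec[of _ n n] scalar_prod_minus_distrib[of _ n])

lemma sym_mats_diff: "A \<in> sym_mats n \<Longrightarrow> B \<in> sym_mats n \<Longrightarrow> A - B \<in> sym_mats n"
  by (auto simp: sym_mats_def transpose_minus)

lemma quadratic_nonneg_discriminant:
  fixes a b c :: real
  assumes "\<And>t. a + 2 * t * b + t\<^sup>2 * c \<ge> 0"
  shows "b\<^sup>2 \<le> a * c"
proof (cases "c = 0")
  case True
  have "b = 0"
  proof (rule ccontr)
    assume "b \<noteq> 0"
    \<comment> \<open>This value of \<open>t\<close> is the solution of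
      \<open>a + 2 * t * b = - 1\<close>.\<close>
    then have "a + 2 * (- (a + 1) / (2 * b)) * b = - 1" by (simp add: field_simps)
    with assms[of "- (a + 1) / (2 * b)"] True show False by simp
  qed
  then show ?thesis using True by simp
next
  case False
  have "c > 0"
  proof (rule ccontr)
    assume "\<not> c > 0"
    with False have c: "c < 0" by simp
    \<comment> \<open>The sign of \<open>t\<close> is opposite to that of \<open>b\<close>, and its
      size gives \<open>t\<^sup>2 * c = - (\<bar>a\<bar> + 1)\<close>; the linear term is then at
      most 0 and the whole value at most -1.\<close>
    define t where "t = (if b \<ge> 0 then - 1 else 1) * sqrt ((\<bar>a\<bar> + 1) / - c)"
    have "(\<bar>a\<bar> + 1) / - c \<ge> 0" using c by (intro divide_nonneg_pos) auto
    then have "t\<^sup>2 = (\<bar>a\<bar> + 1) / - c" "sqrt ((\<bar>a\<bar> + 1) / - c) \<ge> 0"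
      by (auto simp: t_def power_mult_distrib)
    then have "t\<^sup>2 * c = - (\<bar>a\<bar> + 1)" "t * b \<le> 0"
      using c by (auto simp: t_def mult_le_0_iff)
    with assms[of t] show False by (simp add: mult.assoc)
  qed
  have "a + 2 * (- b / c) * b + (- b / c)\<^sup>2 * c = a - b\<^sup>2 / c"
    using \<open>c > 0\<close> by (simp add: field_simps power2_eq_square)
  with assms[of "- b / c"] have "b\<^sup>2 / c \<le> a" by simp
  then show ?thesis using \<open>c > 0\<close> by (simp add: field_simps)
qed

lemma psd_cauchy_schwarz:
  assumes A: "A \<in> sym_mats n" and psd: "\<And>x. x \<in> carrier_vec n \<Longrightarrow> bil A x x \<ge> 0"
    and x: "x \<in> carrier_vec n" and y: "y \<in> carrier_vec n"
  shows "(bil A x y)\<^sup>2 \<le> bil A x x * bil A y y"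
proof (rule quadratic_nonneg_discriminant)
  fix t
  note Ac = sym_matsD(1)[OF A]
  have "0 \<le> bil A (x + t \<cdot>\<^sub>v y) (x + t \<cdot>\<^sub>v y)" using x y by (intro psd) auto
  also have "\<dots> = bil A x x + 2 * t * bil A x y + t\<^sup>2 * bil A y y"
    using x y Ac bil_commute[OF A y x]
    by (simp add: bil_add[OF Ac] bil_smult[OF Ac] power2_eq_square algebra_simps)
  finally show "0 \<le> bil A x x + 2 * t * bil A x y + t\<^sup>2 * bil A y y" .
qed

text \<open>Cauchy-Schwarz with \<open>A x\<close> itself as test vector bounds the square of
  \<open>(A x) \<bullet> (A x)\<close> by a multiple of \<open>bil A x x\<close>.\<close>

lemma psd_isotropic_kernel:
  assumes A: "A \<in> sym_mats n" and psd: "\<And>x. x \<in> carrier_vec n \<Longrightarrow> bil A x x \<ge> 0"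
    and x: "x \<in> carrier_vec n" "bil A x x = 0"
  shows "A *\<^sub>v x = 0\<^sub>v n"
proof -
  have c: "A *\<^sub>v x \<in> carrier_vec n" using sym_matsD(1)[OF A] x by auto
  from psd_cauchy_schwarz[OF A psd c x(1)] x(2) have "bil A (A *\<^sub>v x) x = 0" by simp
  then show ?thesis using scalar_prod_self_eq_0[OF c] by (simp add: bil_def)
qed

text \<open>Minimality is expressed through decrements: the bounds on \<open>D\<close> say that
  \<open>D\<close> is semidefinite and that \<open>Y - D\<close> still dominates both 0 and
  \<open>N\<close>. Under \<open>Y = A - C\<close> a decrement is \<open>D = C' - C\<close> for a
  competing lower bound \<open>C'\<close>.\<close>

definition minimal_above :: "nat \<Rightarrow> real mat \<Rightarrow> real mat \<Rightarrow> bool" where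
  "minimal_above n N Y \<longleftrightarrow> Y \<in> sym_mats n \<and>
     (\<forall>x\<in>carrier_vec n. 0 \<le> bil Y x x \<and> bil N x x \<le> bil Y x x) \<and>
     (\<forall>D\<in>sym_mats n. (\<forall>x\<in>carrier_vec n. 0 \<le> bil D x x \<and> bil D x x \<le> bil Y x x \<and>
        bil D x x \<le> bil Y x x - bil N x x) \<longrightarrow> D = 0\<^sub>m n n)"

lemma max_lower_bound_iff_minimal_above:
  assumes A: "A \<in> sym_mats n" and B: "B \<in> sym_mats n" and C: "C \<in> sym_mats n"
  shows "max_lower_bound n A B C \<longleftrightarrow> minimal_above n (A - B) (A - C)"
proof -
  note Ac = sym_matsD(1)[OF A] and Bc = sym_matsD(1)[OF B] and Cc = sym_matsD(1)[OF C]
  have 1: "(0 \<le> bil (A - C) x x \<and> bil (A - B) x x \<le> bil (A - C) x x) \<longleftrightarrow>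
      (bil C x x \<le> bil A x x \<and> bil C x x \<le> bil B x x)" if "x \<in> carrier_vec n" for x
    using that by (auto simp: bil_diff_mat[OF Ac Cc] bil_diff_mat[OF Ac Bc])
  define bounds where "bounds D x \<longleftrightarrow> 0 \<le> bil D x x \<and> bil D x x \<le> bil (A - C) x x \<and>
        bil D x x \<le> bil (A - C) x x - bil (A - B) x x" for D x
  have 2: "bounds (C' - C) x \<longleftrightarrow>
      (bil C x x \<le> bil C' x x \<and> bil C' x x \<le> bil A x x \<and> bil C' x x \<le> bil B x x)"
    if "x \<in> carrier_vec n" "C' \<in> carrier_mat n n" for x C'
    using that by (auto simp: bounds_def bil_diff_mat[OF Ac Cc] bil_diff_mat[OF Ac Bc] bil_diff_mat[OF that(2) Cc])
  have 3: "(\<forall>D\<in>sym_mats n. (\<forall>x\<in>carrier_vec n. bounds D x) \<longrightarrow> D = 0\<^sub>m n n) \<longleftrightarrow>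
      (\<forall>C'\<in>sym_mats n. (\<forall>x\<in>carrier_vec n. bounds (C' - C) x) \<longrightarrow> C' = C)"
  proof (intro iffI ballI impI)
    fix C' assume *: "\<forall>D\<in>sym_mats n. (\<forall>x\<in>carrier_vec n. bounds D x) \<longrightarrow> D = 0\<^sub>m n n"
      "C' \<in> sym_mats n" "\<forall>x\<in>carrier_vec n. bounds (C' - C) x"
    then have "C' - C = 0\<^sub>m n n" using sym_mats_diff[OF *(2) C] by blast
    then show "C' = C" using mat_eq_if_diff_0[OF _ Cc] sym_matsD(1)[OF *(2)] by blast
  next
    fix D assume *: "\<forall>C'\<in>sym_mats n. (\<forall>x\<in>carrier_vec n. bounds (C' - C) x) \<longrightarrow> C' = C"
      "D \<in> sym_mats n" "\<forall>x\<in>carrier_vec n. bounds D x"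
    have Dc: "D \<in> carrier_mat n n" using *(2) sym_matsD by auto
    have "D + C \<in> sym_mats n" using *(2) C Dc Cc by (auto simp: sym_mats_def transpose_add[of _ n n])
    moreover have "D + C - C = D" using Dc Cc by (intro eq_matI) auto
    ultimately have "D + C = C" using *(1,3) by auto
    then have "D + C - C = C - C" by simp
    then show "D = 0\<^sub>m n n" using \<open>D + C - C = D\<close> Cc by simp
  qed
  have "minimal_above n (A - B) (A - C) \<longleftrightarrow>
     (\<forall>x\<in>carrier_vec n. bil C x x \<le> bil A x x \<and> bil C x x \<le> bil B x x) \<and>
     (\<forall>C'\<in>sym_mats n. (\<forall>x\<in>carrier_vec n. bounds (C' - C) x) \<longrightarrow> C' = C)"
    unfolding minimal_above_def 3[symmetric] bounds_def[symmetric]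
    using sym_mats_diff[OF A C] 1 by auto
  moreover have "(\<forall>x\<in>carrier_vec n. bounds (C' - C) x) \<longleftrightarrow>
     loewner_le n C C' \<and> loewner_le n C' A \<and> loewner_le n C' B" if "C' \<in> sym_mats n" for C'
    using 2 sym_matsD(1)[OF that] by (auto simp: loewner_le_def qform_bil)
  ultimately show ?thesis
    using C unfolding max_lower_bound_def by (auto simp: loewner_le_def qform_bil)
qed

lemma is_solution_iff:
  assumes A: "A \<in> sym_mats n" and B: "B \<in> sym_mats n" and Y: "Y \<in> sym_mats n"
    and U: "U \<subseteq> carrier_vec n" and V: "V \<subseteq> carrier_vec n"
  shows "is_solution n A B U V (A - Y) \<longleftrightarrow> minimal_above n (A - B) Y \<and>
    (\<forall>u\<in>U. Y *\<^sub>v u = (A - B) *\<^sub>v u) \<and> (\<forall>v\<in>V. Y *\<^sub>v v = 0\<^sub>v n)"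
proof -
  note Ac = sym_matsD(1)[OF A] and Bc = sym_matsD(1)[OF B] and Yc = sym_matsD(1)[OF Y]
  have AAY: "A - (A - Y) = Y" using Ac Yc by (intro eq_matI) auto
  have *: "(a - b = c) \<longleftrightarrow> (b = a - c)" if "a \<in> carrier_vec n" "b \<in> carrier_vec n" "c \<in> carrier_vec n"
    for a b c :: "real vec"
    using that by (auto intro!: eq_vecI)
  have "(A - Y) *\<^sub>v x = B *\<^sub>v x \<longleftrightarrow> Y *\<^sub>v x = (A - B) *\<^sub>v x" if "x \<in> carrier_vec n" for x
    using that Ac Bc Yc *[of "A *\<^sub>v x" "Y *\<^sub>v x" "B *\<^sub>v x"]
    by (simp add: minus_mult_distrib_mat_vec[of _ n n])
  moreover have "(A - Y) *\<^sub>v x = A *\<^sub>v x \<longleftrightarrow> Y *\<^sub>v x = 0\<^sub>v n" if "x \<in> carrier_vec n" for x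
    using that Ac Yc *[of "A *\<^sub>v x" "Y *\<^sub>v x" "A *\<^sub>v x"]
    by (simp add: minus_mult_distrib_mat_vec[of _ n n] minus_cancel_vec[of _ n])
  ultimately have "(\<forall>u\<in>U. (A - Y) *\<^sub>v u = B *\<^sub>v u) \<longleftrightarrow> (\<forall>u\<in>U. Y *\<^sub>v u = (A - B) *\<^sub>v u)"
    "(\<forall>v\<in>V. (A - Y) *\<^sub>v v = A *\<^sub>v v) \<longleftrightarrow> (\<forall>v\<in>V. Y *\<^sub>v v = 0\<^sub>v n)"
    using U V by (meson subsetD)+
  then show ?thesis
    unfolding is_solution_def max_lower_bound_iff_minimal_above[OF A B sym_mats_diff[OF A Y]] AAY
    by simp
qed

text \<open>An admissible decrement \<open>D\<close> is squeezed to 0 at \<open>y\<close>, where the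
  form of \<open>Y\<close> vanishes, and at \<open>z\<close>, where that of \<open>Y - N\<close>
  vanishes. Isotropic vectors of a semidefinite form lie in its kernel, so
  \<open>D x = D y + D z = 0\<close>.\<close>

lemma minimal_aboveI:
  assumes Y: "Y \<in> sym_mats n" and N: "N \<in> carrier_mat n n"
    and ge: "\<And>x. x \<in> carrier_vec n \<Longrightarrow> 0 \<le> bil Y x x" "\<And>x. x \<in> carrier_vec n \<Longrightarrow> bil N x x \<le> bil Y x x"
    and dec: "\<And>x. x \<in> carrier_vec n \<Longrightarrow> \<exists>y\<in>carrier_vec n. \<exists>z\<in>carrier_vec n.
       x = y + z \<and> bil Y y y = 0 \<and> bil Y z z = bil N z z"
  shows "minimal_above n N Y"
proof -
  have "D = 0\<^sub>m n n" if D: "D \<in> sym_mats n" and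
    b: "\<forall>x\<in>carrier_vec n. 0 \<le> bil D x x \<and> bil D x x \<le> bil Y x x \<and> bil D x x \<le> bil Y x x - bil N x x" for D
  proof (rule mat_eq_mult_vecI[of _ n n])
    fix x :: "real vec" assume x: "x \<in> carrier_vec n"
    obtain y z where yz: "y \<in> carrier_vec n" "z \<in> carrier_vec n" "x = y + z" "bil Y y y = 0" "bil Y z z = bil N z z"
      using dec[OF x] by blast
    have "bil D y y = 0" "bil D z z = 0" using b yz by (force intro: antisym)+
    then have "D *\<^sub>v y = 0\<^sub>v n" "D *\<^sub>v z = 0\<^sub>v n" using psd_isotropic_kernel[OF D] b yz by auto
    then show "D *\<^sub>v x = 0\<^sub>m n n *\<^sub>v x"
      using sym_matsD(1)[OF D] yz by (auto simp: mult_add_distrib_mat_vec[of _ n n])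
  qed (use sym_matsD(1)[OF D] in auto)
  then show ?thesis using Y ge unfolding minimal_above_def by blast
qed

section \<open>The solvability criterion\<close>

lemma inertia_nonsingular:
  assumes N: "N \<in> carrier_mat n n" and i: "inertia N = (p, q, 0)"
    and x: "x \<in> carrier_vec n" "N *\<^sub>v x = 0\<^sub>v n"
  shows "x = 0\<^sub>v n"
proof (rule ccontr)
  assume "x \<noteq> 0\<^sub>v n"
  then have "eigenvector N x 0" using N x by (auto simp: eigenvector_def intro!: eq_vecI)
  then have "poly (char_poly N) 0 = 0"
    using eigenvalue_root_char_poly[OF N] by (auto simp: eigenvalue_def)
  moreover have "char_poly N \<noteq> 0" using degree_monic_char_poly[OF N] by auto
  ultimately have "order 0 (char_poly N) \<noteq> 0" by (simp add: order_root)
  then show False using i by (simp add: inertia_def)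
qed

text \<open>On \<open>U\<close> the form of \<open>N\<close> coincides with that of
  \<open>Y\<close>, on \<open>V\<close> with that of \<open>- (Y - N)\<close>, which settles the
  signs. A null vector would lie in the kernel of \<open>Y\<close> or of \<open>Y - N\<close>; with
  the interpolation condition it would lie in the kernel of \<open>N\<close>, which is
  trivial.\<close>

lemma minimal_above_necessary:
  assumes N: "N \<in> sym_mats n" and ns: "\<And>x. x \<in> carrier_vec n \<Longrightarrow> N *\<^sub>v x = 0\<^sub>v n \<Longrightarrow> x = 0\<^sub>v n"
    and U: "U \<subseteq> carrier_vec n" and V: "V \<subseteq> carrier_vec n" and Y: "minimal_above n N Y"
    and YU: "\<And>u. u \<in> U \<Longrightarrow> Y *\<^sub>v u = N *\<^sub>v u" and YV: "\<And>v. v \<in> V \<Longrightarrow> Y *\<^sub>v v = 0\<^sub>v n"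
  shows "pos_def_over n N U" "neg_def_over n N V" "\<And>u v. u \<in> U \<Longrightarrow> v \<in> V \<Longrightarrow> u \<bullet> (N *\<^sub>v v) = 0"
proof -
  have Ys: "Y \<in> sym_mats n" and ge: "\<And>x. x \<in> carrier_vec n \<Longrightarrow> 0 \<le> bil Y x x \<and> bil N x x \<le> bil Y x x"
    using Y by (auto simp: minimal_above_def)
  note Nc = sym_matsD(1)[OF N] and Yc = sym_matsD(1)[OF Ys]
  show "pos_def_over n N U"
    unfolding pos_def_over_def qform_bil
  proof (intro ballI impI)
    fix u assume u: "u \<in> U" "u \<noteq> 0\<^sub>v n"
    have uc: "u \<in> carrier_vec n" using u U by auto
    have eq: "bil N u u = bil Y u u" using YU[OF u(1)] by (simp add: bil_def)
    have "bil Y u u \<noteq> 0"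
    proof
      assume "bil Y u u = 0"
      then have "N *\<^sub>v u = 0\<^sub>v n" using psd_isotropic_kernel[OF Ys _ uc] ge YU[OF u(1)] by auto
      then show False using ns[OF uc] u by simp
    qed
    then show "0 < bil N u u" using eq ge[OF uc] by simp
  qed
  show "neg_def_over n N V"
    unfolding neg_def_over_def qform_bil
  proof (intro ballI impI)
    fix v assume v: "v \<in> V" "v \<noteq> 0\<^sub>v n"
    have vc: "v \<in> carrier_vec n" using v V by auto
    have Yv: "bil Y v v = 0" using YV[OF v(1)] vc by (simp add: bil_def)
    have "bil N v v \<noteq> 0"
    proof
      assume "bil N v v = 0"
      then have "bil (Y - N) v v = 0" using Yv vc by (simp add: bil_diff_mat[OF Yc Nc])
      moreover have "bil (Y - N) x x \<ge> 0" if "x \<in> carrier_vec n" for x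
        using ge[OF that] that by (simp add: bil_diff_mat[OF Yc Nc])
      ultimately have "(Y - N) *\<^sub>v v = 0\<^sub>v n"
        using psd_isotropic_kernel[OF sym_mats_diff[OF Ys N] _ vc] by blast
      then have "0\<^sub>v n - N *\<^sub>v v = 0\<^sub>v n"
        using YV[OF v(1)] vc by (simp add: minus_mult_distrib_mat_vec[OF Yc Nc])
      then have "N *\<^sub>v v = 0\<^sub>v n" using vec_eq_if_diff_0[of "0\<^sub>v n" n "N *\<^sub>v v"] Nc vc by auto
      then show False using ns[OF vc] v by simp
    qed
    then show "bil N v v < 0" using Yv ge[OF vc] by simp
  qed
  fix u v assume u: "u \<in> U" and v: "v \<in> V"
  have c: "u \<in> carrier_vec n" "v \<in> carrier_vec n" using u v U V by auto
  have "bil N u v = bil N v u" using bil_commute[OF N c] .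
  also have "\<dots> = bil Y v u" using YU[OF u] by (simp add: bil_def)
  also have "\<dots> = bil Y u v" using bil_commute[OF Ys c(2,1)] .
  also have "\<dots> = 0" using YV[OF v] c by (simp add: bil_def)
  finally show "u \<bullet> (N *\<^sub>v v) = 0" by (simp add: bil_def)
qed

lemma minimal_above_exists:
  assumes N: "N \<in> sym_mats n" and ns: "\<And>x. x \<in> carrier_vec n \<Longrightarrow> N *\<^sub>v x = 0\<^sub>v n \<Longrightarrow> x = 0\<^sub>v n"
    and U: "subspace_n n U" and V: "subspace_n n V"
    and pos: "pos_def_over n N U" and neg: "neg_def_over n N V"
    and orth: "\<And>u v. u \<in> U \<Longrightarrow> v \<in> V \<Longrightarrow> bil N u v = 0"
  shows "\<exists>Y. minimal_above n N Y \<and> (\<forall>u\<in>U. Y *\<^sub>v u = N *\<^sub>v u) \<and> (\<forall>v\<in>V. Y *\<^sub>v v = 0\<^sub>v n)"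
proof -
  note Nc = sym_matsD(1)[OF N]
  note Uc = subspace_dim[OF U] and Vc = subspace_dim[OF V]
  have 0: "orthonormal_wrt n N {}" by (simp add: orthonormal_wrt_def)
  have ndU: "\<exists>y\<in>U. bil N x y \<noteq> 0" if "x \<in> U" "x \<noteq> 0\<^sub>v n" for x
    using pos that by (intro bexI[of _ x]) (force simp: pos_def_over_def qform_bil)+
  have ndV: "\<exists>y\<in>V. bil N x y \<noteq> 0" if "x \<in> V" "x \<noteq> 0\<^sub>v n" for x
    using neg that by (intro bexI[of _ x]) (force simp: neg_def_over_def qform_bil)+
  \<comment> \<open>The witness \<open>N x\<close> pairs with \<open>x\<close> to the squared length
    of \<open>N x\<close>, which is nonzero by nonsingularity.\<close>
  have nd: "\<exists>y\<in>carrier_vec n. bil N x y \<noteq> 0" if x: "x \<in> carrier_vec n" "x \<noteq> 0\<^sub>v n" for x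
  proof (intro bexI)
    have c: "N *\<^sub>v x \<in> carrier_vec n" using Nc x by auto
    then have "bil N (N *\<^sub>v x) x > 0" using scalar_prod_self_pos[OF c] ns x by (auto simp: bil_def)
    then show "bil N x (N *\<^sub>v x) \<noteq> 0" using bil_commute[OF N x(1) c] by simp
    show "N *\<^sub>v x \<in> carrier_vec n" by (rule c)
  qed
  obtain S where S: "S \<subseteq> U" "orthonormal_wrt n N S"
    "\<forall>x\<in>U. (\<forall>w\<in>S. bil N w x = 0) \<longrightarrow> x = 0\<^sub>v n"
    using orthonormal_wrt_extend[OF N U 0 empty_subsetI ndU] by blast
  obtain T where T: "T \<subseteq> V" "orthonormal_wrt n N T"
    "\<forall>x\<in>V. (\<forall>w\<in>T. bil N w x = 0) \<longrightarrow> x = 0\<^sub>v n"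
    using orthonormal_wrt_extend[OF N V 0 empty_subsetI ndV] by blast
  have "orthonormal_wrt n N (S \<union> T)"
    unfolding orthonormal_wrt_def
  proof (intro conjI ballI impI)
    show "S \<union> T \<subseteq> carrier_vec n" using S(1) T(1) Uc Vc by auto
    show "\<bar>bil N w w\<bar> = 1" if "w \<in> S \<union> T" for w
      using that S(2) T(2) by (auto simp: orthonormal_wrt_def)
    fix v w assume vw: "v \<in> S \<union> T" "w \<in> S \<union> T" "v \<noteq> w"
    have st: "bil N s t = 0" "bil N t s = 0" if "s \<in> S" "t \<in> T" for s t
    proof -
      have "s \<in> U" "t \<in> V" using that S(1) T(1) by auto
      then show "bil N s t = 0" by (rule orth)
      then show "bil N t s = 0" using bil_commute[OF N Uc[OF \<open>s \<in> U\<close>] Vc[OF \<open>t \<in> V\<close>]] by simp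
    qed
    show "bil N v w = 0" using vw st S(2) T(2) by (auto simp: orthonormal_wrt_def)
  qed
  moreover have "S \<union> T \<subseteq> carrier_vec n" using S(1) T(1) Uc Vc by auto
  ultimately obtain R where R: "S \<union> T \<subseteq> R" "orthonormal_wrt n N R"
    "\<forall>x\<in>carrier_vec n. (\<forall>w\<in>R. bil N w x = 0) \<longrightarrow> x = 0\<^sub>v n"
    using orthonormal_wrt_extend[OF N subspace_carrier _ _ nd, of "S \<union> T"] by blast
  have Rc: "w \<in> carrier_vec n" if "w \<in> R" for w using R(2) that by (auto simp: orthonormal_wrt_def)
  have finR: "finite R" using orthonormal_wrt_finite_card[OF R(2) Nc] by simp
  have one: "bil N w w = 1 \<or> bil N w w = - 1" if "w \<in> R" for w
    using R(2) that by (auto simp: orthonormal_wrt_def abs_if split: if_splits)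
  have expR: "x = lincomb n R (\<lambda>w. bil N w w * bil N w x) (\<lambda>w. w)" if "x \<in> carrier_vec n" for x
    using Rc R(3) by (intro orthonormal_wrt_expansion[OF N subspace_carrier R(2) _ _ that]) blast+
  have expS: "x = lincomb n S (\<lambda>w. bil N w w * bil N w x) (\<lambda>w. w)" if "x \<in> U" for x
    using S(3) by (intro orthonormal_wrt_expansion[OF N U S(2,1) _ that]) blast
  have expT: "x = lincomb n T (\<lambda>w. bil N w w * bil N w x) (\<lambda>w. w)" if "x \<in> V" for x
    using T(3) by (intro orthonormal_wrt_expansion[OF N V T(2,1) _ that]) blast
  \<comment> \<open>In the basis \<open>R\<close>, \<open>N\<close> is the sum of the matrices (N
    w)(N w)^T weighted by the signs \<open>bil N w w\<close>. \<open>Y\<close> keeps the positive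
    terms, and \<open>Y - N\<close> is then the sum of (N w)(N w)^T over the negative vectors, so
    both are semidefinite.\<close>
  define R1 where "R1 = {w \<in> R. bil N w w = 1}"
  define Y where "Y = mat n n (\<lambda>(i,j). \<Sum>w\<in>R1. (N *\<^sub>v w) $ i * (N *\<^sub>v w) $ j)"
  have finR1: "finite R1" "R1 \<subseteq> R" using finR by (auto simp: R1_def)
  have Ys: "Y \<in> sym_mats n" by (auto simp: Y_def sym_mats_def mult.commute intro!: eq_matI)
  have Yc: "Y \<in> carrier_mat n n" using sym_matsD[OF Ys] by simp
  have bilN: "bil N w x = (N *\<^sub>v w) \<bullet> x" if "w \<in> carrier_vec n" "x \<in> carrier_vec n" for w x
    using scalar_prod_mult_mat_vec[OF Nc that] sym_matsD[OF N] by (simp add: bil_def)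
  have Yx: "Y *\<^sub>v x = lincomb n R1 (\<lambda>w. bil N w x) (\<lambda>w. N *\<^sub>v w)" if x: "x \<in> carrier_vec n" for x
  proof (rule eq_vecI)
    fix i assume "i < dim_vec (lincomb n R1 (\<lambda>w. bil N w x) (\<lambda>w. N *\<^sub>v w))"
    then have i: "i < n" by simp
    have "(Y *\<^sub>v x) $ i = (\<Sum>j<n. \<Sum>w\<in>R1. (N *\<^sub>v w) $ i * (N *\<^sub>v w) $ j * x $ j)"
      using x i by (simp add: Y_def scalar_prod_def atLeast0LessThan sum_distrib_right)
    also have "\<dots> = (\<Sum>w\<in>R1. \<Sum>j<n. (N *\<^sub>v w) $ i * (N *\<^sub>v w) $ j * x $ j)" by (rule sum.swap)
    also have "\<dots> = (\<Sum>w\<in>R1. bil N w x * (N *\<^sub>v w) $ i)"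
    proof (intro sum.cong refl)
      fix w assume "w \<in> R1"
      then have wc: "w \<in> carrier_vec n" using finR1 Rc by auto
      show "(\<Sum>j<n. (N *\<^sub>v w) $ i * (N *\<^sub>v w) $ j * x $ j) = bil N w x * (N *\<^sub>v w) $ i"
        unfolding bilN[OF wc x] using x
        by (simp add: scalar_prod_def[of _ x] atLeast0LessThan sum_distrib_left sum_distrib_right mult_ac)
    qed
    finally show "(Y *\<^sub>v x) $ i = lincomb n R1 (\<lambda>w. bil N w x) (\<lambda>w. N *\<^sub>v w) $ i" using i by simp
  qed (simp add: Y_def)
  have Yxy: "bil Y y x = (\<Sum>w\<in>R1. bil N w x * bil N w y)"
    if x: "x \<in> carrier_vec n" and y: "y \<in> carrier_vec n" for x y
  proof -
    have "bil Y y x = (\<Sum>w\<in>R1. bil N w x * (y \<bullet> (N *\<^sub>v w)))"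
      unfolding bil_def[of Y] Yx[OF x] using y Nc Rc finR1
      by (subst scalar_prod_lincomb) auto
    also have "\<dots> = (\<Sum>w\<in>R1. bil N w x * bil N w y)"
      using bil_commute[OF N y] Rc finR1 by (intro sum.cong refl) (auto simp: bil_def)
    finally show ?thesis .
  qed
  have Nxy: "bil N y x = (\<Sum>w\<in>R. bil N w w * bil N w x * bil N w y)"
    if x: "x \<in> carrier_vec n" and y: "y \<in> carrier_vec n" for x y
  proof -
    have "bil N y x = bil N y (lincomb n R (\<lambda>w. bil N w w * bil N w x) (\<lambda>w. w))"
      by (rule arg_cong[OF expR[OF x]])
    also have "\<dots> = (\<Sum>w\<in>R. bil N w w * bil N w x * bil N y w)"
      using Rc y by (intro bil_lincomb[OF Nc]) auto
    also have "\<dots> = (\<Sum>w\<in>R. bil N w w * bil N w x * bil N w y)"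
      using bil_commute[OF N y] Rc by (intro sum.cong refl) auto
    finally show ?thesis .
  qed
  have diff: "bil Y y x - bil N y x = (\<Sum>w\<in>R - R1. bil N w x * bil N w y)"
    if x: "x \<in> carrier_vec n" and y: "y \<in> carrier_vec n" for x y
  proof -
    have "bil N y x = (\<Sum>w\<in>R1. bil N w w * bil N w x * bil N w y) + (\<Sum>w\<in>R - R1. bil N w w * bil N w x * bil N w y)"
      unfolding Nxy[OF x y] using finR finR1 by (simp add: sum.subset_diff add.commute)
    also have "(\<Sum>w\<in>R1. bil N w w * bil N w x * bil N w y) = bil Y y x"
      unfolding Yxy[OF x y] by (intro sum.cong refl) (auto simp: R1_def)
    also have "(\<Sum>w\<in>R - R1. bil N w w * bil N w x * bil N w y) = - (\<Sum>w\<in>R - R1. bil N w x * bil N w y)"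
      unfolding sum_negf[symmetric]
    proof (intro sum.cong refl)
      fix w assume "w \<in> R - R1"
      then have "bil N w w = - 1" using one by (auto simp: R1_def)
      then show "bil N w w * bil N w x * bil N w y = - (bil N w x * bil N w y)" by simp
    qed
    finally show ?thesis by simp
  qed
  have bilR: "bil N w (lincomb n K f (\<lambda>w. w)) = 0" if "w \<in> R" "w \<notin> K" "K \<subseteq> R" for w K f
  proof -
    have 0: "bil N w x = 0" if "x \<in> K" for x
    proof -
      have "x \<in> R" "w \<noteq> x" using \<open>w \<notin> K\<close> \<open>K \<subseteq> R\<close> that by auto
      then show ?thesis using R(2) \<open>w \<in> R\<close> by (simp add: orthonormal_wrt_def)
    qed
    have "bil N w (lincomb n K f (\<lambda>w. w)) = (\<Sum>x\<in>K. f x * bil N w x)"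
      using that Rc by (intro bil_lincomb[OF Nc]) auto
    then show ?thesis by (simp add: 0)
  qed
  have minY: "minimal_above n N Y"
  proof (rule minimal_aboveI[OF Ys Nc])
    fix x :: "real vec" assume x: "x \<in> carrier_vec n"
    show "0 \<le> bil Y x x" unfolding Yxy[OF x x] by (auto intro: sum_nonneg)
    have "0 \<le> bil Y x x - bil N x x" unfolding diff[OF x x] by (auto intro: sum_nonneg)
    then show "bil N x x \<le> bil Y x x" by simp
    \<comment> \<open>\<open>y\<close> collects the basis vectors of sign -1, on which
      \<open>Y\<close> vanishes, and \<open>z\<close> those of sign 1, on which \<open>Y - N\<close>
      vanishes; this is the splitting demanded by \<open>minimal_aboveI\<close>.\<close>
    define y where "y = lincomb n (R - R1) (\<lambda>w. bil N w w * bil N w x) (\<lambda>w. w)"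
    define z where "z = lincomb n R1 (\<lambda>w. bil N w w * bil N w x) (\<lambda>w. w)"
    have yz: "y \<in> carrier_vec n" "z \<in> carrier_vec n" by (auto simp: y_def z_def)
    have "bil Y y y = 0" unfolding Yxy[OF yz(1) yz(1)]
      using finR1 by (intro sum.neutral) (auto simp: y_def bilR)
    moreover have "bil Y z z - bil N z z = 0" unfolding diff[OF yz(2) yz(2)]
      using finR1 by (intro sum.neutral) (auto simp: z_def bilR)
    moreover have "lincomb n R (\<lambda>w. bil N w w * bil N w x) (\<lambda>w. w) = y + z"
      unfolding y_def z_def using finR finR1 by (intro eq_vecI) (auto simp: sum.subset_diff)
    then have "x = y + z" using expR[OF x] by metis
    ultimately show "\<exists>y\<in>carrier_vec n. \<exists>z\<in>carrier_vec n. x = y + z \<and> bil Y y y = 0 \<and> bil Y z z = bil N z z"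
      using yz by force
  qed
  \<comment> \<open>Definiteness fixes the signs of the vectors taken from \<open>U\<close> and
    \<open>V\<close>. A vector of \<open>U\<close> is a combination of positive basis vectors, hence
    orthogonal to \<open>R - R1\<close>, from which \<open>Y - N\<close> is built; a vector of
    \<open>V\<close> is likewise orthogonal to \<open>R1\<close>, from which \<open>Y\<close> is
    built.\<close>
  have Sone: "w \<in> R1" if "w \<in> S" for w
  proof -
    have "w \<in> R" using that R(1) by auto
    have "w \<noteq> 0\<^sub>v n" using one[OF \<open>w \<in> R\<close>] Nc by auto
    then have "bil N w w > 0" using pos that S(1) by (auto simp: pos_def_over_def qform_bil)
    then show ?thesis using one[OF \<open>w \<in> R\<close>] \<open>w \<in> R\<close> by (auto simp: R1_def)
  qed
  have Tone: "w \<in> R - R1" if "w \<in> T" for w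
  proof -
    have "w \<in> R" using that R(1) by auto
    have "w \<noteq> 0\<^sub>v n" using one[OF \<open>w \<in> R\<close>] Nc by auto
    then have "bil N w w < 0" using neg that T(1) by (auto simp: neg_def_over_def qform_bil)
    then show ?thesis using \<open>w \<in> R\<close> by (auto simp: R1_def)
  qed
  have "Y *\<^sub>v u = N *\<^sub>v u" if u: "u \<in> U" for u
  proof -
    have w0: "bil N w u = 0" if "w \<in> R - R1" for w
    proof -
      have "bil N w (lincomb n S (\<lambda>w. bil N w w * bil N w u) (\<lambda>w. w)) = 0"
        using that Sone R(1) by (intro bilR) auto
      then show ?thesis using expS[OF u] by metis
    qed
    have "bil Y y u - bil N y u = 0" if "y \<in> carrier_vec n" for y
      unfolding diff[OF Uc[OF u] that] by (intro sum.neutral) (simp add: w0)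
    then have "bil (Y - N) y u = 0" if "y \<in> carrier_vec n" for y
      using bil_diff_mat[OF Yc Nc that Uc[OF u]] that by simp
    moreover have c: "(Y - N) *\<^sub>v u \<in> carrier_vec n"
      by (rule mult_mat_vec_carrier[OF minus_carrier_mat[OF Nc] Uc[OF u]])
    ultimately have "((Y - N) *\<^sub>v u) \<bullet> ((Y - N) *\<^sub>v u) = 0" by (simp add: bil_def)
    then have "(Y - N) *\<^sub>v u = 0\<^sub>v n" using scalar_prod_self_eq_0[OF c] by simp
    then have "Y *\<^sub>v u - N *\<^sub>v u = 0\<^sub>v n"
      by (simp only: minus_mult_distrib_mat_vec[OF Yc Nc Uc[OF u]])
    then show ?thesis
      by (rule vec_eq_if_diff_0[OF mult_mat_vec_carrier[OF Yc Uc[OF u]] mult_mat_vec_carrier[OF Nc Uc[OF u]]])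
  qed
  moreover have "Y *\<^sub>v v = 0\<^sub>v n" if v: "v \<in> V" for v
  proof -
    have w0: "bil N w v = 0" if "w \<in> R1" for w
    proof -
      have "bil N w (lincomb n T (\<lambda>w. bil N w w * bil N w v) (\<lambda>w. w)) = 0"
        using that Tone R(1) finR1 by (intro bilR) auto
      then show ?thesis using expT[OF v] by metis
    qed
    show ?thesis unfolding Yx[OF Vc[OF v]] by (intro eq_vecI) (simp_all add: w0)
  qed
  ultimately show ?thesis using minY by blast
qed

theorem solution_exists_iff:
  assumes A: "A \<in> sym_mats n" and B: "B \<in> sym_mats n" and i: "inertia (A - B) = (p, q, 0)"
    and U: "subspace_n n U" and V: "subspace_n n V"
  shows "(\<exists>C. is_solution n A B U V C) \<longleftrightarrow> pos_def_over n (A - B) U \<and> neg_def_over n (A - B) V \<and>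
    (\<forall>u\<in>U. \<forall>v\<in>V. u \<bullet> ((A - B) *\<^sub>v v) = 0)"
proof -
  define N where "N = A - B"
  have N: "N \<in> sym_mats n" using sym_mats_diff[OF A B] by (simp add: N_def)
  have ns: "x = 0\<^sub>v n" if "x \<in> carrier_vec n" "N *\<^sub>v x = 0\<^sub>v n" for x
    using inertia_nonsingular[OF sym_matsD(1)[OF N]] i that by (auto simp: N_def)
  have UV: "U \<subseteq> carrier_vec n" "V \<subseteq> carrier_vec n" using U V by (auto simp: subspace_n_def)
  have "(\<exists>C. is_solution n A B U V C) \<longleftrightarrow> (\<exists>Y\<in>sym_mats n. is_solution n A B U V (A - Y))"
  proof
    assume "\<exists>C. is_solution n A B U V C"
    then obtain C where C: "is_solution n A B U V C" by auto
    then have Cs: "C \<in> sym_mats n" by (simp add: is_solution_def max_lower_bound_def)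
    have "A - (A - C) = C" using sym_matsD(1)[OF A] sym_matsD(1)[OF Cs] by (intro eq_matI) auto
    then show "\<exists>Y\<in>sym_mats n. is_solution n A B U V (A - Y)"
      using C sym_mats_diff[OF A Cs] by (intro bexI[of _ "A - C"]) auto
  qed auto
  also have "\<dots> \<longleftrightarrow> (\<exists>Y. minimal_above n N Y \<and> (\<forall>u\<in>U. Y *\<^sub>v u = N *\<^sub>v u) \<and> (\<forall>v\<in>V. Y *\<^sub>v v = 0\<^sub>v n))"
    using is_solution_iff[OF A B _ UV] by (auto simp: N_def minimal_above_def)
  also have "\<dots> \<longleftrightarrow> pos_def_over n N U \<and> neg_def_over n N V \<and> (\<forall>u\<in>U. \<forall>v\<in>V. u \<bullet> (N *\<^sub>v v) = 0)"
    (is "?L \<longleftrightarrow> ?R")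
  proof
    assume ?L
    then obtain Y where Y: "minimal_above n N Y" "\<And>u. u \<in> U \<Longrightarrow> Y *\<^sub>v u = N *\<^sub>v u"
      "\<And>v. v \<in> V \<Longrightarrow> Y *\<^sub>v v = 0\<^sub>v n" by blast
    show ?R using minimal_above_necessary[OF N ns UV Y] by blast
  next
    assume ?R
    then show ?L using minimal_above_exists[OF N ns U V] by (auto simp: bil_def)
  qed
  finally show ?thesis by (simp add: N_def)
qed

section \<open>The parametrization by rectangular matrices\<close>

lemma proj_append[simp]:
  assumes "a \<in> carrier_vec p" "b \<in> carrier_vec q"
  shows "proj_first p (a @\<^sub>v b) = a" "proj_last q (a @\<^sub>v b) = b"
  using assms by (auto simp: proj_first_def proj_last_def intro!: eq_vecI)

lemma proj_carrier[simp]: "proj_first p x \<in> carrier_vec p" "proj_last q x \<in> carrier_vec q"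
  by (auto simp: proj_first_def proj_last_def)

lemma append_proj: "x \<in> carrier_vec (p + q) \<Longrightarrow> proj_first p x @\<^sub>v proj_last q x = x"
  by (intro eq_vecI) (auto simp: proj_first_def proj_last_def carrier_vecD)

lemma J_mat_sym: "J_mat p q \<in> sym_mats (p + q)"
proof -
  have *: "1\<^sub>m p \<in> carrier_mat p p" "0\<^sub>m p q \<in> carrier_mat p q" "0\<^sub>m q p \<in> carrier_mat q p" "- 1\<^sub>m q \<in> carrier_mat q q" by auto
  show ?thesis
    by (auto simp: sym_mats_def J_mat_def transpose_four_block_mat[OF *] transpose_uminus)
qed

lemma J_mat_carrier[simp]: "J_mat p q \<in> carrier_mat (p + q) (p + q)"
  using sym_matsD[OF J_mat_sym] by simp

lemma four_block_mult_append:
  assumes "A \<in> carrier_mat p p" "B \<in> carrier_mat p q" "C \<in> carrier_mat q p" "D \<in> carrier_mat q q"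
    "a \<in> carrier_vec p" "b \<in> carrier_vec q"
  shows "four_block_mat A B C D *\<^sub>v (a @\<^sub>v b) = (A *\<^sub>v a + B *\<^sub>v b) @\<^sub>v (C *\<^sub>v a + D *\<^sub>v b)"
  using assms by (rule four_block_mat_mult_vec)

lemma J_mat_mult_append:
  assumes "a \<in> carrier_vec p" "b \<in> carrier_vec q"
  shows "J_mat p q *\<^sub>v (a @\<^sub>v b) = a @\<^sub>v (- b)"
  unfolding J_mat_def using assms
  by (subst four_block_mult_append) auto

lemma J_mat_squared: "J_mat p q * J_mat p q = 1\<^sub>m (p + q)"
proof (rule mat_eq_mult_vecI[of _ "p + q" "p + q"])
  fix x :: "real vec" assume x: "x \<in> carrier_vec (p + q)"
  have "J_mat p q * J_mat p q *\<^sub>v x = J_mat p q *\<^sub>v (J_mat p q *\<^sub>v (proj_first p x @\<^sub>v proj_last q x))"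
    using x by (simp add: append_proj assoc_mult_mat_vec[of _ "p + q" "p + q" _ "p + q"])
  also have "\<dots> = proj_first p x @\<^sub>v proj_last q x" by (simp add: J_mat_mult_append)
  also have "\<dots> = x" by (rule append_proj[OF x])
  finally show "J_mat p q * J_mat p q *\<^sub>v x = 1\<^sub>m (p + q) *\<^sub>v x" using x by simp
qed (rule mult_carrier_mat J_mat_carrier one_carrier_mat)+

lemma bil_J_mat:
  assumes "x \<in> carrier_vec (p + q)"
  shows "bil (J_mat p q) x x = proj_first p x \<bullet> proj_first p x - proj_last q x \<bullet> proj_last q x"
proof -
  have "bil (J_mat p q) x x = (proj_first p x @\<^sub>v proj_last q x) \<bullet> (J_mat p q *\<^sub>v (proj_first p x @\<^sub>v proj_last q x))"
    using assms by (simp add: append_proj bil_def)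
  then show ?thesis by (simp add: J_mat_mult_append scalar_prod_append[of _ p _ q])
qed

lemma one_plus_mult_vec:
  fixes A B :: "real mat"
  assumes "A \<in> carrier_mat p q" "B \<in> carrier_mat q p" "x \<in> carrier_vec p"
  shows "(1\<^sub>m p + A * B) *\<^sub>v x = x + A *\<^sub>v (B *\<^sub>v x)"
  using assms by (simp add: add_mult_distrib_mat_vec[of _ p p] assoc_mult_mat_vec[of _ p q _ p])

lemma pos_def_one_plus_gram:
  assumes M: "M \<in> carrier_mat p q"
  shows "pos_def_mat p (1\<^sub>m p + M * transpose_mat M)"
proof -
  have c: "M * transpose_mat M \<in> carrier_mat p p" using M by auto
  have "1\<^sub>m p + M * transpose_mat M \<in> sym_mats p"
    using M c by (auto simp: sym_mats_def transpose_add[of _ p p] transpose_mult[of _ p q _ p])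
  moreover have "bil (1\<^sub>m p + M * transpose_mat M) x x > 0" if x: "x \<in> carrier_vec p" "x \<noteq> 0\<^sub>v p" for x
  proof -
    have y: "transpose_mat M *\<^sub>v x \<in> carrier_vec q" using M x by auto
    have "bil (1\<^sub>m p + M * transpose_mat M) x x = x \<bullet> (x + M *\<^sub>v (transpose_mat M *\<^sub>v x))"
      using M x by (simp add: bil_def one_plus_mult_vec)
    also have "\<dots> = x \<bullet> x + x \<bullet> (M *\<^sub>v (transpose_mat M *\<^sub>v x))"
      using M x y by (subst scalar_prod_add_distrib[of _ p]) auto
    also have "x \<bullet> (M *\<^sub>v (transpose_mat M *\<^sub>v x)) = (transpose_mat M *\<^sub>v x) \<bullet> (transpose_mat M *\<^sub>v x)"
      using scalar_prod_mult_mat_vec[OF M x(1) y] .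
    finally show ?thesis
      using scalar_prod_self_pos[OF x] scalar_prod_self_ge_0[of "transpose_mat M *\<^sub>v x"] by linarith
  qed
  ultimately show ?thesis by (simp add: pos_def_mat_def)
qed

text \<open>The intertwining relation \<open>P M = M Q\<close> follows from \<open>P\<^sup>2 M = M Q\<^sup>2\<close>, i.e. \<open>P (P M - M Q) + (P M - M Q) Q = 0\<close>.\<close>
lemma S_mat_blocks:
  assumes M: "M \<in> carrier_mat p q"
  obtains P Z Q where "pos_def_mat p P" "pos_def_mat p Z" "pos_def_mat q Q"
    "P * Z = 1\<^sub>m p" "Z * P = 1\<^sub>m p"
    "P * P = 1\<^sub>m p + M * transpose_mat M" "Q * Q = 1\<^sub>m q + transpose_mat M * M" "P * M = M * Q"
    "S_mat p q M = four_block_mat P M (transpose_mat M) Q" "phi_pq p q M = Z * M"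
proof -
  obtain P Z where P: "pos_def_mat p P" "pos_def_mat p Z" "P * P = 1\<^sub>m p + M * transpose_mat M"
    "P * Z = 1\<^sub>m p" "Z * P = 1\<^sub>m p"
    using pos_def_sqrt_exists[OF pos_def_one_plus_gram[OF M]] by blast
  have Mt: "transpose_mat M \<in> carrier_mat q p" using M by auto
  obtain Q where Q: "pos_def_mat q Q" "Q * Q = 1\<^sub>m q + transpose_mat M * M"
    using pos_def_sqrt_exists[OF pos_def_one_plus_gram[OF Mt]] by auto
  note Pc = pos_def_matD(2)[OF P(1)] and Qc = pos_def_matD(2)[OF Q(1)]
  have PM: "P * M \<in> carrier_mat p q" "M * Q \<in> carrier_mat p q" using Pc Qc M by auto
  have MMt: "M * transpose_mat M \<in> carrier_mat p p" "transpose_mat M * M \<in> carrier_mat q q" using M by auto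
  have "P * (P * M) = P * P * M" using Pc M by simp
  also have "\<dots> = M + M * transpose_mat M * M" using M MMt by (simp add: P(3) add_mult_distrib_mat[of _ p p])
  also have "\<dots> = M + M * (transpose_mat M * M)" using assoc_mult_mat[OF M Mt M] by simp
  also have "\<dots> = M * (Q * Q)" using M by (simp only: Q(2) mult_add_distrib_mat[OF M one_carrier_mat MMt(2)] right_mult_one_mat[OF M])
  also have "\<dots> = M * Q * Q" using M Qc by simp
  finally have eq: "P * (P * M) = M * Q * Q" .
  have "P * (P * M - M * Q) + (P * M - M * Q) * Q = (P * (P * M) - P * (M * Q)) + (P * M * Q - M * Q * Q)"
    by (simp only: mult_minus_distrib_mat[OF Pc PM] minus_mult_distrib_mat[OF PM Qc])
  also have "\<dots> = (M * Q * Q - P * (M * Q)) + (P * (M * Q) - M * Q * Q)"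
    by (simp only: eq assoc_mult_mat[OF Pc M Qc])
  also have "\<dots> = 0\<^sub>m p q"
  proof -
    have "X - Y + (Y - X) = 0\<^sub>m p q" if "X \<in> carrier_mat p q" "Y \<in> carrier_mat p q" for X Y :: "real mat"
      using that by (intro eq_matI) auto
    then show ?thesis using mult_carrier_mat[OF PM(2) Qc] mult_carrier_mat[OF Pc PM(2)] by blast
  qed
  finally have "P * M - M * Q = 0\<^sub>m p q"
    by (rule sylvester_unique[OF Pc pos_def_mat_psd[OF P(1)] Q(1) minus_carrier_mat[OF PM(2)]])
  then have "P * M = M * Q" by (rule mat_eq_if_diff_0[OF PM])
  moreover have "S_mat p q M = four_block_mat P M (transpose_mat M) Q"
    by (simp add: S_mat_def P(3)[symmetric] Q(2)[symmetric] psd_sqrt_eqI[OF P(1)] psd_sqrt_eqI[OF Q(1)])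
  moreover have "phi_pq p q M = Z * M"
    by (simp add: phi_pq_def P(3)[symmetric] inv_psd_sqrt_eqI[OF P(1,2,4,5)])
  ultimately show ?thesis using P Q that by blast
qed

section \<open>The candidate matrices \<open>S (I \<oplus> 0) S\<close>\<close>

abbreviation (input) Y_mat :: "nat \<Rightarrow> nat \<Rightarrow> real mat \<Rightarrow> real mat" where
  "Y_mat p q M \<equiv> S_mat p q M * E_mat p q * S_mat p q M"

text \<open>\<open>E_mat\<close> deletes the second block column of \<open>S\<close>, so
  \<open>Y\<close> is the first block column of \<open>S\<close> times its transpose, the block row
  (P, M).\<close>

lemma Y_mat_blocks:
  assumes M: "M \<in> carrier_mat p q" and P: "P \<in> carrier_mat p p" and Q: "Q \<in> carrier_mat q q"
    and S: "S_mat p q M = four_block_mat P M (transpose_mat M) Q"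
  shows "Y_mat p q M = four_block_mat (P * P) (P * M) (transpose_mat M * P) (transpose_mat M * M)"
proof -
  have Mt: "transpose_mat M \<in> carrier_mat q p" using M by auto
  have c: "P * P \<in> carrier_mat p p" "P * M \<in> carrier_mat p q" "transpose_mat M * P \<in> carrier_mat q p"
     "transpose_mat M * M \<in> carrier_mat q q" "0\<^sub>m p q * transpose_mat M \<in> carrier_mat p p" using M P by auto
  have "four_block_mat P M (transpose_mat M) Q * E_mat p q =
     four_block_mat P (0\<^sub>m p q) (transpose_mat M) (0\<^sub>m q q)"
    unfolding E_mat_def using M Mt P Q
    by (subst mult_four_block_mat[of _ p p _ q _ q _ _ p _ q]) auto
  then show ?thesis
    unfolding S using M Mt P Q c
    by (simp, subst mult_four_block_mat[of _ p p _ q _ q _ _ p _ q]) auto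
qed

lemma pos_def_inj:
  assumes P: "pos_def_mat n P" and x: "x \<in> carrier_vec n" "P *\<^sub>v x = 0\<^sub>v n"
  shows "x = 0\<^sub>v n"
  using pos_def_matD(4)[OF P x(1)] x by (fastforce simp: bil_def)

lemma append_vec_eq_0:
  assumes "(a :: real vec) \<in> carrier_vec p" "b \<in> carrier_vec q"
  shows "a @\<^sub>v b = 0\<^sub>v (p + q) \<longleftrightarrow> a = 0\<^sub>v p \<and> b = 0\<^sub>v q"
proof -
  have "0\<^sub>v (p + q) = 0\<^sub>v p @\<^sub>v (0\<^sub>v q :: real vec)" by (intro eq_vecI) auto
  then show ?thesis using assms by (simp add: append_vec_eq[of _ p])
qed

text \<open>Cauchy-Schwarz row by row; the constant is the squared Frobenius norm of
  \<open>A\<close>.\<close>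

lemma mult_mat_vec_norm_bound:
  fixes A :: "real mat"
  assumes A: "A \<in> carrier_mat m n"
  shows "\<exists>c\<ge>0. \<forall>x\<in>carrier_vec n. (A *\<^sub>v x) \<bullet> (A *\<^sub>v x) \<le> c * (x \<bullet> x)"
proof (intro exI conjI ballI)
  show "(\<Sum>i<m. row A i \<bullet> row A i) \<ge> 0" by (intro sum_nonneg scalar_prod_self_ge_0)
  fix x :: "real vec" assume x: "x \<in> carrier_vec n"
  have "(A *\<^sub>v x) \<bullet> (A *\<^sub>v x) = (\<Sum>i<m. (row A i \<bullet> x)\<^sup>2)"
    using A by (simp add: scalar_prod_def[of _ "A *\<^sub>v x"] atLeast0LessThan power2_eq_square)
  also have "\<dots> \<le> (\<Sum>i<m. (row A i \<bullet> row A i) * (x \<bullet> x))"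
  proof (rule sum_mono)
    fix i assume "i \<in> {..<m}"
    then have r: "row A i \<in> carrier_vec n" using A by auto
    have "(bil (1\<^sub>m n) (row A i) x)\<^sup>2 \<le> bil (1\<^sub>m n) (row A i) (row A i) * bil (1\<^sub>m n) x x"
      using r x by (intro psd_cauchy_schwarz[OF one_sym_mats]) (auto simp: bil_one scalar_prod_self_ge_0)
    then show "(row A i \<bullet> x)\<^sup>2 \<le> (row A i \<bullet> row A i) * (x \<bullet> x)" using r x by (simp add: bil_one)
  qed
  finally show "(A *\<^sub>v x) \<bullet> (A *\<^sub>v x) \<le> (\<Sum>i<m. row A i \<bullet> row A i) * (x \<bullet> x)"
    by (simp add: sum_distrib_right)
qed

text \<open>The relations between \<open>P\<close>, \<open>Q\<close> and \<open>M\<close> amount to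
  \<open>S J S = J\<close>. Hence \<open>Y = S (I \<oplus> 0) S\<close> and
  \<open>Y - J = S (0 \<oplus> I) S\<close>, with quadratic forms equal to the squared lengths of
  the upper and the lower half of \<open>S x\<close>. The claims are proved together because they
  share these computations.\<close>

lemma Y_mat_properties:
  assumes M: "M \<in> carrier_mat p q"
  shows Y_mat_sym: "Y_mat p q M \<in> sym_mats (p + q)"
    and Y_mat_minimal: "minimal_above (p + q) (J_mat p q) (Y_mat p q M)"
    and Y_mat_kernel: "\<And>x. x \<in> carrier_vec (p + q) \<Longrightarrow> Y_mat p q M *\<^sub>v x = 0\<^sub>v (p + q) \<longleftrightarrow>
        phi_pq p q M *\<^sub>v proj_last q x + proj_first p x = 0\<^sub>v p"
    and Y_mat_agrees: "\<And>x. x \<in> carrier_vec (p + q) \<Longrightarrow> Y_mat p q M *\<^sub>v x = J_mat p q *\<^sub>v x \<longleftrightarrow>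
        transpose_mat (phi_pq p q M) *\<^sub>v proj_first p x + proj_last q x = 0\<^sub>v q"
    and phi_pq_carrier: "phi_pq p q M \<in> carrier_mat p q"
    and phi_pq_contraction: "\<exists>r\<ge>0. r < 1 \<and> (\<forall>y\<in>carrier_vec q.
        (phi_pq p q M *\<^sub>v y) \<bullet> (phi_pq p q M *\<^sub>v y) \<le> r * (y \<bullet> y))"
proof -
  obtain P Z Q where P: "pos_def_mat p P" and Z: "pos_def_mat p Z" and Q: "pos_def_mat q Q"
    and PZ: "P * Z = 1\<^sub>m p" "Z * P = 1\<^sub>m p"
    and PP: "P * P = 1\<^sub>m p + M * transpose_mat M" and QQ: "Q * Q = 1\<^sub>m q + transpose_mat M * M"
    and PM: "P * M = M * Q"
    and S: "S_mat p q M = four_block_mat P M (transpose_mat M) Q" and phi: "phi_pq p q M = Z * M"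
    using S_mat_blocks[OF M] by metis
  note Pc = pos_def_matD(2)[OF P] and Qc = pos_def_matD(2)[OF Q] and Zc = pos_def_matD(2)[OF Z]
  define T where "T = transpose_mat M"
  have Tc: "T \<in> carrier_mat q p" using M by (simp add: T_def)
  define R where "R = Z * M"
  have Rc: "R \<in> carrier_mat p q" using Zc M by (simp add: R_def)
  show "phi_pq p q M \<in> carrier_mat p q" using Rc by (simp add: phi R_def)
  have TP: "T * P = Q * T"
    using arg_cong[OF PM, of transpose_mat] transpose_mult[OF Pc M] transpose_mult[OF M Qc]
    by (simp add: T_def pos_def_matD(3)[OF P] pos_def_matD(3)[OF Q])
  have PPv: "P *\<^sub>v (P *\<^sub>v a) = a + M *\<^sub>v (T *\<^sub>v a)" if a: "a \<in> carrier_vec p" for a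
    using assoc_mult_mat_vec[OF Pc Pc a] one_plus_mult_vec[OF M Tc a] by (simp add: PP T_def)
  have QQv: "Q *\<^sub>v (Q *\<^sub>v b) = b + T *\<^sub>v (M *\<^sub>v b)" if b: "b \<in> carrier_vec q" for b
    using assoc_mult_mat_vec[OF Qc Qc b] one_plus_mult_vec[OF Tc M b] by (simp add: QQ T_def)
  have PMv: "P *\<^sub>v (M *\<^sub>v b) = M *\<^sub>v (Q *\<^sub>v b)" if b: "b \<in> carrier_vec q" for b
    using assoc_mult_mat_vec[OF Pc M b] assoc_mult_mat_vec[OF M Qc b] by (simp only: PM)
  have TPv: "T *\<^sub>v (P *\<^sub>v a) = Q *\<^sub>v (T *\<^sub>v a)" if a: "a \<in> carrier_vec p" for a
    using assoc_mult_mat_vec[OF Tc Pc a] assoc_mult_mat_vec[OF Qc Tc a] by (simp only: TP)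
  \<comment> \<open>\<open>f a b\<close> and \<open>g a b\<close> are the upper and lower half of
    \<open>S\<close> applied to (a, b).\<close>
  define f where "f a b = P *\<^sub>v a + M *\<^sub>v b" for a b
  define g where "g a b = T *\<^sub>v a + Q *\<^sub>v b" for a b
  have fc: "f a b \<in> carrier_vec p" and gc: "g a b \<in> carrier_vec q"
    if "a \<in> carrier_vec p" "b \<in> carrier_vec q" for a b
    using that Pc M Tc Qc by (auto simp: f_def g_def)
  have carr: "P *\<^sub>v a \<in> carrier_vec p" "T *\<^sub>v a \<in> carrier_vec q" "Q *\<^sub>v b \<in> carrier_vec q" "M *\<^sub>v b \<in> carrier_vec p"
    if "a \<in> carrier_vec p" "b \<in> carrier_vec q" for a b
    using that Pc M Tc Qc by auto
  have Yv: "Y_mat p q M *\<^sub>v (a @\<^sub>v b) = (P *\<^sub>v f a b) @\<^sub>v (T *\<^sub>v f a b)"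
    if ab: "a \<in> carrier_vec p" "b \<in> carrier_vec q" for a b
  proof -
    have c: "P * P \<in> carrier_mat p p" "P * M \<in> carrier_mat p q" "T * P \<in> carrier_mat q p" "T * M \<in> carrier_mat q q"
      using Pc M Tc by auto
    have "Y_mat p q M *\<^sub>v (a @\<^sub>v b) = (P * P *\<^sub>v a + P * M *\<^sub>v b) @\<^sub>v (T * P *\<^sub>v a + T * M *\<^sub>v b)"
      unfolding Y_mat_blocks[OF M Pc Qc S] T_def[symmetric] by (rule four_block_mult_append[OF c ab])
    also have "\<dots> = (P *\<^sub>v f a b) @\<^sub>v (T *\<^sub>v f a b)"
      unfolding f_def using Pc M Tc ab carr[OF ab]
      by (simp add: mult_add_distrib_mat_vec[OF Pc] mult_add_distrib_mat_vec[OF Tc]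
          assoc_mult_mat_vec[OF Pc] assoc_mult_mat_vec[OF Tc])
    finally show ?thesis .
  qed
  \<comment> \<open>The two rows of \<open>S J S = J\<close>: \<open>P f - M g = a\<close> and
    \<open>Q g - T f = b\<close>. They recover (a, b) from \<open>f\<close> and
    \<open>g\<close>.\<close>
  have Pf: "P *\<^sub>v f a b = a + M *\<^sub>v g a b" and Tf: "T *\<^sub>v f a b = Q *\<^sub>v g a b - b"
    if ab: "a \<in> carrier_vec p" "b \<in> carrier_vec q" for a b
  proof -
    note c = carr[OF ab] carr[OF carr(1)[OF ab] carr(2)[OF ab]] carr[OF carr(4)[OF ab] carr(3)[OF ab]] carr[OF carr(1)[OF ab] carr(3)[OF ab]]
    have "P *\<^sub>v f a b = a + M *\<^sub>v (T *\<^sub>v a) + M *\<^sub>v (Q *\<^sub>v b)"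
      unfolding f_def using c ab by (simp add: mult_add_distrib_mat_vec[OF Pc] PPv PMv)
    also have "\<dots> = a + (M *\<^sub>v (T *\<^sub>v a) + M *\<^sub>v (Q *\<^sub>v b))"
      using c ab by (intro assoc_add_vec[of _ p]) auto
    also have "\<dots> = a + M *\<^sub>v g a b"
      unfolding g_def using c ab by (simp add: mult_add_distrib_mat_vec[OF M])
    finally show "P *\<^sub>v f a b = a + M *\<^sub>v g a b" .
    have "Q *\<^sub>v g a b = Q *\<^sub>v (T *\<^sub>v a) + (b + T *\<^sub>v (M *\<^sub>v b))"
      unfolding g_def using c ab by (simp add: mult_add_distrib_mat_vec[OF Qc] QQv)
    moreover have "T *\<^sub>v f a b = Q *\<^sub>v (T *\<^sub>v a) + T *\<^sub>v (M *\<^sub>v b)"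
      unfolding f_def using c ab by (simp add: mult_add_distrib_mat_vec[OF Tc] TPv)
    ultimately show "T *\<^sub>v f a b = Q *\<^sub>v g a b - b"
      using c ab Tc Qc by (intro eq_vecI) auto
  qed
  have Ys: "Y_mat p q M \<in> sym_mats (p + q)"
  proof -
    have c: "P * P \<in> carrier_mat p p" "P * M \<in> carrier_mat p q" "T * P \<in> carrier_mat q p" "T * M \<in> carrier_mat q q"
      using Pc M Tc by auto
    have t: "transpose_mat (P * P) = P * P" "transpose_mat (T * P) = P * M"
      "transpose_mat (P * M) = T * P" "transpose_mat (T * M) = T * M"
      using transpose_mult[OF Pc Pc] transpose_mult[OF Pc M] transpose_mult[OF Tc Pc] transpose_mult[OF Tc M]
      by (simp_all add: pos_def_matD(3)[OF P] T_def)
    show ?thesis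
      unfolding Y_mat_blocks[OF M Pc Qc S] T_def[symmetric] sym_mats_def
      using c t by (simp add: transpose_four_block_mat[OF c])
  qed
  then show "Y_mat p q M \<in> sym_mats (p + q)" .
  note Yc = sym_matsD(1)[OF Ys]
  have bilY: "bil (Y_mat p q M) (a @\<^sub>v b) (a @\<^sub>v b) = f a b \<bullet> f a b"
    if ab: "a \<in> carrier_vec p" "b \<in> carrier_vec q" for a b
  proof -
    note ac = fc[OF ab]
    have "bil (Y_mat p q M) (a @\<^sub>v b) (a @\<^sub>v b) = a \<bullet> (P *\<^sub>v f a b) + b \<bullet> (T *\<^sub>v f a b)"
      unfolding bil_def Yv[OF ab] using ab ac Pc Tc by (intro scalar_prod_append) auto
    also have "\<dots> = (P *\<^sub>v a) \<bullet> f a b + (M *\<^sub>v b) \<bullet> f a b"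
      using scalar_prod_mult_mat_vec[OF Pc ab(1) ac] scalar_prod_mult_mat_vec[OF Tc ab(2) ac]
      by (simp add: pos_def_matD(3)[OF P] T_def)
    also have "\<dots> = f a b \<bullet> f a b"
      using carr[OF ab] ac by (subst (3) f_def) (simp add: add_scalar_prod_distrib[of _ p])
    finally show ?thesis .
  qed
  have YJ: "Y_mat p q M *\<^sub>v (a @\<^sub>v b) - J_mat p q *\<^sub>v (a @\<^sub>v b) = (M *\<^sub>v g a b) @\<^sub>v (Q *\<^sub>v g a b)"
    if ab: "a \<in> carrier_vec p" "b \<in> carrier_vec q" for a b
    unfolding Yv[OF ab] J_mat_mult_append[OF ab] Pf[OF ab] Tf[OF ab]
    using ab gc[OF ab] M Qc by (intro eq_vecI) auto
  have bilYJ: "bil (Y_mat p q M) (a @\<^sub>v b) (a @\<^sub>v b) - bil (J_mat p q) (a @\<^sub>v b) (a @\<^sub>v b) = g a b \<bullet> g a b"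
    if ab: "a \<in> carrier_vec p" "b \<in> carrier_vec q" for a b
  proof -
    note bc = gc[OF ab]
    have abc: "a @\<^sub>v b \<in> carrier_vec (p + q)" using ab by simp
    have "bil (Y_mat p q M) (a @\<^sub>v b) (a @\<^sub>v b) - bil (J_mat p q) (a @\<^sub>v b) (a @\<^sub>v b) =
        (a @\<^sub>v b) \<bullet> ((M *\<^sub>v g a b) @\<^sub>v (Q *\<^sub>v g a b))"
      unfolding bil_def YJ[OF ab, symmetric]
      by (rule scalar_prod_minus_distrib[symmetric, OF abc mult_mat_vec_carrier[OF Yc abc] mult_mat_vec_carrier[OF J_mat_carrier abc]])
    also have "\<dots> = a \<bullet> (M *\<^sub>v g a b) + b \<bullet> (Q *\<^sub>v g a b)"
      using ab bc M Qc by (intro scalar_prod_append) auto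
    also have "\<dots> = (T *\<^sub>v a) \<bullet> g a b + (Q *\<^sub>v b) \<bullet> g a b"
      using scalar_prod_mult_mat_vec[OF M ab(1) bc] scalar_prod_mult_mat_vec[OF Qc ab(2) bc]
      by (simp add: pos_def_matD(3)[OF Q] T_def)
    also have "\<dots> = g a b \<bullet> g a b"
      using carr[OF ab] bc by (subst (3) g_def) (simp add: add_scalar_prod_distrib[of _ q])
    finally show ?thesis .
  qed
  show "minimal_above (p + q) (J_mat p q) (Y_mat p q M)"
  proof (rule minimal_aboveI[OF Ys J_mat_carrier])
    fix x :: "real vec" assume x: "x \<in> carrier_vec (p + q)"
    define a where "a = proj_first p x"
    define b where "b = proj_last q x"
    have ab: "a \<in> carrier_vec p" "b \<in> carrier_vec q" and xab: "x = a @\<^sub>v b"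
      using append_proj[OF x] by (auto simp: a_def b_def)
    show "0 \<le> bil (Y_mat p q M) x x" unfolding xab bilY[OF ab] by (rule scalar_prod_self_ge_0)
    show "bil (J_mat p q) x x \<le> bil (Y_mat p q M) x x"
      unfolding xab using bilYJ[OF ab] scalar_prod_self_ge_0[of "g a b"] by linarith
    note ac = fc[OF ab] and bc = gc[OF ab]
    \<comment> \<open>The splitting is read off from \<open>a = P f - M g\<close> and
      \<open>b = Q g - T f\<close>. The terms in \<open>g\<close> form a vector whose upper half
      under \<open>S\<close> is 0 because \<open>P M = M Q\<close>; the terms in \<open>f\<close>
      form one whose lower half is 0 because \<open>T P = Q T\<close>.\<close>
    define y1 where "y1 = - (M *\<^sub>v g a b)"
    define y2 where "y2 = Q *\<^sub>v g a b"
    define z1 where "z1 = P *\<^sub>v f a b"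
    define z2 where "z2 = - (T *\<^sub>v f a b)"
    have y: "y1 \<in> carrier_vec p" "y2 \<in> carrier_vec q" and z: "z1 \<in> carrier_vec p" "z2 \<in> carrier_vec q"
      using ac bc M Qc Pc Tc by (auto simp: y1_def y2_def z1_def z2_def)
    have neg: "A *\<^sub>v (- v) = - (A *\<^sub>v v)" if "A \<in> carrier_mat m k" "v \<in> carrier_vec k" for A :: "real mat" and v m k
      using that by (intro eq_vecI) auto
    have "f y1 y2 = 0\<^sub>v p"
      unfolding f_def y1_def y2_def using carr[OF ac bc] carr[OF carr(4)[OF ac bc] carr(3)[OF ac bc]] bc
      by (simp add: neg[OF Pc] PMv)
    then have 1: "bil (Y_mat p q M) (y1 @\<^sub>v y2) (y1 @\<^sub>v y2) = 0" by (simp add: bilY[OF y])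
    have "g z1 z2 = 0\<^sub>v q"
      unfolding g_def z1_def z2_def using carr[OF ac bc] carr[OF carr(1)[OF ac bc] carr(2)[OF ac bc]] ac
      by (simp add: neg[OF Qc] TPv)
    then have 2: "bil (Y_mat p q M) (z1 @\<^sub>v z2) (z1 @\<^sub>v z2) = bil (J_mat p q) (z1 @\<^sub>v z2) (z1 @\<^sub>v z2)"
      using bilYJ[OF z] by simp
    have "x = (y1 @\<^sub>v y2) + (z1 @\<^sub>v z2)"
    proof -
      have "a @\<^sub>v b = (- u @\<^sub>v w) + ((a + u) @\<^sub>v (- (w - b)))"
        if "u \<in> carrier_vec p" "w \<in> carrier_vec q" for u w
        using ab that by (intro eq_vecI) auto
      from this[OF carr(4)[OF ac bc] carr(3)[OF ac bc]] show ?thesis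
        unfolding xab y1_def y2_def z1_def z2_def Pf[OF ab] Tf[OF ab] .
    qed
    then show "\<exists>y\<in>carrier_vec (p + q). \<exists>z\<in>carrier_vec (p + q). x = y + z \<and>
        bil (Y_mat p q M) y y = 0 \<and> bil (Y_mat p q M) z z = bil (J_mat p q) z z"
      using 1 2 y z by (intro bexI[of _ "y1 @\<^sub>v y2"] bexI[of _ "z1 @\<^sub>v z2"]) auto
  qed
  have PZv: "P *\<^sub>v (Z *\<^sub>v a) = a" if "a \<in> carrier_vec p" for a
    using assoc_mult_mat_vec[OF Pc Zc that] that by (simp only: PZ one_mult_mat_vec)
  have PR: "P *\<^sub>v (R *\<^sub>v b) = M *\<^sub>v b" if "b \<in> carrier_vec q" for b
    using that M Zc PZv[of "M *\<^sub>v b"] by (simp add: R_def assoc_mult_mat_vec[OF Zc M])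
  have Rt: "transpose_mat R = T * Z"
    using transpose_mult[OF Zc M] by (simp add: R_def T_def pos_def_matD(3)[OF Z])
  have QRt: "Q *\<^sub>v (transpose_mat R *\<^sub>v a) = T *\<^sub>v a" if "a \<in> carrier_vec p" for a
    using that Zc TPv[of "Z *\<^sub>v a"] PZv[of a] by (simp add: Rt assoc_mult_mat_vec[OF Tc Zc])
  have RQ: "R *\<^sub>v (Q *\<^sub>v b) = M *\<^sub>v b" if b: "b \<in> carrier_vec q" for b
  proof -
    have "R *\<^sub>v (Q *\<^sub>v b) = Z *\<^sub>v (M *\<^sub>v (Q *\<^sub>v b))"
      using Qc b by (simp add: R_def assoc_mult_mat_vec[OF Zc M])
    also have "\<dots> = Z *\<^sub>v (P *\<^sub>v (M *\<^sub>v b))" by (simp add: PMv[OF b])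
    also have "\<dots> = Z * P *\<^sub>v (M *\<^sub>v b)" using assoc_mult_mat_vec[OF Zc Pc, of "M *\<^sub>v b"] M b by simp
    also have "\<dots> = M *\<^sub>v b" unfolding PZ using M b by (intro one_mult_mat_vec[of _ p]) auto
    finally show ?thesis .
  qed
  {
    fix x :: "real vec" assume x: "x \<in> carrier_vec (p + q)"
    define a where "a = proj_first p x"
    define b where "b = proj_last q x"
    have ab: "a \<in> carrier_vec p" "b \<in> carrier_vec q" and xab: "x = a @\<^sub>v b"
      using append_proj[OF x] by (auto simp: a_def b_def)
    note ac = fc[OF ab] and bc = gc[OF ab]
    have Rb: "R *\<^sub>v b \<in> carrier_vec p" and Ra: "transpose_mat R *\<^sub>v a \<in> carrier_vec q" using Rc ab by auto
    have "Y_mat p q M *\<^sub>v x = 0\<^sub>v (p + q) \<longleftrightarrow> f a b = 0\<^sub>v p"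
      unfolding xab Yv[OF ab] append_vec_eq_0[OF carr(1)[OF ac bc] carr(2)[OF ac bc]]
      using pos_def_inj[OF P ac] Pc Tc by auto
    also have "f a b = P *\<^sub>v (R *\<^sub>v b + a)"
      unfolding mult_add_distrib_mat_vec[OF Pc Rb ab(1)] PR[OF ab(2)] f_def
      using carr[OF ab] by (intro comm_add_vec[of _ p]) auto
    also have "P *\<^sub>v (R *\<^sub>v b + a) = 0\<^sub>v p \<longleftrightarrow> R *\<^sub>v b + a = 0\<^sub>v p"
      using pos_def_inj[OF P, of "R *\<^sub>v b + a"] Rb ab Pc by auto
    finally show "Y_mat p q M *\<^sub>v x = 0\<^sub>v (p + q) \<longleftrightarrow>
        phi_pq p q M *\<^sub>v proj_last q x + proj_first p x = 0\<^sub>v p"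
      by (simp add: phi R_def a_def b_def)
    have "Y_mat p q M *\<^sub>v x = J_mat p q *\<^sub>v x \<longleftrightarrow> Y_mat p q M *\<^sub>v x - J_mat p q *\<^sub>v x = 0\<^sub>v (p + q)"
      using vec_eq_if_diff_0[OF mult_mat_vec_carrier[OF Yc x] mult_mat_vec_carrier[OF J_mat_carrier x]]
        mult_mat_vec_carrier[OF J_mat_carrier x] by auto
    also have "\<dots> \<longleftrightarrow> g a b = 0\<^sub>v q"
      unfolding xab YJ[OF ab] append_vec_eq_0[OF carr(4)[OF ac bc] carr(3)[OF ac bc]]
      using pos_def_inj[OF Q bc] Qc M by auto
    also have "g a b = Q *\<^sub>v (transpose_mat R *\<^sub>v a + b)"
      unfolding mult_add_distrib_mat_vec[OF Qc Ra ab(2)] QRt[OF ab(1)] g_def ..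
    also have "Q *\<^sub>v (transpose_mat R *\<^sub>v a + b) = 0\<^sub>v q \<longleftrightarrow> transpose_mat R *\<^sub>v a + b = 0\<^sub>v q"
      using pos_def_inj[OF Q, of "transpose_mat R *\<^sub>v a + b"] Ra ab Qc by auto
    finally show "Y_mat p q M *\<^sub>v x = J_mat p q *\<^sub>v x \<longleftrightarrow>
        transpose_mat (phi_pq p q M) *\<^sub>v proj_first p x + proj_last q x = 0\<^sub>v q"
      by (simp add: phi R_def a_def b_def)
  }
  \<comment> \<open>Contraction bound: for \<open>y = Q x\<close>, the identities
    \<open>Q\<^sup>2 = 1 + T M\<close> and \<open>R Q = M\<close> give
    \<open>y \<bullet> y = x \<bullet> x + (R y) \<bullet> (R y)\<close>. If
    \<open>y \<bullet> y\<close> is at most \<open>d\<close> times \<open>x \<bullet> x\<close>,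
    then \<open>R y\<close> receives at most the fraction \<open>1 - 1 / d\<close>.\<close>
  obtain c where c: "c \<ge> 0" "\<And>x. x \<in> carrier_vec q \<Longrightarrow> (Q *\<^sub>v x) \<bullet> (Q *\<^sub>v x) \<le> c * (x \<bullet> x)"
    using mult_mat_vec_norm_bound[OF Qc] by blast
  \<comment> \<open>The inverse of \<open>Q\<close> is the square of the inverse of its square
    root.\<close>
  obtain G where G: "G \<in> carrier_mat q q" "Q * G = 1\<^sub>m q"
  proof -
    obtain P' Z' where "pos_def_mat q P'" "pos_def_mat q Z'" "P' * P' = Q" "P' * Z' = 1\<^sub>m q"
      using pos_def_sqrt_exists[OF Q] by blast
    note * = this pos_def_matD(2)[OF this(1)] pos_def_matD(2)[OF this(2)]
    have "Q * (Z' * Z') = P' * (P' * (Z' * Z'))"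
      using assoc_mult_mat[OF *(5,5) mult_carrier_mat[OF *(6,6)]] by (simp only: *(3))
    also have "P' * (Z' * Z') = Z'"
      using assoc_mult_mat[OF *(5,6,6)] left_mult_one_mat[OF *(6)] by (simp only: *(4))
    finally have "Q * (Z' * Z') = 1\<^sub>m q" by (simp only: *(4))
    then show thesis using that[of "Z' * Z'"] mult_carrier_mat[OF *(6,6)] by blast
  qed
  \<comment> \<open>Adding 1 ensures \<open>d \<ge> 1\<close>, so that \<open>1 - 1 / d\<close> is
    at least 0 even if \<open>c\<close> is small.\<close>
  define d where "d = c + 1"
  have d: "d \<ge> 1" using c by (simp add: d_def)
  have "(R *\<^sub>v y) \<bullet> (R *\<^sub>v y) \<le> (1 - 1 / d) * (y \<bullet> y)" if y: "y \<in> carrier_vec q" for y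
  proof -
    define x where "x = G *\<^sub>v y"
    have xc: "x \<in> carrier_vec q" using G y by (simp add: x_def)
    have yx: "y = Q *\<^sub>v x" unfolding x_def using assoc_mult_mat_vec[OF Qc G(1) y] y by (simp only: G(2) one_mult_mat_vec)
    have Mx: "M *\<^sub>v x \<in> carrier_vec p" "T *\<^sub>v (M *\<^sub>v x) \<in> carrier_vec q" "Q *\<^sub>v x \<in> carrier_vec q"
      using M Tc Qc xc by auto
    have "y \<bullet> y = x \<bullet> (Q *\<^sub>v (Q *\<^sub>v x))"
      unfolding yx using scalar_prod_mult_mat_vec[OF Qc xc Mx(3)] by (simp add: pos_def_matD(3)[OF Q])
    also have "\<dots> = x \<bullet> x + x \<bullet> (T *\<^sub>v (M *\<^sub>v x))"
      unfolding QQv[OF xc] using xc Mx by (intro scalar_prod_add_distrib) auto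
    also have "x \<bullet> (T *\<^sub>v (M *\<^sub>v x)) = (M *\<^sub>v x) \<bullet> (M *\<^sub>v x)"
      using scalar_prod_mult_mat_vec[OF Tc xc Mx(1)] by (simp add: T_def)
    finally have yy: "y \<bullet> y = x \<bullet> x + (R *\<^sub>v y) \<bullet> (R *\<^sub>v y)" by (simp add: yx RQ[OF xc])
    have "y \<bullet> y \<le> d * (x \<bullet> x)"
      using c(2)[OF xc] scalar_prod_self_ge_0[of x] by (simp add: yx d_def algebra_simps)
    then have "(y \<bullet> y) / d \<le> x \<bullet> x" using d by (simp add: divide_le_eq mult.commute)
    moreover have "(1 - 1 / d) * (y \<bullet> y) = y \<bullet> y - (y \<bullet> y) / d" by (simp add: left_diff_distrib)
    ultimately show ?thesis using yy by linarith
  qed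
  moreover have "1 - 1 / d \<ge> 0" "1 - 1 / d < 1" using d by auto
  ultimately show "\<exists>r\<ge>0. r < 1 \<and> (\<forall>y\<in>carrier_vec q.
        (phi_pq p q M *\<^sub>v y) \<bullet> (phi_pq p q M *\<^sub>v y) \<le> r * (y \<bullet> y))"
    unfolding phi R_def[symmetric] by blast
qed

section \<open>Every minimal matrix above \<open>J_mat p q\<close> is a candidate\<close>

lemma four_block_mat_eqD:
  assumes A: "A \<in> carrier_mat p p" "B \<in> carrier_mat p q" "C \<in> carrier_mat q p" "D \<in> carrier_mat q q"
    and A': "A' \<in> carrier_mat p p" "B' \<in> carrier_mat p q" "C' \<in> carrier_mat q p" "D' \<in> carrier_mat q q"
    and eq: "four_block_mat A B C D = four_block_mat A' B' C' D'"
  shows "A = A'" "B = B'" "C = C'" "D = D'"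
proof -
  have ix: "four_block_mat A B C D $$ (i,j) = four_block_mat A' B' C' D' $$ (i,j)" for i j
    by (simp only: eq)
  show "A = A'"
  proof (rule eq_matI)
    fix i j assume "i < dim_row A'" "j < dim_col A'"
    then show "A $$ (i,j) = A' $$ (i,j)" using ix[of i j] A A' by simp
  qed (use A A' in auto)
  show "B = B'"
  proof (rule eq_matI)
    fix i j assume "i < dim_row B'" "j < dim_col B'"
    then show "B $$ (i,j) = B' $$ (i,j)" using ix[of i "j + p"] A A' by simp
  qed (use A A' in auto)
  show "C = C'"
  proof (rule eq_matI)
    fix i j assume "i < dim_row C'" "j < dim_col C'"
    then show "C $$ (i,j) = C' $$ (i,j)" using ix[of "i + p" j] A A' by simp
  qed (use A A' in auto)
  show "D = D'"
  proof (rule eq_matI)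
    fix i j assume "i < dim_row D'" "j < dim_col D'"
    then show "D $$ (i,j) = D' $$ (i,j)" using ix[of "i + p" "j + p"] A A' by simp
  qed (use A A' in auto)
qed

text \<open>The upper left block \<open>P\<^sup>2\<close> determines \<open>P\<close>, after which
  the upper right block \<open>P M\<close> determines \<open>M\<close>.\<close>

lemma Y_mat_inj:
  assumes M: "M \<in> carrier_mat p q" "M' \<in> carrier_mat p q" and eq: "Y_mat p q M = Y_mat p q M'"
  shows "M = M'"
proof -
  obtain P Z Q where P: "pos_def_mat p P" "pos_def_mat p Z" "pos_def_mat q Q" "Z * P = 1\<^sub>m p"
    "S_mat p q M = four_block_mat P M (transpose_mat M) Q"
    using S_mat_blocks[OF M(1)] by metis
  obtain P' Q' where P': "pos_def_mat p P'" "pos_def_mat q Q'"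
    "S_mat p q M' = four_block_mat P' M' (transpose_mat M') Q'"
    using S_mat_blocks[OF M(2)] by metis
  note Pc = pos_def_matD(2)[OF P(1)] and Zc = pos_def_matD(2)[OF P(2)] and Qc = pos_def_matD(2)[OF P(3)]
  note Pc' = pos_def_matD(2)[OF P'(1)] and Qc' = pos_def_matD(2)[OF P'(2)]
  have b: "four_block_mat (P * P) (P * M) (transpose_mat M * P) (transpose_mat M * M) =
      four_block_mat (P' * P') (P' * M') (transpose_mat M' * P') (transpose_mat M' * M')"
    using eq unfolding Y_mat_blocks[OF M(1) Pc Qc P(5)] Y_mat_blocks[OF M(2) Pc' Qc' P'(3)] .
  have c: "P * P \<in> carrier_mat p p" "P * M \<in> carrier_mat p q"
      "transpose_mat M * P \<in> carrier_mat q p" "transpose_mat M * M \<in> carrier_mat q q"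
      "P' * P' \<in> carrier_mat p p" "P' * M' \<in> carrier_mat p q"
      "transpose_mat M' * P' \<in> carrier_mat q p" "transpose_mat M' * M' \<in> carrier_mat q q"
    using M Pc Pc' by auto
  have "P * P = P' * P'" "P * M = P' * M'"
    by (rule four_block_mat_eqD(1,2)[OF c b])+
  then have "P * M = P * M'" "P = P'"
    using pos_def_sqrt_unique[OF P'(1) pos_def_matD(1)[OF P(1)] pos_def_mat_psd[OF P(1)]] by auto
  then have "Z * P * M = Z * P * M'" using assoc_mult_mat[OF Zc Pc M(1)] assoc_mult_mat[OF Zc Pc M(2)] by simp
  then show ?thesis using M by (simp add: P(4))
qed

text \<open>If \<open>w\<close> lay in both images, a small multiple of \<open>w w\<^sup>T\<close> could be subtracted from \<open>Y\<close>.\<close>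
lemma minimal_above_images_disjoint:
  assumes N: "N \<in> sym_mats n" and Y: "minimal_above n N Y"
    and a: "a \<in> carrier_vec n" and b: "b \<in> carrier_vec n" and eq: "Y *\<^sub>v a = (Y - N) *\<^sub>v b"
  shows "Y *\<^sub>v a = 0\<^sub>v n"
proof (rule ccontr)
  have Ys: "Y \<in> sym_mats n" and ge: "\<And>x. x \<in> carrier_vec n \<Longrightarrow> 0 \<le> bil Y x x \<and> bil N x x \<le> bil Y x x"
    and min: "\<And>D. D \<in> sym_mats n \<Longrightarrow> (\<forall>x\<in>carrier_vec n. 0 \<le> bil D x x \<and> bil D x x \<le> bil Y x x \<and>
        bil D x x \<le> bil Y x x - bil N x x) \<Longrightarrow> D = 0\<^sub>m n n"
    using Y by (auto simp: minimal_above_def)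
  note Nc = sym_matsD(1)[OF N] and Yc = sym_matsD(1)[OF Ys]
  define w where "w = Y *\<^sub>v a"
  assume "Y *\<^sub>v a \<noteq> 0\<^sub>v n"
  then have w: "w \<in> carrier_vec n" "w \<noteq> 0\<^sub>v n" using Yc a by (auto simp: w_def)
  have YN: "Y - N \<in> sym_mats n" by (rule sym_mats_diff[OF Ys N])
  have geYN: "bil (Y - N) x x \<ge> 0" if "x \<in> carrier_vec n" for x
    using ge[OF that] that by (simp add: bil_diff_mat[OF Yc Nc])
  \<comment> \<open>By Cauchy-Schwarz \<open>(x \<bullet> w)\<^sup>2\<close> is at most
    \<open>bil Y x x * bil Y a a\<close>, and likewise for \<open>Y - N\<close> with
    \<open>b\<close>. Dividing by a \<open>K\<close> above both constants puts \<open>D\<close>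
    below both forms; the summand 1 keeps \<open>K\<close> positive.\<close>
  define K where "K = 1 + bil Y a a + bil (Y - N) b b"
  have K: "K \<ge> 1" "bil Y a a \<le> K" "bil (Y - N) b b \<le> K" using ge[OF a] geYN[OF b] by (auto simp: K_def)
  define D where "D = spectral_mat n {w} (\<lambda>_. 1 / K)"
  have Dx: "bil D x x = (x \<bullet> w)\<^sup>2 / K" if x: "x \<in> carrier_vec n" for x
  proof -
    have "bil D x x = 1 / K * (w \<bullet> x) * (x \<bullet> w)"
      unfolding bil_def D_def using x w
      by (subst spectral_mat_mult_vec, simp, simp, subst scalar_prod_lincomb[OF x]) auto
    then show ?thesis by (simp add: power2_eq_square comm_scalar_prod[OF x w(1)])
  qed
  have bound: "(x \<bullet> w)\<^sup>2 / K \<le> bil X x x"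
    if X: "X \<in> sym_mats n" "\<And>x. x \<in> carrier_vec n \<Longrightarrow> bil X x x \<ge> 0" "c \<in> carrier_vec n"
      "w = X *\<^sub>v c" "bil X c c \<le> K" and x: "x \<in> carrier_vec n" for X c x
  proof -
    have "(x \<bullet> w)\<^sup>2 \<le> bil X x x * bil X c c"
      using psd_cauchy_schwarz[OF X(1,2) x X(3)] by (simp add: bil_def[of X x c] X(4))
    also have "\<dots> \<le> bil X x x * K" using X(2)[OF x] X(5) by (intro mult_left_mono) auto
    finally show ?thesis using K by (simp add: divide_le_eq)
  qed
  have "bil D x x \<le> bil Y x x" "bil D x x \<le> bil (Y - N) x x" "bil D x x \<ge> 0" if x: "x \<in> carrier_vec n" for x
  proof -
    show "bil D x x \<le> bil Y x x"
      unfolding Dx[OF x] using ge K by (intro bound[OF Ys _ a w_def _ x]) auto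
    have "w = (Y - N) *\<^sub>v b" using eq by (simp add: w_def)
    then show "bil D x x \<le> bil (Y - N) x x"
      unfolding Dx[OF x] using geYN K by (intro bound[OF YN _ b _ _ x]) auto
    show "bil D x x \<ge> 0" unfolding Dx[OF x] using K by simp
  qed
  then have "D = 0\<^sub>m n n"
    using spectral_mat_sym by (intro min) (auto simp: D_def bil_diff_mat[OF Yc Nc])
  moreover have "0\<^sub>m n n *\<^sub>v w = 0\<^sub>v n" using w by (intro eq_vecI) auto
  ultimately have "bil D w w = 0" using w by (simp add: bil_def)
  then have "w \<bullet> w = 0" using K by (simp add: Dx[OF w(1)])
  then show False using w scalar_prod_self_eq_0[OF w(1)] by simp
qed

text \<open>For \<open>y = N Y x\<close> one has \<open>N y = Y x\<close>, so
  \<open>Y (y - x) = (Y - N) y\<close> lies in both images and vanishes. In other words,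
  \<open>N * Y\<close> is idempotent.\<close>

lemma minimal_above_idempotent:
  assumes N: "N \<in> sym_mats n" "N * N = 1\<^sub>m n" and Y: "minimal_above n N Y"
  shows "Y * N * Y = Y"
proof (rule mat_eq_mult_vecI)
  have Ys: "Y \<in> sym_mats n" using Y by (simp add: minimal_above_def)
  note Nc = sym_matsD(1)[OF N(1)] and Yc = sym_matsD(1)[OF Ys]
  show "Y * N * Y \<in> carrier_mat n n" "Y \<in> carrier_mat n n" using Yc Nc by auto
  fix x :: "real vec" assume x: "x \<in> carrier_vec n"
  define y where "y = N *\<^sub>v (Y *\<^sub>v x)"
  have yc: "Y *\<^sub>v x \<in> carrier_vec n" "y \<in> carrier_vec n" "y - x \<in> carrier_vec n"
    using Nc Yc x by (auto simp: y_def)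
  have Ny: "N *\<^sub>v y = Y *\<^sub>v x"
    unfolding y_def using assoc_mult_mat_vec[OF Nc Nc yc(1)] yc(1) by (simp add: N(2))
  have "Y *\<^sub>v (y - x) = Y *\<^sub>v y - Y *\<^sub>v x" by (rule mult_minus_distrib_mat_vec[OF Yc yc(2) x])
  also have "\<dots> = (Y - N) *\<^sub>v y" by (simp add: minus_mult_distrib_mat_vec[OF Yc Nc yc(2)] Ny)
  finally have "Y *\<^sub>v (y - x) = 0\<^sub>v n"
    by (rule minimal_above_images_disjoint[OF N(1) Y yc(3,2)])
  then have "Y *\<^sub>v y - Y *\<^sub>v x = 0\<^sub>v n" by (simp only: mult_minus_distrib_mat_vec[OF Yc yc(2) x])
  then have "Y *\<^sub>v y = Y *\<^sub>v x" 
    by (rule vec_eq_if_diff_0[OF mult_mat_vec_carrier[OF Yc yc(2)] mult_mat_vec_carrier[OF Yc x]])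
  moreover have "Y * N * Y *\<^sub>v x = Y *\<^sub>v y"
    unfolding y_def using Yc Nc x by (simp add: assoc_mult_mat_vec[of _ n n _ n])
  ultimately show "Y * N * Y *\<^sub>v x = Y *\<^sub>v x" by simp
qed

lemma bil_blocks:
  assumes "a \<in> carrier_mat p p" "b \<in> carrier_mat p q" "c \<in> carrier_mat q p" "d \<in> carrier_mat q q"
  shows "x \<in> carrier_vec p \<Longrightarrow> bil (four_block_mat a b c d) (x @\<^sub>v 0\<^sub>v q) (x @\<^sub>v 0\<^sub>v q) = bil a x x"
    "y \<in> carrier_vec q \<Longrightarrow> bil (four_block_mat a b c d) (0\<^sub>v p @\<^sub>v y) (0\<^sub>v p @\<^sub>v y) = bil d y y"
proof -
  have z: "A *\<^sub>v 0\<^sub>v k = 0\<^sub>v m" if "A \<in> carrier_mat m k" for A :: "real mat" and m k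
    using that by (intro eq_vecI) auto
  show "bil (four_block_mat a b c d) (x @\<^sub>v 0\<^sub>v q) (x @\<^sub>v 0\<^sub>v q) = bil a x x" if x: "x \<in> carrier_vec p"
  proof -
    have "four_block_mat a b c d *\<^sub>v (x @\<^sub>v 0\<^sub>v q) = (a *\<^sub>v x) @\<^sub>v (c *\<^sub>v x)"
      using assms x z[OF assms(2)] z[OF assms(4)] by (simp add: four_block_mult_append)
    then show ?thesis using assms x by (simp add: bil_def scalar_prod_append[of _ p _ q])
  qed
  show "bil (four_block_mat a b c d) (0\<^sub>v p @\<^sub>v y) (0\<^sub>v p @\<^sub>v y) = bil d y y" if y: "y \<in> carrier_vec q"
  proof -
    have "four_block_mat a b c d *\<^sub>v (0\<^sub>v p @\<^sub>v y) = (b *\<^sub>v y) @\<^sub>v (d *\<^sub>v y)"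
      using assms y z[OF assms(1)] z[OF assms(3)] by (simp add: four_block_mult_append)
    then show ?thesis using assms y by (simp add: bil_def scalar_prod_append[of _ p _ q])
  qed
qed

lemma sym_mats_blocks:
  assumes Y: "Y \<in> sym_mats (p + q)"
  obtains a b d where "a \<in> sym_mats p" "b \<in> carrier_mat p q" "d \<in> sym_mats q"
    "Y = four_block_mat a b (transpose_mat b) d"
proof -
  note Yc = sym_matsD(1)[OF Y]
  obtain a b c d where s: "split_block Y p p = (a, b, c, d)" by (metis prod_cases4)
  from split_block[OF s, of q q] Yc have
    bl: "a \<in> carrier_mat p p" "b \<in> carrier_mat p q" "c \<in> carrier_mat q p" "d \<in> carrier_mat q q"
      "Y = four_block_mat a b c d" by auto
  have eq: "four_block_mat (transpose_mat a) (transpose_mat c) (transpose_mat b) (transpose_mat d) = four_block_mat a b c d"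
    using sym_matsD(2)[OF Y] unfolding bl(5) transpose_four_block_mat[OF bl(1-4)] .
  have c: "transpose_mat a \<in> carrier_mat p p" "transpose_mat c \<in> carrier_mat p q"
    "transpose_mat b \<in> carrier_mat q p" "transpose_mat d \<in> carrier_mat q q"
    using bl(1-4) by auto
  have "transpose_mat a = a" "transpose_mat b = c" "transpose_mat d = d"
    by (rule four_block_mat_eqD(1,3,4)[OF c bl(1-4) eq])+
  then show thesis using that[of a b d] bl by (auto simp: sym_mats_def)
qed

text \<open>Let \<open>a\<close>, \<open>b\<close>, \<open>c\<close>, \<open>d\<close> be the blocks
  of \<open>Y\<close>, with c = b^T. Domination of \<open>J\<close> and of 0 makes
  \<open>a - 1\<close> and \<open>d\<close> semidefinite, and \<open>Y J Y = Y\<close> reads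
  \<open>a\<^sup>2 = a + b c\<close>, \<open>a b = b + b d\<close>,
  \<open>c b = d + d\<^sup>2\<close>. Comparison with a candidate forces
  \<open>P\<^sup>2 = a\<close> and \<open>P M = b\<close>; what remains is that this
  \<open>M\<close> satisfies 1 + M M^T = P^2 and M^T M = d.\<close>

lemma minimal_above_J_imp_Y_mat:
  assumes Y: "minimal_above (p + q) (J_mat p q) Y"
  shows "\<exists>M\<in>carrier_mat p q. Y = Y_mat p q M"
proof -
  have Ys: "Y \<in> sym_mats (p + q)" and
    ge: "\<And>x. x \<in> carrier_vec (p + q) \<Longrightarrow> 0 \<le> bil Y x x \<and> bil (J_mat p q) x x \<le> bil Y x x"
    using Y by (auto simp: minimal_above_def)
  obtain a b d where bl: "a \<in> sym_mats p" "b \<in> carrier_mat p q" "d \<in> sym_mats q"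
    "Y = four_block_mat a b (transpose_mat b) d"
    using sym_mats_blocks[OF Ys] .
  define c where "c = transpose_mat b"
  note ac = sym_matsD(1)[OF bl(1)] and bc = bl(2) and dc = sym_matsD(1)[OF bl(3)]
  have cc: "c \<in> carrier_mat q p" using bc by (simp add: c_def)
  note Yeq = bl(4)[folded c_def]
  have Yc: "Y \<in> carrier_mat (p + q) (p + q)" using sym_matsD(1)[OF Ys] .
  have a_ge: "x \<bullet> x \<le> bil a x x" if x: "x \<in> carrier_vec p" for x
    using ge[of "x @\<^sub>v 0\<^sub>v q"] x
    by (simp add: Yeq bil_blocks[OF ac bc cc dc] bil_J_mat proj_append[OF x zero_carrier_vec])
  have d_ge: "0 \<le> bil d y y" if y: "y \<in> carrier_vec q" for y
    using ge[of "0\<^sub>v p @\<^sub>v y"] y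
    by (simp add: Yeq bil_blocks[OF ac bc cc dc])
  have a_pd: "pos_def_mat p a"
    using bl(1) a_ge scalar_prod_self_pos[of _ p] by (force simp: pos_def_mat_def)
  have d1_pd: "pos_def_mat q (1\<^sub>m q + d)"
    unfolding pos_def_mat_def
  proof (intro conjI ballI impI)
    show "1\<^sub>m q + d \<in> sym_mats q"
      using dc sym_matsD(2)[OF bl(3)] by (auto simp: sym_mats_def transpose_add[of _ q q])
    fix y :: "real vec" assume y: "y \<in> carrier_vec q" "y \<noteq> 0\<^sub>v q"
    have "bil (1\<^sub>m q + d) y y = y \<bullet> y + bil d y y"
      using y dc by (simp add: bil_def add_mult_distrib_mat_vec[of _ q q] scalar_prod_add_distrib[of _ q])
    then show "bil (1\<^sub>m q + d) y y > 0" using scalar_prod_self_pos[OF y] d_ge[OF y(1)] by linarith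
  qed
  obtain P Z where P: "pos_def_mat p P" "pos_def_mat p Z" "P * P = a" "P * Z = 1\<^sub>m p" "Z * P = 1\<^sub>m p"
    using pos_def_sqrt_exists[OF a_pd] by blast
  note Pc = pos_def_matD(2)[OF P(1)] and Zc = pos_def_matD(2)[OF P(2)]
  have car: "a * a \<in> carrier_mat p p" "b * c \<in> carrier_mat p p" "a * b \<in> carrier_mat p q" "b * d \<in> carrier_mat p q"
    "c * b \<in> carrier_mat q q" "d * d \<in> carrier_mat q q" "c * a \<in> carrier_mat q p" "d * c \<in> carrier_mat q p"
    using ac bc cc dc by auto
  have neg: "X * (- 1\<^sub>m q) = - X" if "X \<in> carrier_mat k q" for X :: "real mat" and k
    using that by (simp add: uminus_mult_right_mat)
  have "Y * J_mat p q = four_block_mat a (- b) c (- d)"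
    unfolding Yeq J_mat_def using ac bc cc dc
    by (subst mult_four_block_mat[of _ p p _ q _ q _ _ p _ q]) (auto simp: neg)
  then have "four_block_mat a (- b) c (- d) * four_block_mat a b c d = Y"
    using minimal_above_idempotent[OF J_mat_sym J_mat_squared Y] by (simp add: Yeq)
  then have eq4: "four_block_mat (a * a + (- b) * c) (a * b + (- b) * d) (c * a + (- d) * c) (c * b + (- d) * d) =
      four_block_mat a b c d"
    using ac bc cc dc by (subst (asm) mult_four_block_mat[of _ p p _ q _ q _ _ p _ q]) (auto simp: Yeq)
  have c4: "a * a + (- b) * c \<in> carrier_mat p p" "a * b + (- b) * d \<in> carrier_mat p q"
      "c * a + (- d) * c \<in> carrier_mat q p" "c * b + (- d) * d \<in> carrier_mat q q"
    using ac bc cc dc by auto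
  have "a * a + (- b) * c = a" "a * b + (- b) * d = b" "c * b + (- d) * d = d"
    by (rule four_block_mat_eqD(1,2,4)[OF c4 ac bc cc dc eq4])+
  then have e: "a * a - b * c = a" "a * b - b * d = b" "c * b - d * d = d"
    using ac bc cc dc car
    by (simp_all add: uminus_mult_left_mat add_uminus_minus_mat[of _ p p] add_uminus_minus_mat[of _ p q] add_uminus_minus_mat[of _ q q])
  have move: "X = W + V" if "X - V = W" "X \<in> carrier_mat k l" "V \<in> carrier_mat k l" for X V W :: "real mat" and k l
    using that by (auto intro!: eq_matI)
  have e1: "a * a = a + b * c" using move[OF e(1) car(1,2)] .
  have e2: "a * b = b + b * d" using move[OF e(2) car(3,4)] .
  have e3: "c * b = d + d * d" using move[OF e(3) car(5,6)] .
  define M where "M = Z * b"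
  have Mc: "M \<in> carrier_mat p q" using Zc bc by (simp add: M_def)
  have Mt: "transpose_mat M = c * Z"
    using transpose_mult[OF Zc bc] by (simp add: M_def c_def pos_def_matD(3)[OF P(2)])
  have Zaa: "Z * (a * X) = P * X" if X: "X \<in> carrier_mat p k" for X k
  proof -
    have "Z * (a * X) = Z * (P * (P * X))" using assoc_mult_mat[OF Pc Pc X] by (simp add: P(3))
    also have "\<dots> = Z * P * (P * X)" using assoc_mult_mat[OF Zc Pc mult_carrier_mat[OF Pc X]] by simp
    also have "\<dots> = P * X" unfolding P(5) by (rule left_mult_one_mat[OF mult_carrier_mat[OF Pc X]])
    finally show ?thesis .
  qed
  have ZP: "Z * (P * X) = X" and PZ: "P * (Z * X) = X" if X: "X \<in> carrier_mat p k" for X k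
    using assoc_mult_mat[OF Zc Pc X] assoc_mult_mat[OF Pc Zc X] P(4,5) X by auto
  \<comment> \<open>Since \<open>b c = a\<^sup>2 - a\<close> and \<open>Z\<close> inverts
    \<open>P\<close>, M M^T = Z (a^2 - a) Z = P^2 - 1.\<close>
  have MMt: "1\<^sub>m p + M * transpose_mat M = P * P"
  proof -
    have "Z * (a + b * c) * Z = Z * (a * a) * Z" by (simp only: e1)
    also have "\<dots> = P * a * Z" by (simp only: Zaa[OF ac])
    also have "\<dots> = P * (a * Z)" by (rule assoc_mult_mat[OF Pc ac Zc])
    also have "a * Z = P" using assoc_mult_mat[OF Pc Pc Zc] P(4) right_mult_one_mat[OF Pc] by (simp add: P(3))
    finally have 1: "Z * (a + b * c) * Z = P * P" .
    have "Z * (a + b * c) * Z = Z * a * Z + Z * (b * c) * Z"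
      using Zc ac car by (simp add: mult_add_distrib_mat[OF Zc ac car(2)] add_mult_distrib_mat[of _ p p])
    moreover have "Z * a * Z = 1\<^sub>m p"
    proof -
      have "Z * a = P" using Zaa[of "1\<^sub>m p" p] ac Pc by simp
      then show ?thesis by (simp add: P(4))
    qed
    moreover have "Z * (b * c) * Z = M * (c * Z)"
      unfolding M_def
      by (simp only: assoc_mult_mat[OF Zc bc cc, symmetric] assoc_mult_mat[OF mult_carrier_mat[OF Zc bc] cc Zc])
    ultimately show ?thesis using 1 by (simp add: Mt)
  qed
  have PM: "P * M = b" unfolding M_def by (rule PZ[OF bc])
  have MtP: "transpose_mat M * P = c"
    unfolding Mt using assoc_mult_mat[OF cc Zc Pc] P(5) cc by simp
  \<comment> \<open>Right multiplication by \<open>1 + d\<close> turns both M^T M and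
    \<open>d\<close> into \<open>c b\<close>. This positive definite factor is cancelled by
    \<open>sylvester_unique\<close> with left coefficient 0.\<close>
  have MtM: "transpose_mat M * M = d"
  proof -
    define G where "G = transpose_mat M * M"
    have Gc: "G \<in> carrier_mat q q" using Mc by (simp add: G_def)
    have "M * (1\<^sub>m q + d) = Z * (b * (1\<^sub>m q + d))"
      unfolding M_def using assoc_mult_mat[OF Zc bc, of "1\<^sub>m q + d" q] dc by simp
    also have "b * (1\<^sub>m q + d) = a * b"
      unfolding e2 using mult_add_distrib_mat[OF bc one_carrier_mat dc] bc by simp
    also have "Z * (a * b) = P * b" by (rule Zaa[OF bc])
    finally have "G * (1\<^sub>m q + d) = transpose_mat M * (P * b)"
      unfolding G_def using assoc_mult_mat[of "transpose_mat M" q p M q "1\<^sub>m q + d" q] Mc dc by simp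
    also have "\<dots> = transpose_mat M * P * b"
      using assoc_mult_mat[of "transpose_mat M" q p P p b q] Mc Pc bc by simp
    also have "\<dots> = d * (1\<^sub>m q + d)"
      unfolding MtP e3 using mult_add_distrib_mat[OF dc one_carrier_mat dc] dc by simp
    finally have "G * (1\<^sub>m q + d) - d * (1\<^sub>m q + d) = 0\<^sub>m q q" using dc by simp
    then have eq0: "0\<^sub>m q q * (G - d) + (G - d) * (1\<^sub>m q + d) = 0\<^sub>m q q"
      using Gc dc by (simp add: minus_mult_distrib_mat[OF Gc dc, of "1\<^sub>m q + d" q])
    have psd0: "psd (0\<^sub>m q q)"
      unfolding psd_def qform_def
    proof
      fix y :: "real vec" assume "y \<in> carrier_vec (dim_row (0\<^sub>m q q :: real mat))"
      then have "0\<^sub>m q q *\<^sub>v y = 0\<^sub>v q" "y \<in> carrier_vec q" by (auto intro!: eq_vecI)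
      then show "0 \<le> y \<bullet> (0\<^sub>m q q *\<^sub>v y)" by simp
    qed
    have "G - d = 0\<^sub>m q q"
      by (rule sylvester_unique[OF zero_carrier_mat psd0 d1_pd minus_carrier_mat[OF dc] eq0])
    then show ?thesis using mat_eq_if_diff_0[OF Gc dc] by (simp add: G_def)
  qed
  obtain P' Z' Q' where Q': "pos_def_mat p P'" "pos_def_mat q Q'" "P' * P' = 1\<^sub>m p + M * transpose_mat M"
    "S_mat p q M = four_block_mat P' M (transpose_mat M) Q'"
    using S_mat_blocks[OF Mc] by metis
  have "P' = P"
    using pos_def_sqrt_unique[OF P(1) pos_def_matD(1)[OF Q'(1)] pos_def_mat_psd[OF Q'(1)]] Q'(3) MMt by simp
  then have "Y_mat p q M = Y"
    unfolding Y_mat_blocks[OF Mc pos_def_matD(2)[OF Q'(1)] pos_def_matD(2)[OF Q'(2)] Q'(4)]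
    by (simp add: P(3) PM MtP MtM Yeq)
  then show ?thesis using Mc by auto
qed

section \<open>The unit ball\<close>

lemma mat_add_diff_cancel:
  fixes A B :: "real mat"
  assumes "A \<in> carrier_mat m n" "B \<in> carrier_mat m n"
  shows "A - B + B = A" "A + B - B = A"
  using assms by (auto intro!: eq_matI)

text \<open>The supremum becomes a uniform bound on squared lengths, with \<open>r\<close> the
  square of the spectral norm; strictness survives as the gap between \<open>r\<close> and 1. The
  element 0 inserted in \<open>spec_norm\<close> keeps the set nonempty when \<open>q = 0\<close>
  and makes the norm nonnegative.\<close>

lemma spec_norm_less_1_iff:
  assumes R: "R \<in> carrier_mat p q"
  shows "spec_norm R < 1 \<longleftrightarrow>
    (\<exists>r\<ge>0. r < 1 \<and> (\<forall>y\<in>carrier_vec q. (R *\<^sub>v y) \<bullet> (R *\<^sub>v y) \<le> r * (y \<bullet> y)))"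
proof
  define X where "X = insert 0 {vnorm (R *\<^sub>v x) | x. x \<in> carrier_vec q \<and> vnorm x = 1}"
  have sX: "spec_norm R = Sup X" using R by (simp add: spec_norm_def X_def)
  have bd: "z \<le> sqrt r" if "z \<in> X" "r \<ge> 0" "\<forall>y\<in>carrier_vec q. (R *\<^sub>v y) \<bullet> (R *\<^sub>v y) \<le> r * (y \<bullet> y)" for z r
  proof -
    consider "z = 0" | x where "x \<in> carrier_vec q" "vnorm x = 1" "z = vnorm (R *\<^sub>v x)"
      using \<open>z \<in> X\<close> by (auto simp: X_def)
    then show ?thesis
    proof cases
      case 2
      then have "x \<bullet> x = 1" by (simp add: vnorm_def)
      then have "(R *\<^sub>v x) \<bullet> (R *\<^sub>v x) \<le> r" using 2(1) that(3) by force
      then show ?thesis using 2(3) by (simp add: vnorm_def)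
    qed (use that in simp)
  qed
  {
    assume "\<exists>r\<ge>0. r < 1 \<and> (\<forall>y\<in>carrier_vec q. (R *\<^sub>v y) \<bullet> (R *\<^sub>v y) \<le> r * (y \<bullet> y))"
    then obtain r where r: "r \<ge> 0" "r < 1" "\<forall>y\<in>carrier_vec q. (R *\<^sub>v y) \<bullet> (R *\<^sub>v y) \<le> r * (y \<bullet> y)"
      by blast
    have "Sup X \<le> sqrt r" using bd[OF _ r(1,3)] by (intro cSup_least) (auto simp: X_def)
    also have "sqrt r < 1" using r by simp
    finally show "spec_norm R < 1" by (simp add: sX)
  }
  assume lt: "spec_norm R < 1"
  obtain c where c: "c \<ge> 0" "\<forall>y\<in>carrier_vec q. (R *\<^sub>v y) \<bullet> (R *\<^sub>v y) \<le> c * (y \<bullet> y)"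
    using mult_mat_vec_norm_bound[OF R] by blast
  have bdd: "bdd_above X" using bd[OF _ c] by (intro bdd_aboveI)
  define s where "s = spec_norm R"
  have le: "z \<le> s" if "z \<in> X" for z unfolding s_def sX by (rule cSup_upper[OF that bdd])
  have s: "s \<ge> 0" "s < 1" using le[of 0] lt by (auto simp: X_def s_def)
  have "(R *\<^sub>v y) \<bullet> (R *\<^sub>v y) \<le> s\<^sup>2 * (y \<bullet> y)" if y: "y \<in> carrier_vec q" for y
  proof (cases "y = 0\<^sub>v q")
    case True
    have "R *\<^sub>v 0\<^sub>v q = 0\<^sub>v p" using R by (intro eq_vecI) auto
    then show ?thesis using True by simp
  next
    case False
    have yy: "y \<bullet> y > 0" using scalar_prod_self_pos[OF y False] .
    define k where "k = 1 / sqrt (y \<bullet> y)"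
    have k2: "k * k = 1 / (y \<bullet> y)" using yy by (simp add: k_def)
    define x where "x = k \<cdot>\<^sub>v y"
    have xc: "x \<in> carrier_vec q" using y by (simp add: x_def)
    have "x \<bullet> x = k * k * (y \<bullet> y)" using y by (simp add: x_def)
    then have "vnorm x = 1" using yy by (simp add: vnorm_def k2)
    then have "vnorm (R *\<^sub>v x) \<le> s" using xc by (intro le) (auto simp: X_def)
    then have "(vnorm (R *\<^sub>v x))\<^sup>2 \<le> s\<^sup>2"
      by (intro power_mono) (auto simp: vnorm_def scalar_prod_self_ge_0)
    then have 1: "(R *\<^sub>v x) \<bullet> (R *\<^sub>v x) \<le> s\<^sup>2" by (simp add: vnorm_def scalar_prod_self_ge_0)
    have "(R *\<^sub>v x) \<bullet> (R *\<^sub>v x) = k * k * ((R *\<^sub>v y) \<bullet> (R *\<^sub>v y))"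
      using R y by (simp add: x_def mult_mat_vec)
    then have "(R *\<^sub>v y) \<bullet> (R *\<^sub>v y) / (y \<bullet> y) \<le> s\<^sup>2" using 1 by (simp add: k2)
    then show ?thesis using yy by (simp add: divide_le_eq)
  qed
  moreover have "s\<^sup>2 < 1" using s by (simp add: power_less_one_iff abs_square_less_1)
  ultimately show "\<exists>r\<ge>0. r < 1 \<and> (\<forall>y\<in>carrier_vec q. (R *\<^sub>v y) \<bullet> (R *\<^sub>v y) \<le> r * (y \<bullet> y))"
    by (intro exI[of _ "s\<^sup>2"]) auto
qed

lemma unit_ball_mats_iff:
  "R \<in> unit_ball_mats p q \<longleftrightarrow> R \<in> carrier_mat p q \<and>
    (\<exists>r\<ge>0. r < 1 \<and> (\<forall>y\<in>carrier_vec q. (R *\<^sub>v y) \<bullet> (R *\<^sub>v y) \<le> r * (y \<bullet> y)))"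
  using spec_norm_less_1_iff by (auto simp: unit_ball_mats_def)

lemma phi_pq_in_unit_ball: "M \<in> carrier_mat p q \<Longrightarrow> phi_pq p q M \<in> unit_ball_mats p q"
  using phi_pq_contraction phi_pq_carrier by (simp add: unit_ball_mats_iff)

text \<open>Explicit preimage: M = R L^(-1) with L^2 = 1 - R^T R, which is definite because
  \<open>R\<close> is a strict contraction. Then 1 + M^T M = L^(-2), so Q = L^(-1), and
  \<open>P M = M Q\<close> gives phi(M) = P^(-1) M = M Q^(-1) = M L = R.\<close>

lemma phi_pq_surj:
  assumes "R \<in> unit_ball_mats p q"
  shows "\<exists>M\<in>carrier_mat p q. phi_pq p q M = R"
proof -
  obtain r where R: "R \<in> carrier_mat p q" and r: "r < 1"
    and le: "\<And>y. y \<in> carrier_vec q \<Longrightarrow> (R *\<^sub>v y) \<bullet> (R *\<^sub>v y) \<le> r * (y \<bullet> y)"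
    using assms by (auto simp: unit_ball_mats_iff)
  define T where "T = transpose_mat R"
  have Tc: "T \<in> carrier_mat q p" using R by (simp add: T_def)
  have TR: "T * R \<in> carrier_mat q q" using R Tc by auto
  have tTR: "transpose_mat (T * R) = T * R" using transpose_mult[OF Tc R] by (simp add: T_def)
  have "pos_def_mat q (1\<^sub>m q - T * R)"
    unfolding pos_def_mat_def
  proof (intro conjI ballI impI)
    show "1\<^sub>m q - T * R \<in> sym_mats q"
      using TR tTR by (intro sym_mats_diff one_sym_mats) (simp add: sym_mats_def)
    fix y :: "real vec" assume y: "y \<in> carrier_vec q" "y \<noteq> 0\<^sub>v q"
    have Ry: "R *\<^sub>v y \<in> carrier_vec p" using R y by auto
    have "bil (T * R) y y = y \<bullet> (T *\<^sub>v (R *\<^sub>v y))" using assoc_mult_mat_vec[OF Tc R y(1)] by (simp add: bil_def)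
    also have "\<dots> = (R *\<^sub>v y) \<bullet> (R *\<^sub>v y)" using scalar_prod_mult_mat_vec[OF Tc y(1) Ry] by (simp add: T_def)
    also have "\<dots> \<le> r * (y \<bullet> y)" by (rule le[OF y(1)])
    also have "\<dots> < y \<bullet> y" using scalar_prod_self_pos[OF y] r by simp
    finally show "bil (1\<^sub>m q - T * R) y y > 0"
      using y by (simp add: bil_diff_mat[OF one_carrier_mat TR] bil_one)
  qed
  then obtain L G where L: "pos_def_mat q L" "pos_def_mat q G" "L * L = 1\<^sub>m q - T * R" "L * G = 1\<^sub>m q" "G * L = 1\<^sub>m q"
    using pos_def_sqrt_exists by blast
  note Lc = pos_def_matD(2)[OF L(1)] and Gc = pos_def_matD(2)[OF L(2)]
  define M where "M = R * G"
  have M: "M \<in> carrier_mat p q" using R Gc by (simp add: M_def)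
  have Mt: "transpose_mat M = G * T"
    using transpose_mult[OF R Gc] by (simp add: M_def T_def pos_def_matD(3)[OF L(2)])
  have LLTR: "L * L + T * R = 1\<^sub>m q" unfolding L(3) by (rule mat_add_diff_cancel(1)[OF one_carrier_mat TR])
  have "1\<^sub>m q + transpose_mat M * M = G * G"
  proof -
    have "G * (L * L + T * R) * G = (G * (L * L) + G * (T * R)) * G"
      using mult_add_distrib_mat[OF Gc mult_carrier_mat[OF Lc Lc] TR] by simp
    also have "\<dots> = G * (L * L) * G + G * (T * R) * G"
      using Gc Lc TR by (intro add_mult_distrib_mat) auto
    also have "G * (L * L) * G = 1\<^sub>m q"
      by (simp only: assoc_mult_mat[OF Gc Lc Lc, symmetric] L(4,5) left_mult_one_mat[OF Lc])
    also have "G * (T * R) * G = transpose_mat M * M"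
      unfolding Mt unfolding M_def
      by (simp only: assoc_mult_mat[OF Gc Tc R, symmetric] assoc_mult_mat[OF mult_carrier_mat[OF Gc Tc] R Gc])
    finally show ?thesis using Gc by (simp add: LLTR)
  qed
  then have GG: "G * G = 1\<^sub>m q + transpose_mat M * M" by simp
  obtain P Z Q where Q: "pos_def_mat p P" "pos_def_mat p Z" "pos_def_mat q Q" "Z * P = 1\<^sub>m p"
    "Q * Q = 1\<^sub>m q + transpose_mat M * M" "P * M = M * Q" "phi_pq p q M = Z * M"
    using S_mat_blocks[OF M] by metis
  note Pc = pos_def_matD(2)[OF Q(1)] and Zc = pos_def_matD(2)[OF Q(2)]
  have "Q = G"
    using pos_def_sqrt_unique[OF L(2) pos_def_matD(1)[OF Q(3)] pos_def_mat_psd[OF Q(3)]] Q(5) GG by simp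
  have MLR: "M * L = R"
    unfolding M_def using assoc_mult_mat[OF R Gc Lc] right_mult_one_mat[OF R] by (simp only: L(5))
  have "M * G * L = M"
    using assoc_mult_mat[OF M Gc Lc] right_mult_one_mat[OF M] by (simp only: L(5))
  have "M = Z * P * M" unfolding Q(4) using M by simp
  also have "\<dots> = Z * (M * G)" using assoc_mult_mat[OF Zc Pc M] by (simp only: Q(6) \<open>Q = G\<close>)
  finally have "M * L = Z * (M * G) * L" by (rule arg_cong)
  also have "\<dots> = Z * (M * G * L)" by (rule assoc_mult_mat[OF Zc mult_carrier_mat[OF M Gc] Lc])
  also have "\<dots> = Z * M" by (simp only: \<open>M * G * L = M\<close>)
  finally have "phi_pq p q M = R" by (simp add: Q(7) MLR)
  then show ?thesis using M by blast
qed

text \<open>The image determines \<open>P\<close>: multiplying P^2 = 1 + M M^T on both sides by its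
  inverse \<open>Z\<close> gives Z^2 = 1 - phi(M) phi(M)^T. Then M = P phi(M) is determined as
  well.\<close>

lemma phi_pq_inj:
  assumes M: "M \<in> carrier_mat p q" "M' \<in> carrier_mat p q" and eq: "phi_pq p q M = phi_pq p q M'"
  shows "M = M'"
proof -
  have *: "\<exists>P Z. pos_def_mat p P \<and> pos_def_mat p Z \<and> P * Z = 1\<^sub>m p \<and> M = P * phi_pq p q M \<and>
      Z * Z = 1\<^sub>m p - phi_pq p q M * transpose_mat (phi_pq p q M) \<and> Z * P = 1\<^sub>m p"
    if M: "M \<in> carrier_mat p q" for M
  proof -
    obtain P Z where P: "pos_def_mat p P" "pos_def_mat p Z" "P * Z = 1\<^sub>m p" "Z * P = 1\<^sub>m p"
      "P * P = 1\<^sub>m p + M * transpose_mat M" "phi_pq p q M = Z * M"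
      using S_mat_blocks[OF M] by metis
    note Pc = pos_def_matD(2)[OF P(1)] and Zc = pos_def_matD(2)[OF P(2)]
    define T where "T = transpose_mat M"
    have Tc: "T \<in> carrier_mat q p" using M by (simp add: T_def)
    have MT: "M * T \<in> carrier_mat p p" using M Tc by auto
    have "Z * M * transpose_mat (Z * M) = Z * M * (T * Z)"
      using transpose_mult[OF Zc M] by (simp add: T_def pos_def_matD(3)[OF P(2)])
    also have "\<dots> = Z * (M * T) * Z"
      by (simp only: assoc_mult_mat[OF Zc M Tc, symmetric] assoc_mult_mat[OF mult_carrier_mat[OF Zc M] Tc Zc])
    finally have 1: "Z * M * transpose_mat (Z * M) = Z * (M * T) * Z" .
    have "Z * (P * P) * Z = Z * (1\<^sub>m p + M * T) * Z" by (simp only: P(5) T_def)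
    also have "\<dots> = Z * Z + Z * (M * T) * Z"
      using Zc MT by (simp add: mult_add_distrib_mat[OF Zc one_carrier_mat MT] add_mult_distrib_mat[of _ p p _ _ p])
    also have "Z * (P * P) * Z = 1\<^sub>m p"
      by (simp only: assoc_mult_mat[OF Zc Pc Pc, symmetric] P(3,4) left_mult_one_mat[OF Pc])
    finally have 2: "1\<^sub>m p = Z * Z + Z * (M * T) * Z" .
    have "Z * Z = 1\<^sub>m p - Z * (M * T) * Z"
      unfolding 2 using mult_carrier_mat[OF mult_carrier_mat[OF Zc MT] Zc] mult_carrier_mat[OF Zc Zc]
      by (intro mat_add_diff_cancel(2)[symmetric])
    moreover have "P * (Z * M) = M"
      using assoc_mult_mat[OF Pc Zc M] left_mult_one_mat[OF M] by (simp only: P(3))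
    ultimately show ?thesis using P 1 by (intro exI[of _ P] exI[of _ Z]) simp
  qed
  obtain P Z where P: "pos_def_mat p P" "pos_def_mat p Z" "P * Z = 1\<^sub>m p" "M = P * phi_pq p q M"
      "Z * Z = 1\<^sub>m p - phi_pq p q M * transpose_mat (phi_pq p q M)" "Z * P = 1\<^sub>m p"
    using *[OF M(1)] by blast
  obtain P' Z' where P': "pos_def_mat p P'" "pos_def_mat p Z'" "P' * Z' = 1\<^sub>m p" "M' = P' * phi_pq p q M'"
      "Z' * Z' = 1\<^sub>m p - phi_pq p q M' * transpose_mat (phi_pq p q M')"
    using *[OF M(2)] by blast
  note Pc = pos_def_matD(2)[OF P(1)] and Zc = pos_def_matD(2)[OF P(2)] and Pc' = pos_def_matD(2)[OF P'(1)]
  have "Z * Z = Z' * Z'" unfolding P(5) P'(5) eq ..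
  then have Z: "Z = Z'"
    by (rule pos_def_sqrt_unique[OF P'(2) pos_def_matD(1)[OF P(2)] pos_def_mat_psd[OF P(2)]])
  have "P' * (Z * P) = P' * Z * P" by (rule assoc_mult_mat[OF Pc' Zc Pc, symmetric])
  then have "P' = P" using P'(3) P(6) Pc Pc' by (simp add: Z)
  then show ?thesis using P(4) P'(4) eq by simp
qed

text \<open>Openness is stated along a single direction, the form in which it later yields a second
  point of the ball inside \<open>W\<close>.\<close>

lemma unit_ball_mats_open_direction:
  assumes R: "R \<in> unit_ball_mats p q" and D: "D \<in> carrier_mat p q"
  shows "\<exists>e>0. R + e \<cdot>\<^sub>m D \<in> unit_ball_mats p q"
proof -
  obtain r where Rc: "R \<in> carrier_mat p q" and r: "r \<ge> 0" "r < 1"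
    and le: "\<And>y. y \<in> carrier_vec q \<Longrightarrow> (R *\<^sub>v y) \<bullet> (R *\<^sub>v y) \<le> r * (y \<bullet> y)"
    using R by (auto simp: unit_ball_mats_iff)
  obtain c where c: "c \<ge> 0" "\<And>y. y \<in> carrier_vec q \<Longrightarrow> (D *\<^sub>v y) \<bullet> (D *\<^sub>v y) \<le> c * (y \<bullet> y)"
    using mult_mat_vec_norm_bound[OF D] by blast
  \<comment> \<open>\<open>t\<close> divides up the slack: \<open>(1 + t) * r \<le> r + t\<close>,
    and \<open>e\<close> is chosen so that the contribution of \<open>D\<close> is at most
    \<open>t / 2\<close>; since \<open>2 * t = 1 - r\<close>, the total stays below 1. The summand 1
    in \<open>K\<close> keeps the later division legitimate.\<close>
  define t where "t = (1 - r) / 2"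
  have t: "t > 0" "t \<le> 1" using r by (auto simp: t_def)
  define K where "K = (1 + 1 / t) * c + 1"
  have K: "K > 0" using t c by (simp add: K_def add_nonneg_pos)
  define e where "e = sqrt (t / 2 / K)"
  have e: "e > 0" "e\<^sup>2 = t / 2 / K" using t K by (auto simp: e_def)
  define r' where "r' = (1 + t) * r + t / 2"
  have "(1 + t) * r \<le> r + t" using r t by (simp add: algebra_simps mult_left_le)
  moreover have "(1 + t) * r \<ge> 0" using r t by simp
  moreover have "2 * t = 1 - r" by (simp add: t_def)
  ultimately have r': "r' \<ge> 0" "r' < 1" using r t unfolding r'_def by linarith+
  have "((R + e \<cdot>\<^sub>m D) *\<^sub>v y) \<bullet> ((R + e \<cdot>\<^sub>m D) *\<^sub>v y) \<le> r' * (y \<bullet> y)" if y: "y \<in> carrier_vec q" for y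
  proof -
    define a where "a = R *\<^sub>v y"
    define b where "b = D *\<^sub>v y"
    have ab: "a \<in> carrier_vec p" "b \<in> carrier_vec p" using Rc D y by (auto simp: a_def b_def)
    have "(R + e \<cdot>\<^sub>m D) *\<^sub>v y = a + e \<cdot>\<^sub>v b"
    proof -
      have "(e \<cdot>\<^sub>m D) *\<^sub>v y = e \<cdot>\<^sub>v b"
        using D y by (intro eq_vecI) (auto simp: b_def)
      then show ?thesis using Rc D y by (simp add: a_def add_mult_distrib_mat_vec[of _ p q])
    qed
    then have "((R + e \<cdot>\<^sub>m D) *\<^sub>v y) \<bullet> ((R + e \<cdot>\<^sub>m D) *\<^sub>v y) = a \<bullet> a + 2 * (e * (a \<bullet> b)) + e\<^sup>2 * (b \<bullet> b)"
      using ab comm_scalar_prod[OF ab]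
      by (simp add: scalar_prod_add_distrib[of _ p] add_scalar_prod_distrib[of _ p] power2_eq_square algebra_simps)
    \<comment> \<open>Young's inequality, obtained from the squared length of
      \<open>t a - e b\<close>.\<close>
    also have "2 * (e * (a \<bullet> b)) \<le> t * (a \<bullet> a) + e\<^sup>2 / t * (b \<bullet> b)"
    proof -
      have "0 \<le> (t \<cdot>\<^sub>v a - e \<cdot>\<^sub>v b) \<bullet> (t \<cdot>\<^sub>v a - e \<cdot>\<^sub>v b)" by (rule scalar_prod_self_ge_0)
      also have "\<dots> = t * (t * (a \<bullet> a) + e\<^sup>2 / t * (b \<bullet> b) - 2 * (e * (a \<bullet> b)))"
        using ab comm_scalar_prod[OF ab] t
        by (simp add: scalar_prod_minus_distrib[of _ p] minus_scalar_prod_distrib[of _ p] power2_eq_square algebra_simps)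
      finally show ?thesis using t by (simp add: zero_le_mult_iff)
    qed
    finally have "((R + e \<cdot>\<^sub>m D) *\<^sub>v y) \<bullet> ((R + e \<cdot>\<^sub>m D) *\<^sub>v y) \<le> (1 + t) * (a \<bullet> a) + e\<^sup>2 * ((1 + 1 / t) * (b \<bullet> b))"
      by (simp add: algebra_simps)
    also have "\<dots> \<le> (1 + t) * (r * (y \<bullet> y)) + e\<^sup>2 * ((1 + 1 / t) * (c * (y \<bullet> y)))"
      using le[OF y] c(2)[OF y] t by (intro add_mono mult_left_mono) (auto simp: a_def b_def)
    also have "\<dots> \<le> (1 + t) * (r * (y \<bullet> y)) + e\<^sup>2 * (K * (y \<bullet> y))"
      using scalar_prod_self_ge_0[of y] by (intro add_left_mono mult_left_mono) (auto simp: K_def algebra_simps)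
    also have "e\<^sup>2 * (K * (y \<bullet> y)) = t / 2 * (y \<bullet> y)" unfolding e(2) using K by simp
    finally show ?thesis by (simp add: r'_def algebra_simps)
  qed
  then show ?thesis using e(1) r' Rc D by (intro exI[of _ e]) (auto simp: unit_ball_mats_iff)
qed

section \<open>Dimensions\<close>

text \<open>The functionals \<open>x \<mapsto> (\<Sum>i\<in>I. L t i * ev x i)\<close>, \<open>t \<in> T\<close>, play the role of a dual basis of the span of \<open>X\<close>.\<close>
lemma Max_card_independent_eq:
  fixes ev :: "'x \<Rightarrow> 'i \<Rightarrow> real" and L :: "'t \<Rightarrow> 'i \<Rightarrow> real"
  assumes T: "finite T"
    and b: "\<And>t. t \<in> T \<Longrightarrow> b t \<in> X"
    and dual: "\<And>s t. s \<in> T \<Longrightarrow> t \<in> T \<Longrightarrow> (\<Sum>i\<in>I. L s i * ev (b t) i) = (if s = t then 1 else 0)"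
    and sep: "\<And>S c i. finite S \<Longrightarrow> S \<subseteq> X \<Longrightarrow> (\<And>t. t \<in> T \<Longrightarrow> (\<Sum>v\<in>S. c v * (\<Sum>i\<in>I. L t i * ev v i)) = 0) \<Longrightarrow>
       i \<in> I \<Longrightarrow> (\<Sum>v\<in>S. c v * ev v i) = 0"
  shows "Max {card S | S. S \<subseteq> X \<and> finite S \<and>
      (\<forall>c. (\<forall>i\<in>I. (\<Sum>v\<in>S. c v * ev v i) = 0) \<longrightarrow> (\<forall>v\<in>S. c v = 0))} = card T"
    (is "Max ?A = _")
proof -
  \<comment> \<open>More than \<open>card T\<close> vectors have a nontrivial combination on which
    all the functionals vanish; by \<open>sep\<close> it is 0 in coordinates, so the vectors are
    dependent.\<close>
  have le: "k \<le> card T" if "k \<in> ?A" for k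
  proof (rule ccontr)
    assume "\<not> k \<le> card T"
    with that obtain S where S: "S \<subseteq> X" "finite S" "card T < card S"
      "\<forall>c. (\<forall>i\<in>I. (\<Sum>v\<in>S. c v * ev v i) = 0) \<longrightarrow> (\<forall>v\<in>S. c v = 0)" by auto
    from linear_system_nontrivial_kernel[OF T S(2,3), of "\<lambda>v t. \<Sum>i\<in>I. L t i * ev v i"]
    obtain c where c: "\<exists>s\<in>S. c s \<noteq> 0" "\<And>t. t \<in> T \<Longrightarrow> (\<Sum>v\<in>S. c v * (\<Sum>i\<in>I. L t i * ev v i)) = 0" by auto
    have "\<forall>i\<in>I. (\<Sum>v\<in>S. c v * ev v i) = 0" using sep[OF S(2,1) c(2)] by blast
    then show False using S(4) c(1) by blast
  qed
  have inj: "inj_on b T"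
  proof (rule inj_onI)
    fix s t assume st: "s \<in> T" "t \<in> T" "b s = b t"
    then show "s = t" using dual[OF st(1,1)] dual[OF st(1,2)] by (auto split: if_splits)
  qed
  have "card (b ` T) \<in> ?A"
  proof (rule CollectI, intro exI[of _ "b ` T"] conjI allI impI ballI refl)
    show "b ` T \<subseteq> X" using b by auto
    show "finite (b ` T)" using T by simp
    fix c v assume c: "\<forall>i\<in>I. (\<Sum>v\<in>b ` T. c v * ev v i) = 0" and v: "v \<in> b ` T"
    then obtain s where s: "s \<in> T" "v = b s" by auto
    have "0 = (\<Sum>i\<in>I. L s i * (\<Sum>t\<in>T. c (b t) * ev (b t) i))"
      using c by (simp add: sum.reindex[OF inj])
    also have "\<dots> = (\<Sum>i\<in>I. \<Sum>t\<in>T. c (b t) * (L s i * ev (b t) i))"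
      by (simp add: sum_distrib_left mult_ac)
    also have "\<dots> = (\<Sum>t\<in>T. \<Sum>i\<in>I. c (b t) * (L s i * ev (b t) i))" by (rule sum.swap)
    also have "\<dots> = (\<Sum>t\<in>T. c (b t) * (if s = t then 1 else 0))"
      using dual[OF s(1)] by (simp add: sum_distrib_left[symmetric])
    also have "\<dots> = c v" using s T by (simp add: if_distrib cong: if_cong)
    finally show "c v = 0" by simp
  qed
  moreover have "card (b ` T) = card T" using inj by (rule card_image)
  ultimately have mem: "card T \<in> ?A" by (simp only:)
  \<comment> \<open>\<open>Max\<close> is meaningful only on a finite set, and the bound supplies
    finiteness.\<close>
  have "?A \<subseteq> {..card T}" by (rule subsetI, rule iffD2[OF atMost_iff], rule le)
  then have "finite ?A" by (rule finite_subset) simp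
  then show ?thesis by (rule Max_eqI[OF _ le mem])
qed

text \<open>The functionals \<open>x \<mapsto> s \<bullet> (P x)\<close>, written in coordinates
  through P^T, are dual to chosen preimages of the members of \<open>S\<close>. This transfers the
  dimensions of \<open>U\<close> and \<open>V\<close> to their coordinate projections, which are
  what the equations of \<open>W\<close> involve.\<close>

lemma dim_vecs_injective_image:
  assumes X: "subspace_n n X" and P: "P \<in> carrier_mat m n"
    and inj: "\<And>x. x \<in> X \<Longrightarrow> P *\<^sub>v x = 0\<^sub>v m \<Longrightarrow> x = 0\<^sub>v n"
    and S: "orthonormal m S" "S \<subseteq> (\<lambda>x. P *\<^sub>v x) ` X"
    and complete: "\<And>y. y \<in> (\<lambda>x. P *\<^sub>v x) ` X \<Longrightarrow> (\<And>w. w \<in> S \<Longrightarrow> w \<bullet> y = 0) \<Longrightarrow> y = 0\<^sub>v m"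
  shows "dim_vecs n X = card S"
proof -
  note oS = orthonormal_one[OF S(1)]
  note Xc = subspace_dim[OF X]
  define b where "b s = (SOME x. x \<in> X \<and> P *\<^sub>v x = s)" for s
  have bs: "b s \<in> X \<and> P *\<^sub>v b s = s" if "s \<in> S" for s
  proof -
    have "\<exists>x. x \<in> X \<and> P *\<^sub>v x = s" using that S(2) by auto
    then show ?thesis unfolding b_def by (rule someI_ex)
  qed
  have fn: "(\<Sum>i<n. (transpose_mat P *\<^sub>v s) $ i * v $ i) = s \<bullet> (P *\<^sub>v v)"
    if "s \<in> carrier_vec m" "v \<in> carrier_vec n" for s v
    using scalar_prod_mult_mat_vec[OF P that] that by (simp add: scalar_prod_def[of _ v] atLeast0LessThan)
  have "Max {card S | S. S \<subseteq> X \<and> finite S \<and>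
      (\<forall>c. (\<forall>i\<in>{..<n}. (\<Sum>v\<in>S. c v * v $ i) = 0) \<longrightarrow> (\<forall>v\<in>S. c v = 0))} = card S"
  proof (rule Max_card_independent_eq[where L = "\<lambda>s i. (transpose_mat P *\<^sub>v s) $ i" and b = b])
    show "finite S" by (rule oS(4))
    show "b t \<in> X" if "t \<in> S" for t using bs[OF that] by simp
    show "(\<Sum>i<n. (transpose_mat P *\<^sub>v s) $ i * b t $ i) = (if s = t then 1 else 0)"
      if "s \<in> S" "t \<in> S" for s t
    proof -
      have "(\<Sum>i<n. (transpose_mat P *\<^sub>v s) $ i * b t $ i) = s \<bullet> t"
        using fn[OF oS(3)[OF that(1)], of "b t"] bs[OF that(2)] Xc by simp
      then show ?thesis using oS(1,2) that by auto
    qed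
    fix S' c i assume S': "finite S'" "S' \<subseteq> X"
      and 0: "\<And>t. t \<in> S \<Longrightarrow> (\<Sum>v\<in>S'. c v * (\<Sum>i<n. (transpose_mat P *\<^sub>v t) $ i * v $ i)) = 0"
      and i: "i \<in> {..<n}"
    define z where "z = lincomb n S' c (\<lambda>v. v)"
    have zX: "z \<in> X" unfolding z_def using S' by (intro subspace_lincomb[OF X]) auto
    have Pz: "P *\<^sub>v z = lincomb m S' c (\<lambda>v. P *\<^sub>v v)"
      unfolding z_def using P S' Xc by (intro mult_mat_vec_lincomb) auto
    have "t \<bullet> (P *\<^sub>v z) = 0" if t: "t \<in> S" for t
    proof -
      have "t \<bullet> (P *\<^sub>v z) = (\<Sum>v\<in>S'. c v * (t \<bullet> (P *\<^sub>v v)))"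
        unfolding Pz using P S' Xc oS(3)[OF t] by (intro scalar_prod_lincomb) auto
      also have "\<dots> = (\<Sum>v\<in>S'. c v * (\<Sum>i<n. (transpose_mat P *\<^sub>v t) $ i * v $ i))"
        using S' Xc by (intro sum.cong refl) (auto simp: fn[OF oS(3)[OF t]])
      finally show ?thesis using 0[OF t] by simp
    qed
    then have "P *\<^sub>v z = 0\<^sub>v m" using zX by (intro complete) auto
    then have "z = 0\<^sub>v n" by (rule inj[OF zX])
    then have "z $ i = 0" using i by simp
    then show "(\<Sum>v\<in>S'. c v * v $ i) = 0" using i by (simp add: z_def)
  qed
  then show ?thesis by (simp only: dim_vecs_def lin_indep_vecs_def Ball_def lessThan_iff)
qed

lemma subspace_image:
  assumes X: "subspace_n n X" and P: "P \<in> carrier_mat m n"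
  shows "subspace_n m ((\<lambda>x. P *\<^sub>v x) ` X)"
  unfolding subspace_n_def
proof (intro conjI ballI allI)
  note Xc = subspace_dim[OF X]
  show "(\<lambda>x. P *\<^sub>v x) ` X \<subseteq> carrier_vec m" using P Xc by auto
  have P0: "0\<^sub>v m = P *\<^sub>v 0\<^sub>v n" using P by (intro eq_vecI) auto
  have "0\<^sub>v n \<in> X" using X by (simp add: subspace_n_def)
  then show "0\<^sub>v m \<in> (\<lambda>x. P *\<^sub>v x) ` X" by (rule image_eqI[where f = "\<lambda>x. P *\<^sub>v x", OF P0])
  fix u assume u: "u \<in> (\<lambda>x. P *\<^sub>v x) ` X"
  then obtain x where x: "x \<in> X" "u = P *\<^sub>v x" by auto
  show "u + v \<in> (\<lambda>x. P *\<^sub>v x) ` X" if v: "v \<in> (\<lambda>x. P *\<^sub>v x) ` X" for v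
  proof -
    obtain y where y: "y \<in> X" "v = P *\<^sub>v y" using v by auto
    have "u + v = P *\<^sub>v (x + y)" using mult_add_distrib_mat_vec[OF P Xc[OF x(1)] Xc[OF y(1)]] x y by simp
    moreover have "x + y \<in> X" using X x y by (auto simp: subspace_n_def)
    ultimately show ?thesis by auto
  qed
  show "c \<cdot>\<^sub>v u \<in> (\<lambda>x. P *\<^sub>v x) ` X" for c
  proof -
    have "c \<cdot>\<^sub>v u = P *\<^sub>v (c \<cdot>\<^sub>v x)" using mult_mat_vec[OF P Xc[OF x(1)]] x by simp
    moreover have "c \<cdot>\<^sub>v x \<in> X" using X x by (auto simp: subspace_n_def)
    ultimately show ?thesis by auto
  qed
qed

text \<open>A basis of \<open>X\<close> sits inside a basis of the whole space, so that
  \<open>B - S\<close> has \<open>m - card S\<close> members. \<open>card B\<close> cannot be below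
  \<open>m\<close>, since fewer than \<open>m\<close> equations \<open>w \<bullet> x = 0\<close>
  have a nonzero solution.\<close>

lemma subspace_orthonormal_basis:
  assumes X: "subspace_n m X"
  obtains S B where "S \<subseteq> X" "S \<subseteq> B" "orthonormal m B" "card B = m"
    "\<forall>x\<in>X. (\<forall>w\<in>S. w \<bullet> x = 0) \<longrightarrow> x = 0\<^sub>v m"
    "\<forall>x\<in>carrier_vec m. (\<forall>w\<in>B. w \<bullet> x = 0) \<longrightarrow> x = 0\<^sub>v m"
proof -
  note Xc = subspace_dim[OF X]
  have 0: "orthonormal m {}" by (simp add: orthonormal_wrt_def)
  have self: "bil (1\<^sub>m m) x x \<noteq> 0" if "x \<in> carrier_vec m" "x \<noteq> 0\<^sub>v m" for x
    using that scalar_prod_self_pos[OF that] by (simp add: bil_one)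
  have nd: "\<exists>y\<in>X. bil (1\<^sub>m m) x y \<noteq> 0" if "x \<in> X" "x \<noteq> 0\<^sub>v m" for x
    using self[OF Xc[OF that(1)] that(2)] that(1) by blast
  have nd': "\<exists>y\<in>carrier_vec m. bil (1\<^sub>m m) x y \<noteq> 0" if "x \<in> carrier_vec m" "x \<noteq> 0\<^sub>v m" for x
    using self[OF that] that(1) by blast
  obtain S where S: "S \<subseteq> X" "orthonormal m S"
    "\<forall>x\<in>X. (\<forall>w\<in>S. bil (1\<^sub>m m) w x = 0) \<longrightarrow> x = 0\<^sub>v m"
    using orthonormal_wrt_extend[OF one_sym_mats X 0 empty_subsetI nd] by blast
  have Sc: "S \<subseteq> carrier_vec m" using S(1) Xc by blast
  obtain B where B: "S \<subseteq> B" "orthonormal m B"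
    "\<forall>x\<in>carrier_vec m. (\<forall>w\<in>B. bil (1\<^sub>m m) w x = 0) \<longrightarrow> x = 0\<^sub>v m"
    using orthonormal_wrt_extend[OF one_sym_mats subspace_carrier S(2) Sc nd'] by blast
  note oB = orthonormal_one[OF B(2)]
  have cS: "x = 0\<^sub>v m" if x: "x \<in> X" "\<And>w. w \<in> S \<Longrightarrow> w \<bullet> x = 0" for x
  proof -
    have "bil (1\<^sub>m m) w x = 0" if "w \<in> S" for w
      using bil_one[of w m x] x(2)[OF that] Sc that Xc[OF x(1)] by auto
    then show ?thesis using S(3) x(1) by blast
  qed
  have cB: "x = 0\<^sub>v m" if x: "x \<in> carrier_vec m" "\<And>w. w \<in> B \<Longrightarrow> w \<bullet> x = 0" for x
  proof -
    have "bil (1\<^sub>m m) w x = 0" if "w \<in> B" for w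
      using bil_one[OF oB(3)[OF that] x(1)] x(2)[OF that] by simp
    then show ?thesis using B(3) x(1) by blast
  qed
  have "card B = m"
  proof (rule antisym)
    show "card B \<le> m" using orthonormal_wrt_finite_card(2)[OF B(2)] by simp
    show "m \<le> card B"
    proof (rule ccontr)
      assume "\<not> m \<le> card B"
      then have "card B < card {..<m}" by simp
      from linear_system_nontrivial_kernel[OF oB(4) _ this, of "\<lambda>i w. w $ i"] obtain c where
        c: "\<exists>i<m. c i \<noteq> 0" "\<And>w. w \<in> B \<Longrightarrow> (\<Sum>i<m. c i * w $ i) = 0" by auto
      have "w \<bullet> vec m c = 0" if "w \<in> B" for w
        using c(2)[OF that] by (simp add: scalar_prod_def atLeast0LessThan mult.commute)
      then have "vec m c = 0\<^sub>v m" by (intro cB) auto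
      then have "vec m c $ i = 0" if "i < m" for i using that by simp
      then show False using c(1) by auto
    qed
  qed
  then show thesis using that[OF S(1) B(1,2)] cS cB by simp
qed

lemma orthonormal_wrt_subset: "orthonormal_wrt n N B \<Longrightarrow> S \<subseteq> B \<Longrightarrow> orthonormal_wrt n N S"
  unfolding orthonormal_wrt_def by blast

lemma orthogonal_to_subspace:
  assumes B: "orthonormal m B" and S: "S \<subseteq> B" "S \<subseteq> X" and X: "subspace_n m X"
    and cS: "\<And>x. x \<in> X \<Longrightarrow> (\<And>w. w \<in> S \<Longrightarrow> w \<bullet> x = 0) \<Longrightarrow> x = 0\<^sub>v m"
    and s: "s \<in> B - S" and x: "x \<in> X"
  shows "s \<bullet> x = 0"
proof -
  note oB = orthonormal_one[OF B]
  have oS: "orthonormal m S" by (rule orthonormal_wrt_subset[OF B S(1)])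
  note oS' = orthonormal_one[OF oS]
  have sc: "s \<in> carrier_vec m" using s oB(3) by blast
  have "x = lincomb m S (\<lambda>w. bil (1\<^sub>m m) w w * bil (1\<^sub>m m) w x) (\<lambda>w. w)"
  proof (rule orthonormal_wrt_expansion[OF one_sym_mats X oS S(2) _ x])
    fix y assume y: "y \<in> X" "\<And>w. w \<in> S \<Longrightarrow> bil (1\<^sub>m m) w y = 0"
    have "w \<bullet> y = 0" if "w \<in> S" for w
      using y(2)[OF that] bil_one[OF oS'(3)[OF that] subspace_dim[OF X y(1)]] by simp
    then show "y = 0\<^sub>v m" using cS[OF y(1)] by blast
  qed
  then have "s \<bullet> x = s \<bullet> lincomb m S (\<lambda>w. bil (1\<^sub>m m) w w * bil (1\<^sub>m m) w x) (\<lambda>w. w)"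
    by (rule arg_cong)
  also have "\<dots> = (\<Sum>w\<in>S. (bil (1\<^sub>m m) w w * bil (1\<^sub>m m) w x) * (s \<bullet> w))"
    using oS' sc by (intro scalar_prod_lincomb) auto
  also have "\<dots> = 0"
  proof (intro sum.neutral ballI)
    fix w assume "w \<in> S"
    then have "s \<bullet> w = 0" using s S(1) by (intro oB(2)) auto
    then show "bil (1\<^sub>m m) w w * bil (1\<^sub>m m) w x * (s \<bullet> w) = 0" by simp
  qed
  finally show ?thesis .
qed

lemma sum_mats_mult_vec:
  assumes h: "\<And>k. k \<in> K \<Longrightarrow> h k \<in> carrier_mat m n" and y: "y \<in> carrier_vec n"
  shows "mat m n (\<lambda>ij. \<Sum>k\<in>K. f k * h k $$ ij) *\<^sub>v y = lincomb m K f (\<lambda>k. h k *\<^sub>v y)"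
proof (rule eq_vecI)
  fix i assume "i < dim_vec (lincomb m K f (\<lambda>k. h k *\<^sub>v y))"
  then have i: "i < m" by simp
  have "(mat m n (\<lambda>ij. \<Sum>k\<in>K. f k * h k $$ ij) *\<^sub>v y) $ i = (\<Sum>j<n. \<Sum>k\<in>K. f k * (h k $$ (i,j) * y $ j))"
    using i y by (simp add: scalar_prod_def atLeast0LessThan sum_distrib_right mult.assoc)
  also have "\<dots> = (\<Sum>k\<in>K. \<Sum>j<n. f k * (h k $$ (i,j) * y $ j))" by (rule sum.swap)
  also have "\<dots> = (\<Sum>k\<in>K. f k * (h k *\<^sub>v y) $ i)"
  proof (intro sum.cong refl)
    fix k assume "k \<in> K"
    then show "(\<Sum>j<n. f k * (h k $$ (i,j) * y $ j)) = f k * (h k *\<^sub>v y) $ i"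
      using h[of k] i y by (auto simp: scalar_prod_def atLeast0LessThan sum_distrib_left)
  qed
  finally show "(mat m n (\<lambda>ij. \<Sum>k\<in>K. f k * h k $$ ij) *\<^sub>v y) $ i = lincomb m K f (\<lambda>k. h k *\<^sub>v y) $ i"
    using i by simp
qed simp

text \<open>In bases adapted to \<open>X\<close> and \<open>Y\<close>, an annihilating matrix is
  determined by its entries \<open>s \<bullet> (D t)\<close> with \<open>s\<close> in
  \<open>B - S\<close> and \<open>t\<close> in \<open>E - T\<close>. These entries are free, because
  the rank-one matrices s t^T are annihilating and realize them one at a time.\<close>

lemma dim_annihilating_mats:
  assumes X: "subspace_n p X" and Y: "subspace_n q Y"
    and S: "S \<subseteq> X" "S \<subseteq> B" "orthonormal p B"
    and cS: "\<And>x. x \<in> X \<Longrightarrow> (\<And>w. w \<in> S \<Longrightarrow> w \<bullet> x = 0) \<Longrightarrow> x = 0\<^sub>v p"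
    and cB: "\<And>x. x \<in> carrier_vec p \<Longrightarrow> (\<And>w. w \<in> B \<Longrightarrow> w \<bullet> x = 0) \<Longrightarrow> x = 0\<^sub>v p"
    and T: "T \<subseteq> Y" "T \<subseteq> E" "orthonormal q E"
    and cT: "\<And>x. x \<in> Y \<Longrightarrow> (\<And>w. w \<in> T \<Longrightarrow> w \<bullet> x = 0) \<Longrightarrow> x = 0\<^sub>v q"
    and cE: "\<And>x. x \<in> carrier_vec q \<Longrightarrow> (\<And>w. w \<in> E \<Longrightarrow> w \<bullet> x = 0) \<Longrightarrow> x = 0\<^sub>v q"
  defines "Z \<equiv> {D \<in> carrier_mat p q. (\<forall>x\<in>X. transpose_mat D *\<^sub>v x = 0\<^sub>v q) \<and> (\<forall>y\<in>Y. D *\<^sub>v y = 0\<^sub>v p)}"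
  shows "dim_mats p q Z = card (B - S) * card (E - T)"
    and "Z \<subseteq> {0\<^sub>m p q} \<longleftrightarrow> B = S \<or> E = T"
proof -
  note oB = orthonormal_one[OF S(3)] and oE = orthonormal_one[OF T(3)]
  define K where "K = (B - S) \<times> (E - T)"
  define b where "b st = mat p q (\<lambda>(i,j). fst st $ i * snd st $ j)" for st :: "real vec \<times> real vec"
  define L where "L st ij = fst st $ fst ij * snd st $ snd ij" for st :: "real vec \<times> real vec" and ij :: "nat \<times> nat"
  have fn: "(\<Sum>ij\<in>{..<p} \<times> {..<q}. L (s,t) ij * D $$ ij) = s \<bullet> (D *\<^sub>v t)"
    if "s \<in> carrier_vec p" "t \<in> carrier_vec q" "D \<in> carrier_mat p q" for s t D
  proof -
    have "(\<Sum>ij\<in>{..<p} \<times> {..<q}. L (s,t) ij * D $$ ij) = (\<Sum>(i,j)\<in>{..<p} \<times> {..<q}. s $ i * (D $$ (i,j) * t $ j))"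
      by (intro sum.cong) (auto simp: L_def)
    also have "\<dots> = (\<Sum>i<p. \<Sum>j<q. s $ i * (D $$ (i,j) * t $ j))" by (simp add: sum.cartesian_product)
    also have "\<dots> = s \<bullet> (D *\<^sub>v t)"
      using that by (simp add: scalar_prod_def atLeast0LessThan sum_distrib_left)
    finally show ?thesis .
  qed
  have bc: "b st \<in> carrier_mat p q" for st by (simp add: b_def)
  have bv: "b (s,t) *\<^sub>v y = (t \<bullet> y) \<cdot>\<^sub>v s" if "s \<in> carrier_vec p" "t \<in> carrier_vec q" "y \<in> carrier_vec q" for s t y
    using that by (intro eq_vecI) (auto simp: b_def scalar_prod_def sum_distrib_left sum_distrib_right mult_ac)
  have btv: "transpose_mat (b (s,t)) *\<^sub>v x = (s \<bullet> x) \<cdot>\<^sub>v t"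
    if "s \<in> carrier_vec p" "t \<in> carrier_vec q" "x \<in> carrier_vec p" for s t x
    using that by (intro eq_vecI) (auto simp: b_def scalar_prod_def sum_distrib_left sum_distrib_right mult_ac)
  have bZ: "b (s,t) \<in> Z" if st: "s \<in> B - S" "t \<in> E - T" for s t
  proof -
    have c: "s \<in> carrier_vec p" "t \<in> carrier_vec q" using st oB(3) oE(3) by auto
    have "s \<bullet> x = 0" if "x \<in> X" for x by (rule orthogonal_to_subspace[OF S(3,2,1) X cS st(1) that])
    moreover have "t \<bullet> y = 0" if "y \<in> Y" for y by (rule orthogonal_to_subspace[OF T(3,2,1) Y cT st(2) that])
    ultimately show ?thesis
      using c bc by (auto simp: Z_def bv btv subspace_dim[OF X] subspace_dim[OF Y])
  qed
  have dual: "s \<bullet> (b (s',t') *\<^sub>v t) = (if (s,t) = (s',t') then 1 else 0)"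
    if "s \<in> B" "t \<in> E" "s' \<in> B" "t' \<in> E" for s t s' t'
  proof -
    have "s \<bullet> (b (s',t') *\<^sub>v t) = (t' \<bullet> t) * (s \<bullet> s')"
      using bv[OF oB(3)[OF that(3)] oE(3)[OF that(4)] oE(3)[OF that(2)]]
        scalar_prod_smult_distrib[OF oB(3)[OF that(1)] oB(3)[OF that(3)]] by simp
    then show ?thesis using oB(1,2) oE(1,2) that by auto
  qed
  \<comment> \<open>Entries with \<open>s\<close> in \<open>S\<close> or \<open>t\<close> in
    \<open>T\<close> vanish since \<open>D\<close> annihilates, the others by assumption;
    completeness of \<open>E\<close> and then of \<open>B\<close> gives
    \<open>D = 0\<close>.\<close>
  have sep: "D = 0\<^sub>m p q"
    if D: "D \<in> Z" and 0: "\<And>s t. s \<in> B - S \<Longrightarrow> t \<in> E - T \<Longrightarrow> s \<bullet> (D *\<^sub>v t) = 0" for D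
  proof -
    have Dc: "D \<in> carrier_mat p q" using D by (simp add: Z_def)
    have st: "s \<bullet> (D *\<^sub>v t) = 0" if BE: "s \<in> B" "t \<in> E" for s t
    proof -
      have c: "s \<in> carrier_vec p" "t \<in> carrier_vec q" using BE oB(3) oE(3) by auto
      consider "s \<in> S" | "t \<in> T" | "s \<in> B - S" "t \<in> E - T" using BE by auto
      then show ?thesis
      proof cases
        case 1
        then have "transpose_mat D *\<^sub>v s = 0\<^sub>v q" using D S(1) by (auto simp: Z_def)
        then show ?thesis using scalar_prod_mult_mat_vec[OF Dc c] c by simp
      next
        case 2
        then have "D *\<^sub>v t = 0\<^sub>v p" using D T(1) by (auto simp: Z_def)
        then show ?thesis using c by simp
      next
        case 3
        then show ?thesis by (rule 0)
      qed
    qed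
    have Ds: "transpose_mat D *\<^sub>v s = 0\<^sub>v q" if s: "s \<in> B" for s
    proof (rule cE)
      have c: "s \<in> carrier_vec p" using s oB(3) by auto
      then show Dsc: "transpose_mat D *\<^sub>v s \<in> carrier_vec q" using Dc by auto
      fix t assume t: "t \<in> E"
      have "t \<bullet> (transpose_mat D *\<^sub>v s) = (transpose_mat D *\<^sub>v s) \<bullet> t"
        by (rule comm_scalar_prod[OF oE(3)[OF t] Dsc])
      also have "\<dots> = s \<bullet> (D *\<^sub>v t)" using scalar_prod_mult_mat_vec[OF Dc c oE(3)[OF t]] by simp
      finally show "t \<bullet> (transpose_mat D *\<^sub>v s) = 0" using st[OF s t] by simp
    qed
    show ?thesis
    proof (rule mat_eq_mult_vecI[OF Dc zero_carrier_mat])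
      fix y :: "real vec" assume y: "y \<in> carrier_vec q"
      have "D *\<^sub>v y = 0\<^sub>v p"
      proof (rule cB)
        show "D *\<^sub>v y \<in> carrier_vec p" using Dc y by auto
        fix s assume s: "s \<in> B"
        show "s \<bullet> (D *\<^sub>v y) = 0" using scalar_prod_mult_mat_vec[OF Dc oB(3)[OF s] y] Ds[OF s] y by simp
      qed
      then show "D *\<^sub>v y = 0\<^sub>m p q *\<^sub>v y" using y by (auto intro!: eq_vecI)
    qed
  qed
  have ball_pairs: "(\<forall>ij\<in>{..<p} \<times> {..<q}. Q ij) \<longleftrightarrow> (\<forall>i<p. \<forall>j<q. Q (i,j))" for Q by auto
  have finK: "finite K" using oB(4) oE(4) by (simp add: K_def)
  have "Max {card S | S. S \<subseteq> Z \<and> finite S \<and>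
      (\<forall>c. (\<forall>ij\<in>{..<p} \<times> {..<q}. (\<Sum>v\<in>S. c v * v $$ ij) = 0) \<longrightarrow> (\<forall>v\<in>S. c v = 0))} = card K"
  proof (rule Max_card_independent_eq[where L = L and b = b, OF finK])
    show "b st \<in> Z" if "st \<in> K" for st using that bZ by (auto simp: K_def)
    show "(\<Sum>ij\<in>{..<p} \<times> {..<q}. L st ij * b st' $$ ij) = (if st = st' then 1 else 0)"
      if st: "st \<in> K" "st' \<in> K" for st st'
    proof -
      obtain s t s' t' where e: "st = (s,t)" "st' = (s',t')" by (metis surj_pair)
      have m: "s \<in> B" "t \<in> E" "s' \<in> B" "t' \<in> E" using st by (auto simp: K_def e)
      show ?thesis
        using fn[OF oB(3)[OF m(1)] oE(3)[OF m(2)] bc] dual[OF m] by (simp add: e)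
    qed
    fix G c ij assume G: "finite G" "G \<subseteq> Z" and ij: "ij \<in> {..<p} \<times> {..<q}"
      and 0: "\<And>st. st \<in> K \<Longrightarrow> (\<Sum>v\<in>G. c v * (\<Sum>ij\<in>{..<p} \<times> {..<q}. L st ij * v $$ ij)) = 0"
    have Gc: "M \<in> carrier_mat p q" if "M \<in> G" for M using G(2) that by (auto simp: Z_def)
    define D where "D = mat p q (\<lambda>ij. \<Sum>M\<in>G. c M * M $$ ij)"
    have Dc: "D \<in> carrier_mat p q" by (simp add: D_def)
    have Dv: "D *\<^sub>v y = lincomb p G c (\<lambda>M. M *\<^sub>v y)" if y: "y \<in> carrier_vec q" for y
      unfolding D_def using Gc y by (rule sum_mats_mult_vec)
    have "transpose_mat D = mat q p (\<lambda>ij. \<Sum>M\<in>G. c M * transpose_mat M $$ ij)"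
    proof -
      have "transpose_mat M $$ (j,i) = M $$ (i,j)" if "M \<in> G" "i < p" "j < q" for M i j
        using Gc[OF that(1)] that by simp
      then show ?thesis by (intro eq_matI) (auto simp: D_def)
    qed
    then have Dtv: "transpose_mat D *\<^sub>v x = lincomb q G c (\<lambda>M. transpose_mat M *\<^sub>v x)" if "x \<in> carrier_vec p" for x
      using Gc that by (simp add: sum_mats_mult_vec)
    have DZ: "D \<in> Z"
      unfolding Z_def
    proof (intro CollectI conjI ballI Dc)
      fix x assume x: "x \<in> X"
      have "transpose_mat M *\<^sub>v x = 0\<^sub>v q" if "M \<in> G" for M using G(2) that x by (auto simp: Z_def)
      then show "transpose_mat D *\<^sub>v x = 0\<^sub>v q"
        unfolding Dtv[OF subspace_dim[OF X x]] by (intro eq_vecI) simp_all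
    next
      fix y assume y: "y \<in> Y"
      have "M *\<^sub>v y = 0\<^sub>v p" if "M \<in> G" for M using G(2) that y by (auto simp: Z_def)
      then show "D *\<^sub>v y = 0\<^sub>v p"
        unfolding Dv[OF subspace_dim[OF Y y]] by (intro eq_vecI) simp_all
    qed
    have "D = 0\<^sub>m p q"
    proof (rule sep[OF DZ])
      fix s t assume st: "s \<in> B - S" "t \<in> E - T"
      have c: "s \<in> carrier_vec p" "t \<in> carrier_vec q" using st oB(3) oE(3) by auto
      have "s \<bullet> (D *\<^sub>v t) = (\<Sum>M\<in>G. c M * (s \<bullet> (M *\<^sub>v t)))"
        unfolding Dv[OF c(2)] using c Gc by (intro scalar_prod_lincomb mult_mat_vec_carrier) auto
      also have "\<dots> = (\<Sum>M\<in>G. c M * (\<Sum>ij\<in>{..<p} \<times> {..<q}. L (s,t) ij * M $$ ij))"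
        using fn[OF c] Gc by (intro sum.cong refl) simp
      also have "\<dots> = 0" using 0[of "(s,t)"] st by (simp add: K_def)
      finally show "s \<bullet> (D *\<^sub>v t) = 0" .
    qed
    then have "D $$ ij = 0" using ij by auto
    then show "(\<Sum>v\<in>G. c v * v $$ ij) = 0" using ij by (auto simp: D_def)
  qed
  then have "dim_mats p q Z = card K"
    unfolding dim_mats_def lin_indep_mats_def ball_pairs .
  then show "dim_mats p q Z = card (B - S) * card (E - T)" by (simp add: K_def card_cartesian_product)
  show "Z \<subseteq> {0\<^sub>m p q} \<longleftrightarrow> B = S \<or> E = T"
  proof
    assume "Z \<subseteq> {0\<^sub>m p q}"
    show "B = S \<or> E = T"
    proof (rule ccontr)
      assume "\<not> (B = S \<or> E = T)"
      then obtain s t where st: "s \<in> B - S" "t \<in> E - T" using S(2) T(2) by blast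
      then have b0: "b (s,t) = 0\<^sub>m p q" using bZ \<open>Z \<subseteq> {0\<^sub>m p q}\<close> by blast
      have c: "s \<in> carrier_vec p" "t \<in> carrier_vec q" using st oB(3) oE(3) by auto
      have "b (s,t) *\<^sub>v t = 0\<^sub>v p" unfolding b0 using c by (intro eq_vecI) auto
      then show False using dual[of s t s t] st c by simp
    qed
  next
    assume "B = S \<or> E = T"
    then show "Z \<subseteq> {0\<^sub>m p q}" using sep by blast
  qed
qed

text \<open>With offsets \<open>k = 0\<close> and \<open>k = p\<close> this realizes the two
  coordinate projections as matrices, as the lemmas on images of subspaces require.\<close>

lemma shifted_identity_mult_vec:
  fixes x :: "real vec"
  assumes x: "x \<in> carrier_vec n" and k: "k + m \<le> n"
  shows "mat m n (\<lambda>(i,j). if j = k + i then 1 else 0) *\<^sub>v x = vec m (\<lambda>i. x $ (k + i))"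
proof (rule eq_vecI)
  fix i assume "i < dim_vec (vec m (\<lambda>i. x $ (k + i)))"
  then have i: "i < m" by simp
  have "(mat m n (\<lambda>(i,j). if j = k + i then 1 else 0) *\<^sub>v x) $ i = (\<Sum>j<n. (if j = k + i then 1 else 0) * x $ j)"
    using x i by (simp add: scalar_prod_def atLeast0LessThan)
  also have "\<dots> = (\<Sum>j<n. if j = k + i then x $ j else 0)" by (intro sum.cong) auto
  also have "\<dots> = x $ (k + i)" using i k by simp
  finally show "(mat m n (\<lambda>(i,j). if j = k + i then 1 else 0) *\<^sub>v x) $ i = vec m (\<lambda>i. x $ (k + i)) $ i"
    using i by simp
qed simp

section \<open>The directions of the affine space \<open>W\<close>\<close>

definition annihilating_mats :: "nat \<Rightarrow> nat \<Rightarrow> real vec set \<Rightarrow> real vec set \<Rightarrow> real mat set" where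
  "annihilating_mats p q X Y = {D \<in> carrier_mat p q.
     (\<forall>x\<in>X. transpose_mat D *\<^sub>v x = 0\<^sub>v q) \<and> (\<forall>y\<in>Y. D *\<^sub>v y = 0\<^sub>v p)}"

abbreviation (input) W_dirs :: "nat \<Rightarrow> nat \<Rightarrow> real vec set \<Rightarrow> real vec set \<Rightarrow> real mat set" where
  "W_dirs p q U V \<equiv> annihilating_mats p q (proj_first p ` U) (proj_last q ` V)"

text \<open>The constant terms of the affine equations are already balanced by \<open>R\<close>,
  which leaves the homogeneous equations for \<open>D\<close>.\<close>

lemma W_set_translate:
  assumes R: "R \<in> W_set p q U V" and D: "D \<in> carrier_mat p q"
  shows "R + D \<in> W_set p q U V \<longleftrightarrow> D \<in> W_dirs p q U V"
proof -
  have Rc: "R \<in> carrier_mat p q" using R by (simp add: W_set_def)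
  have Rt: "transpose_mat R \<in> carrier_mat q p" and Dt: "transpose_mat D \<in> carrier_mat q p" using Rc D by auto
  have shift: "(a + d) + c = 0\<^sub>v k \<longleftrightarrow> d = 0\<^sub>v k"
    if c: "a \<in> carrier_vec k" "d \<in> carrier_vec k" "c \<in> carrier_vec k" and 0: "a + c = 0\<^sub>v k"
    for a c d :: "real vec" and k
  proof -
    have "(a + d) + c = d + (a + c)" using c by (intro eq_vecI) auto
    also have "\<dots> = d" using c by (simp add: 0)
    finally show ?thesis by simp
  qed
  have "transpose_mat (R + D) *\<^sub>v proj_first p u + proj_last q u = 0\<^sub>v q \<longleftrightarrow> transpose_mat D *\<^sub>v proj_first p u = 0\<^sub>v q"
    if "u \<in> U" for u
  proof -
    have "transpose_mat R *\<^sub>v proj_first p u + proj_last q u = 0\<^sub>v q" using R that by (auto simp: W_set_def)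
    from shift[OF mult_mat_vec_carrier[OF Rt proj_carrier(1)] mult_mat_vec_carrier[OF Dt proj_carrier(1)] proj_carrier(2) this]
    show ?thesis
      by (simp only: transpose_add[OF Rc D] add_mult_distrib_mat_vec[OF Rt Dt proj_carrier(1)])
  qed
  moreover have "(R + D) *\<^sub>v proj_last q v + proj_first p v = 0\<^sub>v p \<longleftrightarrow> D *\<^sub>v proj_last q v = 0\<^sub>v p"
    if "v \<in> V" for v
  proof -
    have "R *\<^sub>v proj_last q v + proj_first p v = 0\<^sub>v p" using R that by (auto simp: W_set_def)
    from shift[OF mult_mat_vec_carrier[OF Rc proj_carrier(2)] mult_mat_vec_carrier[OF D proj_carrier(2)] proj_carrier(1) this]
    show ?thesis
      by (simp only: add_mult_distrib_mat_vec[OF Rc D proj_carrier(2)])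
  qed
  ultimately show ?thesis using Rc D by (simp add: W_set_def annihilating_mats_def)
qed

lemma W_set_directions:
  assumes R: "R \<in> W_set p q U V"
  shows "{X - Y | X Y. X \<in> W_set p q U V \<and> Y \<in> W_set p q U V} =
    W_dirs p q U V"
proof (intro equalityI subsetI)
  fix D assume "D \<in> {X - Y | X Y. X \<in> W_set p q U V \<and> Y \<in> W_set p q U V}"
  then obtain X Y where XY: "D = X - Y" "X \<in> W_set p q U V" "Y \<in> W_set p q U V" by auto
  then have c: "X \<in> carrier_mat p q" "Y \<in> carrier_mat p q" by (auto simp: W_set_def)
  have "Y + (X - Y) = X" using c by (intro eq_matI) auto
  then show "D \<in> W_dirs p q U V"
    using W_set_translate[OF XY(3) minus_carrier_mat[OF c(2)], of X] XY by simp
next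
  fix D assume D: "D \<in> W_dirs p q U V"
  then have Dc: "D \<in> carrier_mat p q" by (simp add: annihilating_mats_def)
  have Rc: "R \<in> carrier_mat p q" using R by (simp add: W_set_def)
  have "R + D - R = D" using Rc Dc by (intro eq_matI) auto
  moreover have "R + D \<in> W_set p q U V" using W_set_translate[OF R Dc] D by simp
  ultimately have "D = (R + D) - R \<and> R + D \<in> W_set p q U V \<and> R \<in> W_set p q U V" using R by simp
  then show "D \<in> {X - Y | X Y. X \<in> W_set p q U V \<and> Y \<in> W_set p q U V}" by blast
qed

text \<open>A vector (0, b) has \<open>J\<close>-value \<open>- (b \<bullet> b)\<close>, which is
  never positive. Hence \<open>proj_first\<close> is injective on \<open>U\<close> and keeps its
  dimension.\<close>

lemma pos_def_over_J_imp_inj: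
  assumes "pos_def_over (p + q) (J_mat p q) U" "u \<in> U" "u \<in> carrier_vec (p + q)" "proj_first p u = 0\<^sub>v p"
  shows "u = 0\<^sub>v (p + q)"
proof (rule ccontr)
  assume "u \<noteq> 0\<^sub>v (p + q)"
  then have "bil (J_mat p q) u u > 0" using assms by (auto simp: pos_def_over_def qform_bil)
  then show False using assms(4) scalar_prod_self_ge_0[of "proj_last q u"] by (simp add: bil_J_mat[OF assms(3)])
qed

lemma neg_def_over_J_imp_inj:
  assumes "neg_def_over (p + q) (J_mat p q) V" "v \<in> V" "v \<in> carrier_vec (p + q)" "proj_last q v = 0\<^sub>v q"
  shows "v = 0\<^sub>v (p + q)"
proof (rule ccontr)
  assume "v \<noteq> 0\<^sub>v (p + q)"
  then have "bil (J_mat p q) v v < 0" using assms by (auto simp: neg_def_over_def qform_bil)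
  then show False using assms(4) scalar_prod_self_ge_0[of "proj_first p v"] by (simp add: bil_J_mat[OF assms(3)])
qed

text \<open>The point \<open>R\<close> makes \<open>W\<close> nonempty, so that differences of its
  elements fill the whole direction space. That space is then counted with orthonormal bases of the
  projections of \<open>U\<close> and \<open>V\<close>.\<close>

lemma W_set_dimension:
  assumes U: "subspace_n (p + q) U" and V: "subspace_n (p + q) V"
    and pos: "pos_def_over (p + q) (J_mat p q) U" and neg: "neg_def_over (p + q) (J_mat p q) V"
    and R: "R \<in> W_set p q U V"
  shows "affine_dim_mats p q (W_set p q U V) = (p - dim_vecs (p + q) U) * (q - dim_vecs (p + q) V)"
    and "W_dirs p q U V \<subseteq> {0\<^sub>m p q} \<longleftrightarrow>
      dim_vecs (p + q) U = p \<or> dim_vecs (p + q) V = q"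
proof -
  note Uc = subspace_dim[OF U] and Vc = subspace_dim[OF V]
  \<comment> \<open>The form \<open>0 + i\<close> matches the pattern \<open>k + i\<close> of
    \<open>shifted_identity_mult_vec\<close>.\<close>
  define P1 :: "real mat" where "P1 = mat p (p + q) (\<lambda>(i,j). if j = 0 + i then 1 else 0)"
  define P2 :: "real mat" where "P2 = mat q (p + q) (\<lambda>(i,j). if j = p + i then 1 else 0)"
  have P1: "P1 \<in> carrier_mat p (p + q)" "\<And>x. x \<in> carrier_vec (p + q) \<Longrightarrow> P1 *\<^sub>v x = proj_first p x"
    unfolding P1_def by (simp, subst shifted_identity_mult_vec) (simp_all add: proj_first_def)
  have P2: "P2 \<in> carrier_mat q (p + q)" "\<And>x. x \<in> carrier_vec (p + q) \<Longrightarrow> P2 *\<^sub>v x = proj_last q x"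
    unfolding P2_def by (simp, subst shifted_identity_mult_vec) (simp_all add: proj_last_def)
  have img: "(\<lambda>x. P1 *\<^sub>v x) ` U = proj_first p ` U" "(\<lambda>x. P2 *\<^sub>v x) ` V = proj_last q ` V"
    using P1(2) P2(2) Uc Vc by (auto intro!: image_cong)
  have XU: "subspace_n p (proj_first p ` U)" and YV: "subspace_n q (proj_last q ` V)"
    using subspace_image[OF U P1(1)] subspace_image[OF V P2(1)] by (simp_all only: img)
  obtain S B where S: "S \<subseteq> proj_first p ` U" "S \<subseteq> B" "orthonormal p B" "card B = p"
    "\<forall>x\<in>proj_first p ` U. (\<forall>w\<in>S. w \<bullet> x = 0) \<longrightarrow> x = 0\<^sub>v p"
    "\<forall>x\<in>carrier_vec p. (\<forall>w\<in>B. w \<bullet> x = 0) \<longrightarrow> x = 0\<^sub>v p"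
    using subspace_orthonormal_basis[OF XU] .
  obtain T E where T: "T \<subseteq> proj_last q ` V" "T \<subseteq> E" "orthonormal q E" "card E = q"
    "\<forall>x\<in>proj_last q ` V. (\<forall>w\<in>T. w \<bullet> x = 0) \<longrightarrow> x = 0\<^sub>v q"
    "\<forall>x\<in>carrier_vec q. (\<forall>w\<in>E. w \<bullet> x = 0) \<longrightarrow> x = 0\<^sub>v q"
    using subspace_orthonormal_basis[OF YV] .
  have finB: "finite B" "finite E" using orthonormal_one(4)[OF S(3)] orthonormal_one(4)[OF T(3)] by auto
  have finS: "finite S" "finite T" using finite_subset S(2) T(2) finB by auto
  have oS: "orthonormal p S" "orthonormal q T"
    by (rule orthonormal_wrt_subset[OF S(3,2)], rule orthonormal_wrt_subset[OF T(3,2)])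
  have dU: "dim_vecs (p + q) U = card S"
  proof (rule dim_vecs_injective_image[OF U P1(1) _ oS(1) _ S(5)[rule_format]])
    show "x = 0\<^sub>v (p + q)" if "x \<in> U" "P1 *\<^sub>v x = 0\<^sub>v p" for x
      using pos_def_over_J_imp_inj[OF pos that(1) Uc[OF that(1)]] that P1(2)[OF Uc[OF that(1)]] by simp
  qed (simp_all only: img S(1))
  have dV: "dim_vecs (p + q) V = card T"
  proof (rule dim_vecs_injective_image[OF V P2(1) _ oS(2) _ T(5)[rule_format]])
    show "x = 0\<^sub>v (p + q)" if "x \<in> V" "P2 *\<^sub>v x = 0\<^sub>v q" for x
      using neg_def_over_J_imp_inj[OF neg that(1) Vc[OF that(1)]] that P2(2)[OF Vc[OF that(1)]] by simp
  qed (simp_all only: img T(1))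
  note Z = dim_annihilating_mats[OF XU YV S(1,2,3) S(5,6)[rule_format] T(1,2,3) T(5,6)[rule_format], folded annihilating_mats_def]
  have "affine_dim_mats p q (W_set p q U V) = card (B - S) * card (E - T)"
    unfolding affine_dim_mats_def W_set_directions[OF R] by (rule Z(1))
  \<comment> \<open>Because \<open>S \<subseteq> B\<close> and \<open>card B = p\<close>, one has
    \<open>card S \<le> p\<close>, and similarly for \<open>T\<close>; the truncated subtractions
    are genuine ones.\<close>
  then show "affine_dim_mats p q (W_set p q U V) = (p - dim_vecs (p + q) U) * (q - dim_vecs (p + q) V)"
    using card_Diff_subset[OF finS(1) S(2)] card_Diff_subset[OF finS(2) T(2)] S(4) T(4) by (simp add: dU dV)
  have "B = S \<longleftrightarrow> card S = p" using card_subset_eq[OF finB(1) S(2)] S(4) by auto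
  moreover have "E = T \<longleftrightarrow> card T = q" using card_subset_eq[OF finB(2) T(2)] T(4) by auto
  moreover have "W_dirs p q U V \<subseteq> {0\<^sub>m p q} \<longleftrightarrow> B = S \<or> E = T"
    by (rule Z(2))
  ultimately show "W_dirs p q U V \<subseteq> {0\<^sub>m p q} \<longleftrightarrow>
      dim_vecs (p + q) U = p \<or> dim_vecs (p + q) V = q"
    unfolding dU dV by (simp only:)
qed

section \<open>The solution set and uniqueness\<close>

lemma is_solution_Y_mat_iff:
  assumes A: "A \<in> sym_mats (p + q)" and B: "B \<in> sym_mats (p + q)" and J: "A - B = J_mat p q"
    and U: "U \<subseteq> carrier_vec (p + q)" and V: "V \<subseteq> carrier_vec (p + q)" and M: "M \<in> carrier_mat p q"
  shows "is_solution (p + q) A B U V (A - Y_mat p q M) \<longleftrightarrow> phi_pq p q M \<in> W_set p q U V"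
proof -
  have "(\<forall>u\<in>U. Y_mat p q M *\<^sub>v u = J_mat p q *\<^sub>v u) \<longleftrightarrow>
      (\<forall>u\<in>U. transpose_mat (phi_pq p q M) *\<^sub>v proj_first p u + proj_last q u = 0\<^sub>v q)"
    using Y_mat_agrees[OF M] U by (intro ball_cong refl) blast
  moreover have "(\<forall>v\<in>V. Y_mat p q M *\<^sub>v v = 0\<^sub>v (p + q)) \<longleftrightarrow>
      (\<forall>v\<in>V. phi_pq p q M *\<^sub>v proj_last q v + proj_first p v = 0\<^sub>v p)"
    using Y_mat_kernel[OF M] V by (intro ball_cong refl) blast
  ultimately show ?thesis
    unfolding is_solution_iff[OF A B Y_mat_sym[OF M] U V] J W_set_def
    using Y_mat_minimal[OF M] phi_pq_carrier[OF M] by blast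
qed

text \<open>The minimal matrices above \<open>J_mat p q\<close> are exactly the candidates, and the
  interpolation conditions select those with phi(M) in \<open>W\<close>. Membership in the ball
  comes from \<open>phi_pq_in_unit_ball\<close>.\<close>

lemma solution_set_eq:
  assumes A: "A \<in> sym_mats (p + q)" and B: "B \<in> sym_mats (p + q)" and J: "A - B = J_mat p q"
    and U: "U \<subseteq> carrier_vec (p + q)" and V: "V \<subseteq> carrier_vec (p + q)"
  shows "{C. is_solution (p + q) A B U V C} =
    (\<lambda>M. A - Y_mat p q M) ` {M \<in> carrier_mat p q. phi_pq p q M \<in> unit_ball_mats p q \<inter> W_set p q U V}"
    (is "?L = ?R")
proof (intro equalityI subsetI)
  fix C assume "C \<in> ?L"
  then have C: "is_solution (p + q) A B U V C" by simp
  then have Cs: "C \<in> sym_mats (p + q)" and min: "max_lower_bound (p + q) A B C"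
    by (simp_all add: is_solution_def max_lower_bound_def)
  have "minimal_above (p + q) (J_mat p q) (A - C)"
    using min unfolding max_lower_bound_iff_minimal_above[OF A B Cs] J .
  then obtain M where M: "M \<in> carrier_mat p q" "A - C = Y_mat p q M"
    using minimal_above_J_imp_Y_mat by blast
  have CA: "C = A - Y_mat p q M"
    unfolding M(2)[symmetric] using sym_matsD(1)[OF A] sym_matsD(1)[OF Cs] by (intro eq_matI) auto
  have "phi_pq p q M \<in> W_set p q U V"
    using C is_solution_Y_mat_iff[OF A B J U V M(1)] CA by simp
  then show "C \<in> ?R"
    using M(1) phi_pq_in_unit_ball[OF M(1)] CA by blast
next
  fix C assume "C \<in> ?R"
  then show "C \<in> ?L"
    using is_solution_Y_mat_iff[OF A B J U V] by blast
qed

lemma diff_Y_mat_inj: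
  assumes A: "A \<in> carrier_mat (p + q) (p + q)" and M: "M \<in> carrier_mat p q" "M' \<in> carrier_mat p q"
    and eq: "A - Y_mat p q M = A - Y_mat p q M'"
  shows "M = M'"
proof -
  have c: "Y_mat p q M \<in> carrier_mat (p + q) (p + q)" "Y_mat p q M' \<in> carrier_mat (p + q) (p + q)"
    using Y_mat_sym[OF M(1)] Y_mat_sym[OF M(2)] sym_matsD by auto
  have diff: "A - (A - X) = X" if "X \<in> carrier_mat (p + q) (p + q)" for X
    using A that by (intro eq_matI) auto
  have "Y_mat p q M = A - (A - Y_mat p q M)" by (rule diff[OF c(1), symmetric])
  also have "\<dots> = A - (A - Y_mat p q M')" by (simp only: eq)
  also have "\<dots> = Y_mat p q M'" by (rule diff[OF c(2)])
  finally show ?thesis by (rule Y_mat_inj[OF M])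
qed

text \<open>A nonzero direction of \<open>W\<close> leads from \<open>R\<close> to a second point of
  \<open>W\<close> in the ball; surjectivity of phi and injectivity of the parametrization turn it
  into a second solution. Without nonzero directions \<open>W\<close> is the single point
  \<open>R\<close>, and injectivity of phi leaves one \<open>M\<close>.\<close>

lemma unique_solution_iff:
  assumes A: "A \<in> sym_mats (p + q)" and B: "B \<in> sym_mats (p + q)" and J: "A - B = J_mat p q"
    and U: "U \<subseteq> carrier_vec (p + q)" and V: "V \<subseteq> carrier_vec (p + q)"
    and R: "R \<in> unit_ball_mats p q" "R \<in> W_set p q U V"
  shows "(\<exists>!C. is_solution (p + q) A B U V C) \<longleftrightarrow>
    W_dirs p q U V \<subseteq> {0\<^sub>m p q}" (is "?L \<longleftrightarrow> ?Z \<subseteq> _")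
proof
  have Rc: "R \<in> carrier_mat p q" using R(2) by (simp add: W_set_def)
  note sol = is_solution_Y_mat_iff[OF A B J U V]
  obtain M where M: "M \<in> carrier_mat p q" "phi_pq p q M = R" using phi_pq_surj[OF R(1)] by blast
  then have solM: "is_solution (p + q) A B U V (A - Y_mat p q M)" using sol R(2) by simp
  show "?Z \<subseteq> {0\<^sub>m p q}" if ?L
  proof
    fix D assume D: "D \<in> ?Z"
    then have Dc: "D \<in> carrier_mat p q" by (simp add: annihilating_mats_def)
    obtain e where e: "e > 0" "R + e \<cdot>\<^sub>m D \<in> unit_ball_mats p q"
      using unit_ball_mats_open_direction[OF R(1) Dc] by blast
    have sm: "(e \<cdot>\<^sub>m X) *\<^sub>v x = 0\<^sub>v k" if "X *\<^sub>v x = 0\<^sub>v k" "X \<in> carrier_mat k l" "x \<in> carrier_vec l"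
      for X :: "real mat" and x k l
    proof -
      have "(e \<cdot>\<^sub>m X) *\<^sub>v x = e \<cdot>\<^sub>v (X *\<^sub>v x)" using that(2,3) by (intro eq_vecI) auto
      also have "\<dots> = 0\<^sub>v k" unfolding that(1) by (intro eq_vecI) auto
      finally show ?thesis .
    qed
    have t: "transpose_mat (e \<cdot>\<^sub>m D) = e \<cdot>\<^sub>m transpose_mat D" by (intro eq_matI) auto
    have Dt: "transpose_mat D \<in> carrier_mat q p" using Dc by simp
    have "e \<cdot>\<^sub>m D \<in> ?Z"
      using D Dc sm[OF _ Dt] sm[OF _ Dc] by (auto simp: annihilating_mats_def t)
    then have W: "R + e \<cdot>\<^sub>m D \<in> W_set p q U V" using W_set_translate[OF R(2), of "e \<cdot>\<^sub>m D"] Dc by simp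
    obtain M' where M': "M' \<in> carrier_mat p q" "phi_pq p q M' = R + e \<cdot>\<^sub>m D"
      using phi_pq_surj[OF e(2)] by blast
    then have "is_solution (p + q) A B U V (A - Y_mat p q M')" using sol W by simp
    then have "A - Y_mat p q M = A - Y_mat p q M'" using that solM by blast
    then have "M = M'" by (rule diff_Y_mat_inj[OF sym_matsD(1)[OF A] M(1) M'(1)])
    then have "R + e \<cdot>\<^sub>m D = R" using M(2) M'(2) by simp
    then have eq: "(R + e \<cdot>\<^sub>m D) $$ (i,j) = R $$ (i,j)" for i j by simp
    have "D $$ (i,j) = 0" if "i < p" "j < q" for i j
      using eq[of i j] that Rc Dc e(1) by simp
    then have "D = 0\<^sub>m p q" using Dc by (intro eq_matI) auto
    then show "D \<in> {0\<^sub>m p q}" by simp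
  qed
  assume Z: "?Z \<subseteq> {0\<^sub>m p q}"
  show ?L
  proof (rule ex1I[where a = "A - Y_mat p q M"])
    show "is_solution (p + q) A B U V (A - Y_mat p q M)" by (rule solM)
    fix C assume "is_solution (p + q) A B U V C"
    then obtain M' where M': "M' \<in> carrier_mat p q" "C = A - Y_mat p q M'" "phi_pq p q M' \<in> W_set p q U V"
      using solution_set_eq[OF A B J U V] by blast
    define R' where "R' = phi_pq p q M'"
    have Rc': "R' \<in> carrier_mat p q" using phi_pq_carrier[OF M'(1)] by (simp add: R'_def)
    have RR: "R + (R' - R) = R'" using Rc Rc' by (intro eq_matI) auto
    have "R' - R \<in> ?Z"
      using W_set_translate[OF R(2) minus_carrier_mat[OF Rc], of R'] M'(3) unfolding RR by (simp add: R'_def)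
    then have "R' - R = 0\<^sub>m p q" using Z by blast
    then have "R' = R" by (rule mat_eq_if_diff_0[OF Rc' Rc])
    then have "M' = M" using phi_pq_inj[OF M'(1) M(1)] M(2) by (simp add: R'_def)
    then show "C = A - Y_mat p q M" using M'(2) by simp
  qed
qed

theorem theorem4p3:
  fixes n p q :: nat and A B :: "real mat" and U V :: "real vec set"
  assumes A: "A \<in> sym_mats n" and B: "B \<in> sym_mats n"
    and inert: "inertia (A - B) = (p, q, 0)"
    and U: "subspace_n n U" and V: "subspace_n n V"
  shows "((\<exists>C. is_solution n A B U V C) \<longleftrightarrow>
            pos_def_over n (A - B) U \<and> neg_def_over n (A - B) V \<and>
            (\<forall>u \<in> U. \<forall>v \<in> V. u \<bullet> ((A - B) *\<^sub>v v) = 0))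
       \<and> ((A - B = J_mat p q \<and> pos_def_over n (A - B) U \<and> neg_def_over n (A - B) V \<and>
            (\<forall>u \<in> U. \<forall>v \<in> V. u \<bullet> ((A - B) *\<^sub>v v) = 0)) \<longrightarrow>
            unit_ball_mats p q \<inter> W_set p q U V \<noteq> {}
          \<and> {C. is_solution n A B U V C} =
              (\<lambda>M. A - S_mat p q M * E_mat p q * S_mat p q M) `
                {M \<in> carrier_mat p q. phi_pq p q M \<in> unit_ball_mats p q \<inter> W_set p q U V}
          \<and> inj_on (\<lambda>M. A - S_mat p q M * E_mat p q * S_mat p q M)
                {M \<in> carrier_mat p q. phi_pq p q M \<in> unit_ball_mats p q \<inter> W_set p q U V}
          \<and> affine_dim_mats p q (W_set p q U V) = (p - dim_vecs n U) * (q - dim_vecs n V)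
          \<and> ((\<exists>!C. is_solution n A B U V C) \<longleftrightarrow> dim_vecs n U = p \<or> dim_vecs n V = q))"
  (is "?part1 \<and> (?cond \<longrightarrow> ?part2)")
proof (intro conjI[OF solution_exists_iff[OF A B inert U V]] impI)
  assume asm: ?cond
  then have J: "A - B = J_mat p q" by blast
  \<comment> \<open>\<open>n = p + q\<close> is read off from the size of
    \<open>J_mat p q\<close>.\<close>
  have "dim_row (A - B) = n" using sym_matsD(1)[OF B] by simp
  then have n: "n = p + q" by (simp add: J J_mat_def)
  note A' = A[unfolded n] and B' = B[unfolded n] and U' = U[unfolded n] and V' = V[unfolded n]
  have UV: "U \<subseteq> carrier_vec (p + q)" "V \<subseteq> carrier_vec (p + q)" using U' V' by (auto simp: subspace_n_def)
  have pos: "pos_def_over (p + q) (J_mat p q) U" and neg: "neg_def_over (p + q) (J_mat p q) V"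
    using asm unfolding n J by blast+
  note sols = solution_set_eq[OF A' B' J UV]
  \<comment> \<open>Nonemptiness of the slice comes from the solvability criterion: a solution
    exists, and the description of all solutions turns it into a point \<open>R\<close> of the ball
    in \<open>W\<close>.\<close>
  obtain C where "is_solution (p + q) A B U V C"
    using solution_exists_iff[OF A B inert U V] asm unfolding n by blast
  then have "C \<in> (\<lambda>M. A - Y_mat p q M) ` {M \<in> carrier_mat p q. phi_pq p q M \<in> unit_ball_mats p q \<inter> W_set p q U V}"
    using sols by blast
  then obtain R where R: "R \<in> unit_ball_mats p q" "R \<in> W_set p q U V" by blast
  show ?part2
  proof (intro conjI)
    show "unit_ball_mats p q \<inter> W_set p q U V \<noteq> {}" using R by blast
    show "{C. is_solution n A B U V C} = (\<lambda>M. A - S_mat p q M * E_mat p q * S_mat p q M) `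
        {M \<in> carrier_mat p q. phi_pq p q M \<in> unit_ball_mats p q \<inter> W_set p q U V}"
      unfolding n by (rule sols)
    show "inj_on (\<lambda>M. A - S_mat p q M * E_mat p q * S_mat p q M)
        {M \<in> carrier_mat p q. phi_pq p q M \<in> unit_ball_mats p q \<inter> W_set p q U V}"
    proof (rule inj_onI)
      fix M M' assume "M \<in> {M \<in> carrier_mat p q. phi_pq p q M \<in> unit_ball_mats p q \<inter> W_set p q U V}"
        "M' \<in> {M \<in> carrier_mat p q. phi_pq p q M \<in> unit_ball_mats p q \<inter> W_set p q U V}"
      then have M: "M \<in> carrier_mat p q" "M' \<in> carrier_mat p q" by simp_all
      assume "A - S_mat p q M * E_mat p q * S_mat p q M = A - S_mat p q M' * E_mat p q * S_mat p q M'"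
      then show "M = M'" by (rule diff_Y_mat_inj[OF sym_matsD(1)[OF A'] M])
    qed
    show "affine_dim_mats p q (W_set p q U V) = (p - dim_vecs n U) * (q - dim_vecs n V)"
      unfolding n by (rule W_set_dimension(1)[OF U' V' pos neg R(2)])
    show "(\<exists>!C. is_solution n A B U V C) \<longleftrightarrow> dim_vecs n U = p \<or> dim_vecs n V = q"
      unfolding n unique_solution_iff[OF A' B' J UV R] by (rule W_set_dimension(2)[OF U' V' pos neg R(2)])
  qed
qed

end
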